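(* Let $\mathbf H\in\mathcal H(r)^+$ and let $H:\mathcal P_{as}^+\to\mathcal P_{as}^+$ be the operator given by the action of $\mathbf H$ in the standard representation of $\mathcal H^+$. Then $H=0$ if and only if $\varphi_k(\mathbf H)=0$ for all $k\ge r$ large enough.
   Context: Let $\mathbb K=\mathbb Q(t,q)$. Stable limit DAHA. $\mathcal H^+$ is the $\mathbb K$-algebra generated by $\mathbf T_i,\mathbf X_i,\mathbf Y_i$, $i\ge1$, with relations: $\mathbf T_i\mathbf T_j=\mathbf T_j\mathbf T_i$ for $|i-j|>1$; $\mathbf T_i\mathbf T_{i+1}\mathbf T_i=\mathbf T_{i+1}\mathbf T_i\mathbf T_{i+1}$; $(\mathbf T_i-1)(\mathbf T_i+t)=0$; $t\mathbf T_i^{-1}\mathbf X_i\mathbf T_i^{-1}=\mathbf X_{i+1}$; $\mathbf T_i\mathbf X_j=\mathbf X_j\mathbf T_i$ for $j\ne i,i+1$; $\mathbf X_i\mathbf X_j=\mathbf X_j\mathbf X_i$; $t^{-1}\mathbf T_i\mathbf Y_i\mathbf T_i=\mathbf Y_{i+1}$; $\mathbf T_i\mathbf Y_j=\mathbf Y_j\mathbf T_i$ for $j\ne i,i+1$; $\mathbf Y_i\mathbf Y_j=\mathbf Y_j\mathbf Y_i$; $\mathbf Y_1\mathbf T_1\mathbf X_1=\mathbf X_2\mathbf Y_1\mathbf T_1$. For $k\ge2$, $\mathcal H(k)^+\subset\mathcal H^+$ is the subalgebra generated by $\mathbf T_i$ ($1\le i\le k-1$) and $\mathbf X_i,\mathbf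 Y_i$ ($1\le i\le k$). DAHA of type $GL_k$. $\mathcal H_k$ is the $\mathbb K$-algebra generated by $T_i$ ($1\le i\le k-1$) and $X_i^{\pm1},Y_i^{\pm1}$ ($1\le i\le k$) with the same relations (for indices in range) and $Y_1X_1\cdots X_k=qX_1\cdots X_kY_1$; $\mathcal H_k^+$ is the subalgebra generated by the $T_i$, $X_i$, $Y_i$ (no inverses of $X_i,Y_i$). There is a canonical algebra morphism $\varphi_k:\mathcal H(k)^+\to\mathcal H_k^+$ sending $\mathbf T_i,\mathbf X_i,\mathbf Y_i$ to $T_i,X_i,Y_i$; since $\mathcal H(r)^+\subseteq\mathcal H(k)^+$ for $k\ge r$, $\varphi_k$ is defined on $\mathcal H(r)^+$. Almost symmetric module. For $k\ge1$ let $\mathcal P_k^+=\mathbb K[x_1,\dots,x_k]$, and $\pi_k:\mathcal P_k^+\to\mathcal P_{k-1}^+$ evaluation at $x_k=0$. Let $\mathcal P_\infty^+$ be the graded inverse limit, with canonical maps $\Pi_k:\mathcal P_\infty^+\to\mathcal P_k^+$. The simple transpositions $s_i$ act on $\mathcal P_\infty^+$. Put $\mathcal P(k)^+=\{F\in\mathcal P_\infty^+: s_iF=F\ \forall i>k\}$ and $\mathcal P_{as}^+=\bigcup_{k\ge0}\mathcal P(k)^+$. Limits. For $R=A/B\in\mathbb K$ with $A,B\in\mathbb Q[t,q]$, $\operatorname{ord}R$ is the order of vanishing of $A$ at $t=0$ minus that of $B$; $(a_n)$ in $\mathbb K$ converges to $a$ if $\operatorname{ord}(a_n-a)\to+\infty$.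 A sequence $(f_k)$, $f_k\in\mathcal P_k^+$, is convergent if there are $N\ge 1$ and $h_k,g_{i,k}\in\mathcal P_k^+$, $a_{i,k}\in\mathbb K$ ($1\le i\le N$) with $f_k=h_k+\sum_{i=1}^Na_{i,k}g_{i,k}$, $\pi_k(h_k)=h_{k-1}$, $\pi_k(g_{i,k})=g_{i,k-1}$, the element $g_i\in\mathcal P_\infty^+$ defined by $(g_{i,k})_k$ lying in $\mathcal P_{as}^+$, and $(a_{i,k})_k$ converging to some $a_i$. Then $\lim_kf_k:=h+\sum_ia_ig_i$, $h$ being defined by $(h_k)$ (independent of choices). For operators $A_k$ on $\mathcal P_k^+$, $\lim_kA_k$ is the operator $f\mapsto\lim_kA_k\Pi_kf$ on $\mathcal P_{as}^+$, provided these limits exist and lie in $\mathcal P_{as}^+$. Standard representation. On $\mathcal P_k^+$ let $T_i^{(k)}f=s_if+(1-t)x_i\frac{f-s_if}{x_i-x_{i+1}}$, $X_i^{(k)}f=x_if$, $\varpi_kf=\mathrm{pr}_1f(x_2,\dots,x_k,qx_1)$ (with $\mathrm{pr}_1$ the linear map that is the identity on monomials divisible by $x_1$ and zero on the other monomials), and $\widetilde Y_i^{(k)}=t^{k+1-i}T_{i-1}^{(k)}\cdots T_1^{(k)}\varpi_k(T_{k-1}^{(k)})^{-1}\cdots(T_i^{(k)})^{-1}$. The limit operators $\mathscr T_i=\lim_kT_i^{(k)}$, $\mathscr X_i=\lim_kX_i^{(k)}$, $\mathscr Y_i=\lim_k\widetilde Y_i^{(k)}$ on $\mathcal P_{as}^+$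 are known to exist, and $\mathbf T_i\mapsto\mathscr T_i$, $\mathbf X_i\mapsto\mathscr X_i$, $\mathbf Y_i\mapsto\mathscr Y_i$ is known to define a representation of $\mathcal H^+$ on $\mathcal P_{as}^+$, called the standard representation. *)

theory Defs
  imports
    "HOL-Computational_Algebra.Fraction_Field"
    "HOL-Computational_Algebra.Polynomial"
    "HOL-Library.Poly_Mapping"
    "HOL-Library.FuncSet"
    "HOL-Algebra.QuotRing"
    "HOL-Algebra.Generated_Rings"
begin

section \<open>The coefficient field\<close>

text \<open>The field of rational functions in \<open>t\<close>, \<open>q\<close> over the rationals. The outer polynomial
  variable is \<open>t\<close>, the inner one is \<open>q\<close>.\<close>

type_synonym coef = "rat poly poly fract"

definition tK :: coef where
  "tK = Fraction_Field.Fract [:0, 1:] 1"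

definition qK :: coef where
  "qK = Fraction_Field.Fract [:[:0, 1:]:] 1"

text \<open>Order at \<open>t = 0\<close>, meaningful for nonzero arguments only; the order of zero is infinite,
  which is why \<open>convK\<close> treats \<open>a n = l\<close> separately.\<close>

definition ordK :: "coef \<Rightarrow> int" where
  "ordK R = (THE n. \<exists>A B. A \<noteq> 0 \<and> B \<noteq> 0 \<and> R = Fraction_Field.Fract A B \<and>
     n = int (Polynomial.order 0 A) - int (Polynomial.order 0 B))"

definition convK :: "(nat \<Rightarrow> coef) \<Rightarrow> coef \<Rightarrow> bool" where
  "convK a l \<longleftrightarrow> (\<forall>m::int. \<forall>\<^sub>F n in sequentially. a n = l \<or> m \<le> ordK (a n - l))"


section \<open>Algebras given by generators and relations\<close>

text \<open>The free monoid on \<open>'g\<close>, written additively so that finitely supported functions on it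
  with the convolution product form the free associative algebra.\<close>

datatype 'g fword = Fword (letters: "'g list")

instantiation fword :: (type) monoid_add
begin

definition zero_fword :: "'a fword" where
  "zero_fword = Fword []"

definition plus_fword :: "'a fword \<Rightarrow> 'a fword \<Rightarrow> 'a fword" where
  "plus_fword u v = Fword (letters u @ letters v)"

instance
  by standard (simp_all add: zero_fword_def plus_fword_def)

end

type_synonym 'g falg = "'g fword \<Rightarrow>\<^sub>0 coef"

definition scal :: "coef \<Rightarrow> 'g falg" where
  "scal c = Poly_Mapping.single 0 c"

definition gen :: "'g \<Rightarrow> 'g falg" where
  "gen g = Poly_Mapping.single (Fword [g]) 1"

definition free_alg :: "'g set \<Rightarrow> 'g falg ring" where
  "free_alg G = \<lparr>carrier = {a. \<forall>w\<in>Poly_Mapping.keys a. set (letters w) \<subseteq> G},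
     mult = (*), one = 1, zero = 0, add = (+)\<rparr>"

text \<open>A relation \<open>l = r\<close> is represented by the relator \<open>l - r\<close>.\<close>

definition presented_alg :: "'g set \<Rightarrow> 'g falg set \<Rightarrow> 'g falg set ring" where
  "presented_alg G R = free_alg G Quot (Idl\<^bsub>free_alg G\<^esub> R)"

definition pres_class :: "'g set \<Rightarrow> 'g falg set \<Rightarrow> 'g falg \<Rightarrow> 'g falg set" where
  "pres_class G R a = Idl\<^bsub>free_alg G\<^esub> R +>\<^bsub>free_alg G\<^esub> a"


section \<open>The stable limit DAHA and the DAHAs of type GL\<close>

text \<open>\<open>GXi i\<close> and \<open>GYi i\<close> stand for the inverses of \<open>GX i\<close> and \<open>GY i\<close>; they occur
  only in the algebras of finite rank.\<close>

datatype dgen = GT nat | GX nat | GY nat | GXi nat | GYi nat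

abbreviation TT :: "nat \<Rightarrow> dgen falg" where "TT i \<equiv> gen (GT i)"
abbreviation XX :: "nat \<Rightarrow> dgen falg" where "XX i \<equiv> gen (GX i)"
abbreviation YY :: "nat \<Rightarrow> dgen falg" where "YY i \<equiv> gen (GY i)"
abbreviation XI :: "nat \<Rightarrow> dgen falg" where "XI i \<equiv> gen (GXi i)"
abbreviation YI :: "nat \<Rightarrow> dgen falg" where "YI i \<equiv> gen (GYi i)"

text \<open>The quadratic relation \<open>(T - 1) (T + t) = 0\<close> says \<open>T (T + t - 1) = t\<close>, so the inverse
  of \<open>T\<close> is the following element.\<close>

definition Tinv :: "nat \<Rightarrow> dgen falg" where
  "Tinv i = scal (inverse tK) * (TT i + scal (tK - 1))"

text \<open>The common relations: \<open>I\<close> is the index range of the \<open>T\<close>'s and \<open>J\<close> that of the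
  \<open>X\<close>'s and \<open>Y\<close>'s, where \<open>i, i + 1 \<in> J\<close> whenever \<open>i \<in> I\<close>.\<close>

definition daha_relators :: "nat set \<Rightarrow> nat set \<Rightarrow> dgen falg set" where
  "daha_relators I J =
     {TT i * TT j - TT j * TT i | i j. i \<in> I \<and> j \<in> I \<and> (i + 1 < j \<or> j + 1 < i)}
   \<union> {TT i * TT (i + 1) * TT i - TT (i + 1) * TT i * TT (i + 1) | i. i \<in> I \<and> i + 1 \<in> I}
   \<union> {(TT i - 1) * (TT i + scal tK) | i. i \<in> I}
   \<union> {scal tK * Tinv i * XX i * Tinv i - XX (i + 1) | i. i \<in> I}
   \<union> {TT i * XX j - XX j * TT i | i j. i \<in> I \<and> j \<in> J \<and> j \<noteq> i \<and> j \<noteq> i + 1}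
   \<union> {XX i * XX j - XX j * XX i | i j. i \<in> J \<and> j \<in> J}
   \<union> {scal (inverse tK) * TT i * YY i * TT i - YY (i + 1) | i. i \<in> I}
   \<union> {TT i * YY j - YY j * TT i | i j. i \<in> I \<and> j \<in> J \<and> j \<noteq> i \<and> j \<noteq> i + 1}
   \<union> {YY i * YY j - YY j * YY i | i j. i \<in> J \<and> j \<in> J}
   \<union> {r. r = YY 1 * TT 1 * XX 1 - XX 2 * YY 1 * TT 1 \<and> 1 \<in> I}"

definition sdaha_gens :: "dgen set" where
  "sdaha_gens = GT ` {1..} \<union> GX ` {1..} \<union> GY ` {1..}"

definition sdaha_relators :: "dgen falg set" where
  "sdaha_relators = daha_relators {1..} {1..}"

definition sdaha :: "dgen falg set ring" where
  "sdaha = presented_alg sdaha_gens sdaha_relators"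

abbreviation sdaha_class :: "dgen falg \<Rightarrow> dgen falg set" where
  "sdaha_class \<equiv> pres_class sdaha_gens sdaha_relators"

definition sdaha_sub :: "nat \<Rightarrow> dgen falg set set" where
  "sdaha_sub k = generate_ring sdaha (sdaha_class `
     (range scal \<union> TT ` {1..<k} \<union> XX ` {1..k} \<union> YY ` {1..k}))"

definition daha_gens :: "nat \<Rightarrow> dgen set" where
  "daha_gens k = GT ` {1..<k} \<union> GX ` {1..k} \<union> GY ` {1..k} \<union> GXi ` {1..k} \<union> GYi ` {1..k}"

definition Xprod :: "nat \<Rightarrow> dgen falg" where
  "Xprod k = prod_list (map XX [1..<Suc k])"

definition gl_relators :: "nat \<Rightarrow> dgen falg set" where
  "gl_relators k = daha_relators {1..<k} {1..k}
   \<union> {XX i * XI i - 1 | i. i \<in> {1..k}} \<union> {XI i * XX i - 1 | i. i \<in> {1..k}}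
   \<union> {YY i * YI i - 1 | i. i \<in> {1..k}} \<union> {YI i * YY i - 1 | i. i \<in> {1..k}}
   \<union> {YY 1 * Xprod k - scal qK * Xprod k * YY 1}"

definition daha :: "nat \<Rightarrow> dgen falg set ring" where
  "daha k = presented_alg (daha_gens k) (gl_relators k)"

abbreviation daha_class :: "nat \<Rightarrow> dgen falg \<Rightarrow> dgen falg set" where
  "daha_class k \<equiv> pres_class (daha_gens k) (gl_relators k)"

definition daha_plus :: "nat \<Rightarrow> dgen falg set set" where
  "daha_plus k = generate_ring (daha k) (daha_class k `
     (range scal \<union> TT ` {1..<k} \<union> XX ` {1..k} \<union> YY ` {1..k}))"

text \<open>Extensionality makes the morphism, which is determined on generators, unique as a
  total function.\<close>

definition canonical_morphism :: "nat \<Rightarrow> (dgen falg set \<Rightarrow> dgen falg set) \<Rightarrow> bool" where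
  "canonical_morphism k \<phi> \<longleftrightarrow>
     \<phi> \<in> extensional (sdaha_sub k) \<and>
     \<phi> \<in> ring_hom (sdaha\<lparr>carrier := sdaha_sub k\<rparr>) ((daha k)\<lparr>carrier := daha_plus k\<rparr>) \<and>
     (\<forall>c. \<phi> (sdaha_class (scal c)) = daha_class k (scal c)) \<and>
     (\<forall>i\<in>{1..<k}. \<phi> (sdaha_class (TT i)) = daha_class k (TT i)) \<and>
     (\<forall>i\<in>{1..k}. \<phi> (sdaha_class (XX i)) = daha_class k (XX i) \<and>
                 \<phi> (sdaha_class (YY i)) = daha_class k (YY i))"

definition phi :: "nat \<Rightarrow> dgen falg set \<Rightarrow> dgen falg set" where
  "phi k = (THE \<phi>. canonical_morphism k \<phi>)"


section \<open>Polynomials and the almost symmetric module\<close>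

text \<open>Polynomials in variables indexed by the natural numbers; only the indices from 1 on
  are used.\<close>

type_synonym pol = "(nat \<Rightarrow>\<^sub>0 nat) \<Rightarrow>\<^sub>0 coef"

definition Cst :: "coef \<Rightarrow> pol" where
  "Cst c = Poly_Mapping.single 0 c"

definition Var :: "nat \<Rightarrow> pol" where
  "Var i = Poly_Mapping.single (Poly_Mapping.single i 1) 1"

text \<open>The substitution homomorphism replacing the variable with index \<open>i\<close> by \<open>\<sigma> i\<close>.\<close>

definition subst_pol :: "(nat \<Rightarrow> pol) \<Rightarrow> pol \<Rightarrow> pol" where
  "subst_pol \<sigma> f = (\<Sum>m\<in>Poly_Mapping.keys f.
     Cst (Poly_Mapping.lookup f m) * (\<Prod>i\<in>Poly_Mapping.keys m. \<sigma> i ^ Poly_Mapping.lookup m i))"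

definition Pk :: "nat \<Rightarrow> pol set" where
  "Pk k = {f. \<forall>m\<in>Poly_Mapping.keys f. Poly_Mapping.keys m \<subseteq> {1..k}}"

definition mdeg :: "(nat \<Rightarrow>\<^sub>0 nat) \<Rightarrow> nat" where
  "mdeg m = (\<Sum>i\<in>Poly_Mapping.keys m. Poly_Mapping.lookup m i)"

definition proj :: "nat \<Rightarrow> pol \<Rightarrow> pol" where
  "proj k = subst_pol (\<lambda>j. if j = k then 0 else Var j)"

definition swap_pol :: "nat \<Rightarrow> pol \<Rightarrow> pol" where
  "swap_pol i = subst_pol (\<lambda>j. Var (if j = i then i + 1 else if j = i + 1 then i else j))"

text \<open>The graded inverse limit: compatible sequences of uniformly bounded degree. The canonical
  map to \<open>Pk k\<close> is \<open>F \<mapsto> F k\<close>; the component \<open>F 0\<close> is the constant term.\<close>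

definition Pinf :: "(nat \<Rightarrow> pol) set" where
  "Pinf = {F. (\<forall>k. F k \<in> Pk k) \<and> (\<forall>k\<ge>1. proj k (F k) = F (k - 1)) \<and>
     (\<exists>d. \<forall>k. \<forall>m\<in>Poly_Mapping.keys (F k). mdeg m \<le> d)}"

text \<open>The component in \<open>Pk k\<close> of the image of \<open>F\<close> under the \<open>i\<close>-th simple transposition is
  \<open>swap_pol i (F k)\<close> if \<open>k > i\<close>. For \<open>k \<le> i\<close> that polynomial need not lie in \<open>Pk k\<close>, and the
  component is the image of the one in \<open>Pk (i + 1)\<close>.\<close>

definition swap_inf :: "nat \<Rightarrow> (nat \<Rightarrow> pol) \<Rightarrow> nat \<Rightarrow> pol" where
  "swap_inf i F = (\<lambda>k. subst_pol (\<lambda>j. if j \<le> k then Var j else 0)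
     (swap_pol i (F (max k (i + 1)))))"

definition Psym :: "nat \<Rightarrow> (nat \<Rightarrow> pol) set" where
  "Psym k = {F \<in> Pinf. \<forall>i>k. swap_inf i F = F}"

definition Pas :: "(nat \<Rightarrow> pol) set" where
  "Pas = (\<Union>k. Psym k)"


section \<open>Limits\<close>

text \<open>The decomposition is only required for large \<open>k\<close>, because operators such as the \<open>i\<close>-th
  Demazure-Lusztig operator act on \<open>Pk k\<close> only for \<open>k > i\<close>. For a sequence with all
  \<open>f k \<in> Pk k\<close> this is no weaker than requiring it for all \<open>k\<close>: a discrepancy at finitely many
  \<open>k\<close> can be absorbed in further summands whose coefficient sequences vanish for large \<open>k\<close>.\<close>

definition has_lim :: "(nat \<Rightarrow> pol) \<Rightarrow> (nat \<Rightarrow> pol) \<Rightarrow> bool" where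
  "has_lim f L \<longleftrightarrow> (\<exists>N\<ge>1. \<exists>h\<in>Pinf. \<exists>(g :: nat \<Rightarrow> nat \<Rightarrow> pol) (a :: nat \<Rightarrow> nat \<Rightarrow> coef) (b :: nat \<Rightarrow> coef).
     (\<forall>i\<in>{1..N}. g i \<in> Pas \<and> convK (a i) (b i)) \<and>
     (\<forall>\<^sub>F k in sequentially. f k = h k + (\<Sum>i=1..N. Cst (a i k) * g i k)) \<and>
     L = (\<lambda>k. h k + (\<Sum>i=1..N. Cst (b i) * g i k)))"

definition op_lim :: "(nat \<Rightarrow> pol \<Rightarrow> pol) \<Rightarrow> (nat \<Rightarrow> pol) \<Rightarrow> nat \<Rightarrow> pol" where
  "op_lim A F = (THE L. has_lim (\<lambda>k. A k (F k)) L)"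


section \<open>The standard representation\<close>

text \<open>The quotient \<open>(f - s_i f) / (x_i - x_(i+1))\<close> is the unique \<open>g\<close> below.\<close>

definition opT :: "nat \<Rightarrow> pol \<Rightarrow> pol" where
  "opT i f = swap_pol i f +
     Cst (1 - tK) * Var i * (THE g. g * (Var i - Var (i + 1)) = f - swap_pol i f)"

definition opTinv :: "nat \<Rightarrow> nat \<Rightarrow> pol \<Rightarrow> pol" where
  "opTinv k i = inv_into (Pk k) (opT i)"

definition opX :: "nat \<Rightarrow> pol \<Rightarrow> pol" where
  "opX i f = Var i * f"

definition pr1 :: "pol \<Rightarrow> pol" where
  "pr1 f = (\<Sum>m\<in>{m \<in> Poly_Mapping.keys f. 1 \<le> Poly_Mapping.lookup m 1}.
     Poly_Mapping.single m (Poly_Mapping.lookup f m))"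

definition varpi :: "nat \<Rightarrow> pol \<Rightarrow> pol" where
  "varpi k f = pr1 (subst_pol (\<lambda>j. if j = k then Cst qK * Var 1 else Var (j + 1)) f)"

text \<open>\<open>fold\<close> applies the operators in the order of the list, so the inner \<open>fold\<close> applies the
  inverse of the \<open>i\<close>-th operator first, and the outer one applies the \<open>(i - 1)\<close>-st operator last.\<close>

definition opY :: "nat \<Rightarrow> nat \<Rightarrow> pol \<Rightarrow> pol" where
  "opY k i f = Cst (tK ^ (k + 1 - i)) *
     fold opT [1..<i] (varpi k (fold (opTinv k) [i..<k] f))"

definition limT :: "nat \<Rightarrow> (nat \<Rightarrow> pol) \<Rightarrow> nat \<Rightarrow> pol" where
  "limT i = op_lim (\<lambda>k. opT i)"

definition limX :: "nat \<Rightarrow> (nat \<Rightarrow> pol) \<Rightarrow> nat \<Rightarrow> pol" where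
  "limX i = op_lim (\<lambda>k. opX i)"

definition limY :: "nat \<Rightarrow> (nat \<Rightarrow> pol) \<Rightarrow> nat \<Rightarrow> pol" where
  "limY i = op_lim (\<lambda>k. opY k i)"

definition linear_as :: "((nat \<Rightarrow> pol) \<Rightarrow> nat \<Rightarrow> pol) \<Rightarrow> bool" where
  "linear_as A \<longleftrightarrow>
     (\<forall>F\<in>Pas. \<forall>G\<in>Pas. A (\<lambda>k. F k + G k) = (\<lambda>k. A F k + A G k)) \<and>
     (\<forall>c. \<forall>F\<in>Pas. A (\<lambda>k. Cst c * F k) = (\<lambda>k. Cst c * A F k))"

definition End_as :: "((nat \<Rightarrow> pol) \<Rightarrow> nat \<Rightarrow> pol) ring" where
  "End_as = \<lparr>carrier = {A \<in> Pas \<rightarrow>\<^sub>E Pas. linear_as A},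
     mult = (\<lambda>A B. compose Pas A B), one = (\<lambda>F\<in>Pas. F),
     zero = (\<lambda>F\<in>Pas. (\<lambda>k. 0)), add = (\<lambda>A B. \<lambda>F\<in>Pas. (\<lambda>k. A F k + B F k))\<rparr>"

definition is_std_rep :: "(dgen falg set \<Rightarrow> (nat \<Rightarrow> pol) \<Rightarrow> nat \<Rightarrow> pol) \<Rightarrow> bool" where
  "is_std_rep \<rho> \<longleftrightarrow>
     \<rho> \<in> extensional (carrier sdaha) \<and> \<rho> \<in> ring_hom sdaha End_as \<and>
     (\<forall>c. \<rho> (sdaha_class (scal c)) = (\<lambda>F\<in>Pas. (\<lambda>k. Cst c * F k))) \<and>
     (\<forall>i\<ge>1. \<rho> (sdaha_class (TT i)) = restrict (limT i) Pas \<and>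
             \<rho> (sdaha_class (XX i)) = restrict (limX i) Pas \<and>
             \<rho> (sdaha_class (YY i)) = restrict (limY i) Pas)"

definition std_rep :: "dgen falg set \<Rightarrow> (nat \<Rightarrow> pol) \<Rightarrow> nat \<Rightarrow> pol" where
  "std_rep = (THE \<rho>. is_std_rep \<rho>)"

end

theory Submission
  imports Defs "HOL-Library.Function_Algebras"
begin

text \<open>An element \<open>h\<close> of rank \<open>r\<close> acts on the almost symmetric module as a limit of operators in
  finite rank, and the point is to pass from the limit to finite rank and back.

  Let \<open>Y_i\<close> in rank \<open>k\<close> be the operator without the projection \<open>pr1\<close>. With the \<open>T\<close>'s and \<open>X\<close>'s these
  operators satisfy all relations of the DAHA of type \<open>GL_k\<close>, which therefore acts on rational functions
  (\<open>gl_ideal_act_zero\<close>). On an almost symmetric \<open>F\<close> the operators with and without the projection have the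
  form \<open>A + t^k B\<close> for large \<open>k\<close>, where \<open>A\<close> and \<open>B\<close> are almost symmetric and \<open>A\<close> is the same for both
  (\<open>opYP_stable\<close>). So both have the limit \<open>A\<close>. Errors of positive order in \<open>t^k\<close> survive composition as
  such, hence a word in the generators acts on the almost symmetric module as the limit of its actions in
  rank \<open>k\<close> (\<open>conv_act\<close>). In particular relations that hold in rank \<open>k\<close> for all large \<open>k\<close> hold in the limit
  (\<open>actL_zero\<close>). This gives the existence of the standard representation as well as one direction of the
  theorem.

  For the other direction the error terms must be avoided. On multiples of \<open>x_1 \<dots> x_r\<close> there are
  none: there the generators of rank \<open>r\<close> act compatibly at all levels \<open>k \<ge> r\<close>, and they preserve these
  multiples (\<open>opYP_eP\<close>, \<open>actP_eP\<close>). If the limit operator of \<open>h\<close> is zero, then \<open>h X_1 \<dots> X_r\<close> annihilates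
  the polynomials in \<open>k\<close> variables for every \<open>k \<ge> r\<close>. The polynomial representation is faithful
  (\<open>actM_faithful\<close>), and \<open>X_1 \<dots> X_r\<close> is invertible in the DAHA, so \<open>h\<close> vanishes in rank \<open>k\<close>
  (\<open>actL_zero_imp_ideal\<close>). The same argument, with \<open>r = k\<close>, shows that the canonical morphisms are well
  defined.

  Faithfulness combines a normal form and an independence statement. Modulo the relations every
  element without inverses is a sum of terms \<open>p(X) T_w Y_L\<close> with polynomials \<open>p\<close>, one permutation word \<open>w\<close> for
  each permutation and an ordered word \<open>L\<close> (\<open>pos_words_normal\<close>). Over the rational functions the operators
  \<open>T_w Y_L\<close> span all products of a permutation with multiplicative \<open>q\<close>-shifts of the variables. The latter
  are pairwise distinct automorphisms, so they are independent by Dedekind's theorem, and there are as many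
  of them as there are pairs \<open>(w, L)\<close>. Hence the operators \<open>T_w Y_L\<close> are independent too
  (\<open>TY_independent\<close>).\<close>

section \<open>Polynomials and substitutions\<close>

lemma poly_mapping_sum_single:
  "f = (\<Sum>k\<in>Poly_Mapping.keys f. Poly_Mapping.single k (Poly_Mapping.lookup f k))"
  by (rule poly_mapping_eqI)
     (simp add: lookup_sum lookup_single when_def not_in_keys_iff_lookup_eq_zero)

lemma poly_mapping_additive_induct [case_names zero single add]:
  fixes f :: "'a \<Rightarrow>\<^sub>0 'b::comm_monoid_add"
  assumes "P 0" and "\<And>k c. P (Poly_Mapping.single k c)" and "\<And>f g. P f \<Longrightarrow> P g \<Longrightarrow> P (f + g)"
  shows "P f"
proof -
  have "P (\<Sum>k\<in>A. Poly_Mapping.single k (Poly_Mapping.lookup f k))" if "finite A" for A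
    using that by induction (auto intro: assms)
  then show ?thesis using poly_mapping_sum_single[of f] by (metis finite_keys)
qed

definition mon_img :: "(nat \<Rightarrow> pol) \<Rightarrow> (nat \<Rightarrow>\<^sub>0 nat) \<Rightarrow> pol" where
  "mon_img \<sigma> m = (\<Prod>i\<in>Poly_Mapping.keys m. \<sigma> i ^ Poly_Mapping.lookup m i)"

lemma mon_img_superset:
  assumes "finite A" "Poly_Mapping.keys m \<subseteq> A"
  shows "mon_img \<sigma> m = (\<Prod>i\<in>A. \<sigma> i ^ Poly_Mapping.lookup m i)"
  unfolding mon_img_def
  by (rule prod.mono_neutral_left) (use assms in \<open>auto simp: not_in_keys_iff_lookup_eq_zero\<close>)

lemma mon_img_add: "mon_img \<sigma> (m + n) = mon_img \<sigma> m * mon_img \<sigma> n"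
proof -
  let ?A = "Poly_Mapping.keys m \<union> Poly_Mapping.keys n"
  have "Poly_Mapping.keys (m + n) \<subseteq> ?A" by (rule keys_add)
  then show ?thesis
    by (simp add: mon_img_superset[of ?A] lookup_add power_add prod.distrib)
qed

lemma mon_img_zero [simp]: "mon_img \<sigma> 0 = 1"
  by (simp add: mon_img_def)

lemma mon_img_single [simp]: "mon_img \<sigma> (Poly_Mapping.single i n) = \<sigma> i ^ n"
  by (cases "n = 0") (simp_all add: mon_img_def)

lemma subst_pol_sum:
  "subst_pol \<sigma> f = (\<Sum>m\<in>Poly_Mapping.keys f. Cst (Poly_Mapping.lookup f m) * mon_img \<sigma> m)"
  by (simp add: subst_pol_def mon_img_def)

lemma Cst_zero [simp]: "Cst 0 = 0" by (simp add: Cst_def)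
lemma Cst_one [simp]: "Cst 1 = 1" by (simp add: Cst_def)
lemma Cst_add: "Cst (a + b) = Cst a + Cst b" by (simp add: Cst_def single_add)
lemma Cst_diff: "Cst (a - b) = Cst a - Cst b" by (simp add: Cst_def single_diff)
lemma Cst_uminus: "Cst (- a) = - Cst a" by (simp add: Cst_def single_uminus)
lemma Cst_mult: "Cst (a * b) = Cst a * Cst b" by (simp add: Cst_def mult_single)
lemma Cst_power: "Cst (a ^ n) = Cst a ^ n" by (induction n) (simp_all add: Cst_mult)
lemma Cst_eq_iff [simp]: "Cst a = Cst b \<longleftrightarrow> a = b" by (metis Cst_def lookup_single_eq)
lemma Cst_eq_0_iff [simp]: "Cst a = 0 \<longleftrightarrow> a = 0" by (metis Cst_eq_iff Cst_zero)

lemma subst_pol_superset: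
  assumes "finite A" "Poly_Mapping.keys f \<subseteq> A"
  shows "subst_pol \<sigma> f = (\<Sum>m\<in>A. Cst (Poly_Mapping.lookup f m) * mon_img \<sigma> m)"
  unfolding subst_pol_sum
  by (rule sum.mono_neutral_left) (use assms in \<open>auto simp: not_in_keys_iff_lookup_eq_zero\<close>)

lemma subst_pol_add: "subst_pol \<sigma> (f + g) = subst_pol \<sigma> f + subst_pol \<sigma> g"
proof -
  let ?A = "Poly_Mapping.keys f \<union> Poly_Mapping.keys g"
  have "Poly_Mapping.keys (f + g) \<subseteq> ?A" by (rule keys_add)
  then show ?thesis
    by (simp add: subst_pol_superset[of ?A] lookup_add Cst_add sum.distrib algebra_simps)
qed

lemma subst_pol_single: "subst_pol \<sigma> (Poly_Mapping.single m c) = Cst c * mon_img \<sigma> m"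
  by (cases "c = 0") (simp_all add: subst_pol_sum)

lemma subst_pol_zero [simp]: "subst_pol \<sigma> 0 = 0"
  by (simp add: subst_pol_sum)

lemma subst_pol_mult: "subst_pol \<sigma> (f * g) = subst_pol \<sigma> f * subst_pol \<sigma> g"
proof (induction f rule: poly_mapping_additive_induct)
  case (single m c)
  show ?case
    by (induction g rule: poly_mapping_additive_induct)
       (simp_all add: subst_pol_single mult_single subst_pol_add mon_img_add Cst_mult algebra_simps)
qed (simp_all add: subst_pol_add algebra_simps)

lemma subst_pol_Cst [simp]: "subst_pol \<sigma> (Cst c) = Cst c"
  unfolding Cst_def subst_pol_single by (simp add: Cst_def)

lemma subst_pol_Var [simp]: "subst_pol \<sigma> (Var i) = \<sigma> i"
  by (simp add: Var_def subst_pol_single)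

lemma subst_pol_one [simp]: "subst_pol \<sigma> 1 = 1"
  using subst_pol_Cst[of \<sigma> 1] by simp

lemma subst_pol_uminus: "subst_pol \<sigma> (- f) = - subst_pol \<sigma> f"
proof -
  have "subst_pol \<sigma> (- f) + subst_pol \<sigma> f = 0"
    by (simp flip: subst_pol_add)
  then show ?thesis by (simp add: eq_neg_iff_add_eq_0)
qed

lemma subst_pol_diff: "subst_pol \<sigma> (f - g) = subst_pol \<sigma> f - subst_pol \<sigma> g"
  using subst_pol_add[of \<sigma> f "- g"] by (simp add: subst_pol_uminus)

lemma subst_pol_power: "subst_pol \<sigma> (f ^ n) = subst_pol \<sigma> f ^ n"
  by (induction n) (simp_all add: subst_pol_mult)

lemma subst_pol_prod: "subst_pol \<sigma> (prod f A) = (\<Prod>i\<in>A. subst_pol \<sigma> (f i))"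
  by (induction A rule: infinite_finite_induct) (simp_all add: subst_pol_mult)

lemma subst_pol_sum_distrib: "subst_pol \<sigma> (sum f A) = (\<Sum>i\<in>A. subst_pol \<sigma> (f i))"
  by (induction A rule: infinite_finite_induct) (simp_all add: subst_pol_add)

lemmas subst_pol_hom = subst_pol_add subst_pol_mult subst_pol_diff subst_pol_uminus
  subst_pol_power

lemma single_as_monomial: "Poly_Mapping.single m c = Cst c * mon_img Var m"
proof -
  have *: "(\<Prod>i\<in>A. Var i ^ Poly_Mapping.lookup m i)
      = Poly_Mapping.single (\<Sum>i\<in>A. Poly_Mapping.single i (Poly_Mapping.lookup m i)) 1"
    if "finite A" for A
    using that
  proof (induction A)
    case (insert x A)
    have "Var x ^ n = Poly_Mapping.single (Poly_Mapping.single x n) 1" for n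
      by (induction n) (simp_all add: Var_def mult_single flip: single_add)
    then show ?case using insert by (simp add: mult_single)
  qed simp
  show ?thesis
    unfolding mon_img_def *[OF finite_keys] poly_mapping_sum_single[symmetric]
    by (simp add: Cst_def mult_single)
qed

lemma mon_img_cong:
  "(\<And>i. i \<in> Poly_Mapping.keys m \<Longrightarrow> \<sigma> i = \<tau> i) \<Longrightarrow> mon_img \<sigma> m = mon_img \<tau> m"
  by (simp add: mon_img_def)

lemma subst_pol_mon_img: "subst_pol \<sigma> (mon_img \<tau> m) = mon_img (\<lambda>i. subst_pol \<sigma> (\<tau> i)) m"
  by (simp add: mon_img_def subst_pol_prod subst_pol_power)

lemma subst_pol_subst_pol: "subst_pol \<sigma> (subst_pol \<tau> f) = subst_pol (\<lambda>i. subst_pol \<sigma> (\<tau> i)) f"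
  unfolding subst_pol_sum[of \<tau> f] subst_pol_sum_distrib subst_pol_mult subst_pol_mon_img
    subst_pol_Cst by (simp add: subst_pol_sum)

lemma subst_pol_cong:
  assumes "f \<in> Pk k" "\<And>i. 1 \<le> i \<Longrightarrow> i \<le> k \<Longrightarrow> \<sigma> i = \<tau> i"
  shows "subst_pol \<sigma> f = subst_pol \<tau> f"
  unfolding subst_pol_sum
proof (rule sum.cong)
  fix m assume "m \<in> Poly_Mapping.keys f"
  then have "Poly_Mapping.keys m \<subseteq> {1..k}" using assms(1) by (auto simp: Pk_def)
  then have "mon_img \<sigma> m = mon_img \<tau> m" using assms(2) by (intro mon_img_cong) auto
  then show "Cst (Poly_Mapping.lookup f m) * mon_img \<sigma> m
      = Cst (Poly_Mapping.lookup f m) * mon_img \<tau> m" by simp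
qed simp

lemma subst_pol_Var_id: "subst_pol Var f = f"
  unfolding subst_pol_sum by (simp flip: single_as_monomial poly_mapping_sum_single)

lemma subst_pol_id:
  assumes "f \<in> Pk k" "\<And>i. 1 \<le> i \<Longrightarrow> i \<le> k \<Longrightarrow> \<sigma> i = Var i"
  shows "subst_pol \<sigma> f = f"
  using subst_pol_cong[OF assms(1), of \<sigma> Var] assms(2) by (simp add: subst_pol_Var_id)

section \<open>Polynomials of bounded degree\<close>

text \<open>The degree bound that the graded inverse limit imposes is tracked together with the
  variables that may occur.\<close>

definition Pkd :: "nat \<Rightarrow> nat \<Rightarrow> pol set" where
  "Pkd k d = {f. \<forall>m\<in>Poly_Mapping.keys f. Poly_Mapping.keys m \<subseteq> {1..k} \<and> mdeg m \<le> d}"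

lemma mdeg_add: "mdeg (m + n) = mdeg m + mdeg n"
  unfolding mdeg_def by (rule setsum_keys_plus_distrib) simp_all

lemma mdeg_zero [simp]: "mdeg 0 = 0" by (simp add: mdeg_def)

lemma mdeg_single [simp]: "mdeg (Poly_Mapping.single i n) = n"
  by (cases "n = 0") (simp_all add: mdeg_def)

lemma Pkd_imp_Pk: "f \<in> Pkd k d \<Longrightarrow> f \<in> Pk k" by (auto simp: Pkd_def Pk_def)

lemma Pk_imp_Pkd: assumes "f \<in> Pk k" shows "\<exists>d. f \<in> Pkd k d"
proof -
  have "mdeg m \<le> Max (mdeg ` Poly_Mapping.keys f)" if "m \<in> Poly_Mapping.keys f" for m
    using that by (intro Max_ge) auto
  then have "f \<in> Pkd k (Max (mdeg ` Poly_Mapping.keys f))"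
    using assms by (simp add: Pkd_def Pk_def)
  then show ?thesis by blast
qed

lemma Pkd_mono: "f \<in> Pkd k d \<Longrightarrow> k \<le> k' \<Longrightarrow> d \<le> d' \<Longrightarrow> f \<in> Pkd k' d'"
  by (fastforce simp: Pkd_def)

lemma Pkd_zero [simp]: "0 \<in> Pkd k d" by (simp add: Pkd_def)
lemma Pkd_Cst [simp]: "Cst c \<in> Pkd k d" by (simp add: Pkd_def Cst_def)
lemma Pkd_one [simp]: "1 \<in> Pkd k d" using Pkd_Cst[of 1] by simp
lemma Pkd_Var: "1 \<le> i \<Longrightarrow> i \<le> k \<Longrightarrow> 1 \<le> d \<Longrightarrow> Var i \<in> Pkd k d"
  by (simp add: Pkd_def Var_def)

lemma Pkd_add: "f \<in> Pkd k d \<Longrightarrow> g \<in> Pkd k d \<Longrightarrow> f + g \<in> Pkd k d"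
  using keys_add[of f g] unfolding Pkd_def by blast
lemma Pkd_uminus: "f \<in> Pkd k d \<Longrightarrow> - f \<in> Pkd k d"
  unfolding Pkd_def by (auto simp: in_keys_iff)
lemma Pkd_diff: "f \<in> Pkd k d \<Longrightarrow> g \<in> Pkd k d \<Longrightarrow> f - g \<in> Pkd k d"
  using Pkd_add[of f k d "- g"] by (simp add: Pkd_uminus)

lemma Pkd_mult: assumes "f \<in> Pkd k d" "g \<in> Pkd k e" shows "f * g \<in> Pkd k (d + e)"
  unfolding Pkd_def
proof safe
  fix m assume "m \<in> Poly_Mapping.keys (f * g)"
  then obtain a b where m: "m = a + b" "a \<in> Poly_Mapping.keys f" "b \<in> Poly_Mapping.keys g"
    using keys_mult[of f g] by auto
  then show "mdeg m \<le> d + e" using assms by (auto simp: Pkd_def mdeg_add add_mono)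
  fix i assume "i \<in> Poly_Mapping.keys m"
  then show "i \<in> {1..k}" using m assms keys_add[of a b] unfolding Pkd_def by blast
qed

lemma Pkd_Cst_mult: "f \<in> Pkd k d \<Longrightarrow> Cst c * f \<in> Pkd k d"
  using Pkd_mult[of "Cst c" k 0 f d] by simp

lemma Pkd_power: "f \<in> Pkd k d \<Longrightarrow> f ^ n \<in> Pkd k (n * d)"
  by (induction n) (auto dest: Pkd_mult)

lemma Pkd_sum: "(\<And>i. i \<in> A \<Longrightarrow> f i \<in> Pkd k d) \<Longrightarrow> sum f A \<in> Pkd k d"
  by (induction A rule: infinite_finite_induct) (auto intro: Pkd_add)

lemma Pkd_subst:
  assumes f: "f \<in> Pkd k d" and \<sigma>: "\<And>i. 1 \<le> i \<Longrightarrow> i \<le> k \<Longrightarrow> \<sigma> i \<in> Pkd k' 1"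
  shows "subst_pol \<sigma> f \<in> Pkd k' d"
  unfolding subst_pol_sum
proof (intro Pkd_sum Pkd_Cst_mult)
  fix m assume m: "m \<in> Poly_Mapping.keys f"
  have *: "(\<Prod>i\<in>A. \<sigma> i ^ Poly_Mapping.lookup m i) \<in> Pkd k' (\<Sum>i\<in>A. Poly_Mapping.lookup m i)"
    if "finite A" "A \<subseteq> {1..k}" for A
    using that
  proof (induction A)
    case (insert x A)
    then have "\<sigma> x ^ Poly_Mapping.lookup m x \<in> Pkd k' (Poly_Mapping.lookup m x * 1)"
      by (intro Pkd_power \<sigma>) auto
    then show ?case using insert Pkd_mult by fastforce
  qed simp
  have "Poly_Mapping.keys m \<subseteq> {1..k}" using m f unfolding Pkd_def by blast
  then have "mon_img \<sigma> m \<in> Pkd k' (mdeg m)"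
    unfolding mon_img_def mdeg_def by (rule *[OF finite_keys])
  then show "mon_img \<sigma> m \<in> Pkd k' d"
    using m f by (intro Pkd_mono[of _ k' "mdeg m" k' d]) (auto simp: Pkd_def)
qed

lemma Pkd_divide_Var: assumes "Var i * f \<in> Pkd k d" shows "f \<in> Pkd k d"
  unfolding Pkd_def
proof safe
  fix m assume m: "m \<in> Poly_Mapping.keys f"
  have "Poly_Mapping.lookup (Var i * f) (Poly_Mapping.single i 1 + m) = Poly_Mapping.lookup f m"
  proof (induction f rule: poly_mapping_additive_induct)
    case (single n c)
    then show ?case by (simp add: Var_def mult_single lookup_single)
  qed (simp_all add: algebra_simps lookup_add)
  then have *: "Poly_Mapping.single i 1 + m \<in> Poly_Mapping.keys (Var i * f)"
    using m by (simp add: in_keys_iff)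
  then show "mdeg m \<le> d"
    using assms by (force simp: Pkd_def mdeg_add)
  fix j assume "j \<in> Poly_Mapping.keys m"
  then have "j \<in> Poly_Mapping.keys (Poly_Mapping.single i 1 + m)"
    by (simp add: in_keys_iff lookup_add)
  then show "j \<in> {1..k}" using assms * unfolding Pkd_def by blast
qed

text \<open>The Demazure-Lusztig operators have no simple formula on monomials, but simple commutation
  rules with the variables; this induction turns such rules into bounds for the degree and the
  variables of their values.\<close>

lemma Pkd_induct [consumes 1, case_names const add Var]:
  assumes "f \<in> Pkd k d"
  and const: "\<And>c d. P d (Cst c)"
  and add: "\<And>d f g. P d f \<Longrightarrow> P d g \<Longrightarrow> P d (f + g)"
  and Var: "\<And>d i f. 1 \<le> i \<Longrightarrow> i \<le> k \<Longrightarrow> f \<in> Pkd k d \<Longrightarrow> P d f \<Longrightarrow> P (Suc d) (Var i * f)"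
  shows "P d f"
proof -
  have mon: "P d (Poly_Mapping.single m c)" if "Poly_Mapping.keys m \<subseteq> {1..k}" "mdeg m \<le> d" for m c d
    using that
  proof (induction d arbitrary: m)
    case 0
    have "m = 0"
    proof (rule ccontr)
      assume "m \<noteq> 0"
      then obtain i where "i \<in> Poly_Mapping.keys m"
        by (metis all_not_in_conv keys_eq_empty)
      moreover have "(\<Sum>i\<in>Poly_Mapping.keys m. Poly_Mapping.lookup m i) = 0"
        using 0 by (simp add: mdeg_def)
      ultimately show False by (simp add: in_keys_iff)
    qed
    then show ?case using const by (simp add: Cst_def)
  next
    case (Suc d)
    show ?case
    proof (cases "m = 0")
      case True
      then show ?thesis using const by (simp add: Cst_def)
    next
      case False
      then obtain i where i: "i \<in> Poly_Mapping.keys m"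
        by (metis all_not_in_conv keys_eq_empty)
      define n where "n = m - Poly_Mapping.single i 1"
      have m: "m = Poly_Mapping.single i 1 + n"
        by (rule poly_mapping_eqI)
           (use i in \<open>auto simp: n_def lookup_add lookup_minus lookup_single when_def in_keys_iff\<close>)
      have n: "Poly_Mapping.keys n \<subseteq> {1..k}" "mdeg n \<le> d"
        using Suc.prems unfolding m
         by (auto simp: mdeg_add in_keys_iff lookup_add subset_iff)
      have "Var i * Poly_Mapping.single n c = Poly_Mapping.single m c"
        unfolding m by (simp add: Var_def mult_single)
      moreover have "P (Suc d) (Var i * Poly_Mapping.single n c)"
        using i Suc.prems n by (intro Var Suc.IH) (auto simp: Pkd_def)
      ultimately show ?thesis by simp
    qed
  qed
  have "P d (\<Sum>m\<in>A. Poly_Mapping.single m (Poly_Mapping.lookup f m))"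
    if "finite A" "A \<subseteq> Poly_Mapping.keys f" for A
    using that
  proof (induction A)
    case empty
    then show ?case using const[of d 0] by simp
  next
    case (insert m A)
    then have "Poly_Mapping.keys m \<subseteq> {1..k}" "mdeg m \<le> d"
      using assms(1) unfolding Pkd_def by blast+
    then show ?case using insert by (auto intro!: add mon)
  qed
  then show ?thesis using poly_mapping_sum_single[of f] by (metis finite_keys order_refl)
qed

lemma Pk_induct [consumes 1, case_names const add Var]:
  assumes "f \<in> Pk k"
  and const: "\<And>c. P (Cst c)"
  and add: "\<And>f g. P f \<Longrightarrow> P g \<Longrightarrow> P (f + g)"
  and Var: "\<And>i f. 1 \<le> i \<Longrightarrow> i \<le> k \<Longrightarrow> f \<in> Pk k \<Longrightarrow> P f \<Longrightarrow> P (Var i * f)"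
  shows "P f"
proof -
  obtain d where "f \<in> Pkd k d" using Pk_imp_Pkd[OF assms(1)] by blast
  then show ?thesis
    by (induction rule: Pkd_induct) (auto intro: const add Var Pkd_imp_Pk)
qed

lemma Pk_Un: "f \<in> Pk k \<longleftrightarrow> (\<exists>d. f \<in> Pkd k d)"
  using Pk_imp_Pkd Pkd_imp_Pk by blast

lemma Pk_zero [simp]: "0 \<in> Pk k" by (simp add: Pk_def)
lemma Pk_one [simp]: "1 \<in> Pk k" by (simp add: Pk_Un)
lemma Pk_Cst [simp]: "Cst c \<in> Pk k" by (simp add: Pk_Un)
lemma Pk_Var: "1 \<le> i \<Longrightarrow> i \<le> k \<Longrightarrow> Var i \<in> Pk k"
  using Pkd_Var Pkd_imp_Pk by blast
lemma Pk_add: "f \<in> Pk k \<Longrightarrow> g \<in> Pk k \<Longrightarrow> f + g \<in> Pk k"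
  using keys_add[of f g] unfolding Pk_def by blast
lemma Pk_mult: "f \<in> Pk k \<Longrightarrow> g \<in> Pk k \<Longrightarrow> f * g \<in> Pk k"
  unfolding Pk_Un using Pkd_mult by blast

text \<open>The variable with index \<open>0\<close> lies in no \<open>Pk k\<close>; identities that hold for all polynomials are
  proved by the following induction.\<close>

lemma pol_induct [case_names const add Var]:
  assumes const: "\<And>c. P (Cst c)"
  and add: "\<And>f g. P f \<Longrightarrow> P g \<Longrightarrow> P (f + g)"
  and Var: "\<And>i f. P f \<Longrightarrow> P (Var i * f)"
  shows "P (f :: pol)"
proof (induction f rule: poly_mapping_additive_induct)
  case zero
  then show ?case using const[of 0] by simp
next
  case (single m c)
  have *: "P (Var i ^ n * f)" if "P f" for i n f
    using that by (induction n) (simp_all add: Var mult.assoc)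
  have "P (Cst c * (\<Prod>i\<in>A. Var i ^ Poly_Mapping.lookup m i))" if "finite A" for A
    using that
  proof (induction A)
    case (insert i A)
    have eq: "Cst c * (\<Prod>i\<in>insert i A. Var i ^ Poly_Mapping.lookup m i)
        = Var i ^ Poly_Mapping.lookup m i * (Cst c * (\<Prod>i\<in>A. Var i ^ Poly_Mapping.lookup m i))"
      using insert.hyps by (simp add: mult.left_commute)
    show ?case unfolding eq by (rule *[OF insert.IH])
  qed (simp add: const)
  then show ?case unfolding single_as_monomial mon_img_def by simp
qed (rule add)

section \<open>The field of rational functions and its automorphisms\<close>

type_synonym ratfun = "pol fract"

definition emb :: "pol \<Rightarrow> ratfun" where "emb f = Fraction_Field.Fract f 1"

abbreviation cK :: "coef \<Rightarrow> ratfun" where "cK c \<equiv> emb (Cst c)"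
abbreviation xv :: "nat \<Rightarrow> ratfun" where "xv i \<equiv> emb (Var i)"

lemma emb_add: "emb (f + g) = emb f + emb g" by (simp add: emb_def)
lemma emb_diff: "emb (f - g) = emb f - emb g" by (simp add: emb_def)
lemma emb_uminus: "emb (- f) = - emb f" by (simp add: emb_def)
lemma emb_mult: "emb (f * g) = emb f * emb g" by (simp add: emb_def)
lemma emb_zero [simp]: "emb 0 = 0" by (simp add: emb_def Zero_fract_def)
lemma emb_one [simp]: "emb 1 = 1" by (simp add: emb_def One_fract_def)
lemma emb_eq_iff [simp]: "emb f = emb g \<longleftrightarrow> f = g" by (simp add: emb_def eq_fract)
lemma emb_eq_0_iff [simp]: "emb f = 0 \<longleftrightarrow> f = 0" using emb_eq_iff[of f 0] by (simp del: emb_eq_iff)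
lemma emb_power: "emb (f ^ n) = emb f ^ n" by (induction n) (simp_all add: emb_mult)
lemmas emb_hom = emb_add emb_diff emb_uminus emb_mult emb_power
lemmas Cst_hom = Cst_add Cst_diff Cst_uminus Cst_mult Cst_power

lemma ratfun_cases: obtains a b where "b \<noteq> 0" "z = emb a / emb b"
proof (cases z rule: Fract_cases)
  case (Fract a b)
  then show ?thesis using that[of b a] by (simp add: emb_def)
qed

lemma Var_eq_iff [simp]: "Var i = Var j \<longleftrightarrow> i = j"
proof
  assume "Var i = Var j"
  then have "Poly_Mapping.lookup (Var i) (Poly_Mapping.single i 1)
      = Poly_Mapping.lookup (Var j) (Poly_Mapping.single i 1)" by simp
  then have "Poly_Mapping.single i (1::nat) = Poly_Mapping.single j 1"
    by (auto simp: Var_def lookup_single when_def split: if_splits)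
  then have "Poly_Mapping.lookup (Poly_Mapping.single i (1::nat)) i
      = Poly_Mapping.lookup (Poly_Mapping.single j (1::nat)) i" by simp
  then show "i = j" by (simp add: lookup_single when_def split: if_splits)
qed simp

lemma Var_nonzero [simp]: "Var i \<noteq> 0"
  by (metis Var_def lookup_single_eq lookup_zero zero_neq_one)

lemma Cst_Var_eq_iff: "Cst a * Var i = Cst b * Var j \<longleftrightarrow> (a = b \<and> (i = j \<or> a = 0))"
proof -
  have "Cst c * Var l = Poly_Mapping.single (Poly_Mapping.single l 1) c" for c l
    by (simp add: Cst_def Var_def mult_single)
  moreover have "Poly_Mapping.single (Poly_Mapping.single i (1::nat)) a
      = Poly_Mapping.single (Poly_Mapping.single j 1) b \<longleftrightarrow> (a = b \<and> (i = j \<or> a = 0))"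
  proof
    assume *: "Poly_Mapping.single (Poly_Mapping.single i (1::nat)) a
        = Poly_Mapping.single (Poly_Mapping.single j 1) b"
    have "Poly_Mapping.single i (1::nat) = Poly_Mapping.single j 1 \<longleftrightarrow> i = j"
      by (metis keys_single singleton_inject zero_neq_one)
    with arg_cong[OF *, of "\<lambda>f. Poly_Mapping.lookup f (Poly_Mapping.single i (1::nat))"]
      arg_cong[OF *, of "\<lambda>f. Poly_Mapping.lookup f (Poly_Mapping.single j (1::nat))"]
    show "a = b \<and> (i = j \<or> a = 0)"
      by (cases "i = j") (auto simp: lookup_single when_def split: if_splits)
  qed auto
  ultimately show ?thesis by simp
qed

text \<open>Relations between operators are checked in the field of rational functions. There all
  operators are combinations of field automorphisms with rational coefficients, and the
  variables and the shift \<open>\<omega>\<close> are invertible, so that the whole DAHA acts.\<close>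

definition alg_hom :: "(ratfun \<Rightarrow> ratfun) \<Rightarrow> bool" where
  "alg_hom u \<longleftrightarrow> (\<forall>a b. u (a + b) = u a + u b) \<and> (\<forall>a b. u (a * b) = u a * u b) \<and>
     (\<forall>c. u (cK c) = cK c)"

lemma alg_hom_add: "alg_hom u \<Longrightarrow> u (a + b) = u a + u b"
  and alg_hom_mult: "alg_hom u \<Longrightarrow> u (a * b) = u a * u b"
  and alg_hom_cK: "alg_hom u \<Longrightarrow> u (cK c) = cK c"
  by (simp_all add: alg_hom_def)

lemma alg_hom_zero: "alg_hom u \<Longrightarrow> u 0 = 0"
  using alg_hom_cK[of u 0] by simp
lemma alg_hom_one: "alg_hom u \<Longrightarrow> u 1 = 1"
  using alg_hom_cK[of u 1] by simp
lemma alg_hom_uminus: "alg_hom u \<Longrightarrow> u (- a) = - u a"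
  using alg_hom_mult[of u "cK (- 1)" a] alg_hom_cK[of u "- 1"] by (simp add: Cst_uminus emb_uminus)
lemma alg_hom_diff: "alg_hom u \<Longrightarrow> u (a - b) = u a - u b"
  using alg_hom_add[of u a "- b"] alg_hom_uminus[of u b] by simp
lemma alg_hom_inverse: assumes u: "alg_hom u" shows "u (inverse a) = inverse (u a)"
proof (cases "a = 0")
  case False
  then have "u a * u (inverse a) = 1"
    by (simp add: alg_hom_one[OF u] flip: alg_hom_mult[OF u])
  then show ?thesis by (metis inverse_unique)
qed (simp add: alg_hom_zero[OF u])
lemma alg_hom_divide: "alg_hom u \<Longrightarrow> u (a / b) = u a / u b"
  by (simp add: divide_inverse alg_hom_mult alg_hom_inverse)
lemma alg_hom_power: "alg_hom u \<Longrightarrow> u (a ^ n) = u a ^ n"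
  by (induction n) (simp_all add: alg_hom_mult alg_hom_one)

lemmas alg_hom_rules = alg_hom_add alg_hom_mult alg_hom_cK alg_hom_zero alg_hom_one
  alg_hom_uminus alg_hom_diff alg_hom_inverse alg_hom_divide alg_hom_power

text \<open>An element of the field is a quotient of polynomials, and a field homomorphism respects
  quotients; this reduces identities between compositions to the variables.\<close>

lemma alg_hom_ext:
  assumes u: "alg_hom u" and v: "alg_hom v" and eq: "\<And>i. u (xv i) = v (xv i)"
  shows "u z = v z"
proof -
  have "u (emb f) = v (emb f)" for f
    by (induction f rule: pol_induct)
       (simp_all add: emb_hom alg_hom_rules[OF u] alg_hom_rules[OF v] eq)
  then show ?thesis
    by (cases z rule: ratfun_cases) (simp add: alg_hom_rules[OF u] alg_hom_rules[OF v])
qed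

lemma alg_hom_comp: "alg_hom u \<Longrightarrow> alg_hom v \<Longrightarrow> alg_hom (\<lambda>z. u (v z))"
  by (simp add: alg_hom_def)
lemma alg_hom_id: "alg_hom (\<lambda>z. z)"
  by (simp add: alg_hom_def)

text \<open>A substitution with a left inverse is injective, hence sends nonzero denominators to nonzero
  denominators.\<close>

lemma subst_pol_extends:
  assumes "\<And>f. subst_pol \<sigma>' (subst_pol \<sigma> f) = f"
  shows "\<exists>u. alg_hom u \<and> (\<forall>f. u (emb f) = emb (subst_pol \<sigma> f))"
proof -
  have nz: "subst_pol \<sigma> b \<noteq> 0" if "b \<noteq> 0" for b
    using that assms[of b] by auto
  define u where "u z = (THE y. \<exists>a b. b \<noteq> 0 \<and> z = emb a / emb b \<and>
      y = emb (subst_pol \<sigma> a) / emb (subst_pol \<sigma> b))" for z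
  have u: "u (emb a / emb b) = emb (subst_pol \<sigma> a) / emb (subst_pol \<sigma> b)" if "b \<noteq> 0" for a b
    unfolding u_def
  proof (rule the_equality)
    fix y assume "\<exists>a' b'. b' \<noteq> 0 \<and> emb a / emb b = emb a' / emb b' \<and>
      y = emb (subst_pol \<sigma> a') / emb (subst_pol \<sigma> b')"
    then obtain a' b' where *: "b' \<noteq> 0" "emb a / emb b = emb a' / emb b'"
      "y = emb (subst_pol \<sigma> a') / emb (subst_pol \<sigma> b')" by blast
    then have "a * b' = a' * b" using that by (simp add: frac_eq_eq flip: emb_mult)
    then have "subst_pol \<sigma> a * subst_pol \<sigma> b' = subst_pol \<sigma> a' * subst_pol \<sigma> b"
      by (metis subst_pol_mult)
    then show "y = emb (subst_pol \<sigma> a) / emb (subst_pol \<sigma> b)"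
      using that * nz by (simp add: frac_eq_eq flip: emb_mult)
  qed (use that in blast)
  have u1: "u (emb f) = emb (subst_pol \<sigma> f)" for f
    using u[of 1 f] by simp
  have "u (y + z) = u y + u z \<and> u (y * z) = u y * u z" for y z
  proof (cases y rule: ratfun_cases; cases z rule: ratfun_cases)
    fix a b a' b' assume *: "b \<noteq> 0" "y = emb a / emb b" "b' \<noteq> 0" "z = emb a' / emb b'"
    have 1: "y + z = emb (a * b' + a' * b) / emb (b * b')" "y * z = emb (a * a') / emb (b * b')"
      using * by (simp_all add: emb_hom add_frac_eq)
    have "b * b' \<noteq> 0" using * by simp
    note 2 = u[OF this]
    show ?thesis
      unfolding 1 2 unfolding *(2,4) u[OF *(1)] u[OF *(3)]
      using * nz by (simp add: emb_hom subst_pol_hom add_frac_eq)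
  qed
  then have "alg_hom u" by (simp add: alg_hom_def u1)
  then show ?thesis using u1 by blast
qed

definition monsub :: "(nat \<Rightarrow> nat) \<Rightarrow> (nat \<Rightarrow> coef) \<Rightarrow> pol \<Rightarrow> pol" where
  "monsub p c = subst_pol (\<lambda>i. Cst (c i) * Var (p i))"

definition monaut :: "(nat \<Rightarrow> nat) \<Rightarrow> (nat \<Rightarrow> coef) \<Rightarrow> ratfun \<Rightarrow> ratfun" where
  "monaut p c = (SOME u. alg_hom u \<and> (\<forall>f. u (emb f) = emb (monsub p c f)))"

lemma
  assumes "bij p" "\<And>i. c i \<noteq> 0"
  shows alg_hom_monaut: "alg_hom (monaut p c)"
    and monaut_emb: "monaut p c (emb f) = emb (monsub p c f)"
proof -
  have "subst_pol (\<lambda>i. Cst (inverse (c (inv_into UNIV p i))) * Var (inv_into UNIV p i))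
      (subst_pol (\<lambda>i. Cst (c i) * Var (p i)) f) = f" for f
  proof -
    have *: "Cst (c i) * (Cst (inverse (c i)) * Var i) = Var i" for i
      using assms(2)[of i] by (simp flip: mult.assoc Cst_mult)
    show ?thesis
      using assms(1) by (simp add: subst_pol_subst_pol subst_pol_mult subst_pol_Var_id bij_is_inj *)
  qed
  from subst_pol_extends[of _ "\<lambda>i. Cst (c i) * Var (p i)", OF this]
  have "\<exists>u. alg_hom u \<and> (\<forall>f. u (emb f) = emb (monsub p c f))" by (simp add: monsub_def)
  from someI_ex[OF this]
  have "alg_hom (monaut p c) \<and> (\<forall>f. monaut p c (emb f) = emb (monsub p c f))"
    unfolding monaut_def .
  then show "alg_hom (monaut p c)" "monaut p c (emb f) = emb (monsub p c f)" by simp_all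
qed

lemma monaut_xv:
  assumes "bij p" "\<And>i. c i \<noteq> 0" shows "monaut p c (xv i) = cK (c i) * xv (p i)"
  by (simp add: monaut_emb[OF assms] monsub_def emb_mult)

text \<open>The shift \<open>omM k\<close> only moves the first \<open>k\<close> variables. The substitution in \<open>varpi\<close> also moves
  the later ones and is not invertible; both agree on polynomials in the first \<open>k\<close> variables.\<close>

definition adj_swap :: "nat \<Rightarrow> nat \<Rightarrow> nat" where
  "adj_swap i j = (if j = i then i + 1 else if j = i + 1 then i else j)"

definition sM :: "nat \<Rightarrow> ratfun \<Rightarrow> ratfun" where
  "sM i = monaut (adj_swap i) (\<lambda>_. 1)"

definition cyc :: "nat \<Rightarrow> nat \<Rightarrow> nat" where
  "cyc k j = (if j = k then 1 else if 1 \<le> j \<and> j < k then j + 1 else j)"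

definition cyc_inv :: "nat \<Rightarrow> nat \<Rightarrow> nat" where
  "cyc_inv k j = (if j = 1 then k else if 2 \<le> j \<and> j \<le> k then j - 1 else j)"

definition omM :: "nat \<Rightarrow> ratfun \<Rightarrow> ratfun" where
  "omM k = monaut (cyc k) (\<lambda>j. if j = k then qK else 1)"

definition omMinv :: "nat \<Rightarrow> ratfun \<Rightarrow> ratfun" where
  "omMinv k = monaut (cyc_inv k) (\<lambda>j. if j = 1 then inverse qK else 1)"

definition tauM :: "nat \<Rightarrow> ratfun \<Rightarrow> ratfun" where
  "tauM i = monaut id (\<lambda>j. if j = i then qK else 1)"

lemma tK_nonzero [simp]: "tK \<noteq> 0"
  by (simp add: tK_def Zero_fract_def eq_fract)

lemma qK_nonzero [simp]: "qK \<noteq> 0"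
  by (simp add: qK_def Zero_fract_def eq_fract)

lemma qK_power: "qK ^ n = Fraction_Field.Fract [:[:0, 1:] ^ n:] 1"
proof (induction n)
  case (Suc n)
  then show ?case by (simp add: qK_def)
qed (simp add: One_fract_def one_pCons)

lemma qK_power_eq_iff [simp]: "qK ^ m = qK ^ n \<longleftrightarrow> m = n"
proof
  assume "qK ^ m = qK ^ n"
  then have "degree ([:0, 1:] ^ m :: rat poly) = degree ([:0, 1:] ^ n :: rat poly)"
    by (simp add: qK_power eq_fract)
  then show "m = n" by (simp add: degree_power_eq)
qed simp

lemma adj_swap_adj_swap [simp]: "adj_swap i (adj_swap i j) = j"
  by (simp add: adj_swap_def)

lemma bij_adj_swap: "bij (adj_swap i)"
  by (rule o_bij[of "adj_swap i"]) auto

lemma cyc_cyc_inv: "1 \<le> k \<Longrightarrow> cyc k (cyc_inv k j) = j" "1 \<le> k \<Longrightarrow> cyc_inv k (cyc k j) = j"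
  by (auto simp: cyc_def cyc_inv_def)

lemma bij_cyc: "1 \<le> k \<Longrightarrow> bij (cyc k)" and bij_cyc_inv: "1 \<le> k \<Longrightarrow> bij (cyc_inv k)"
  by (rule o_bij[of "cyc_inv k"] o_bij[of "cyc k"], auto simp: cyc_cyc_inv)+

lemma alg_hom_sM: "alg_hom (sM i)"
  unfolding sM_def by (rule alg_hom_monaut) (simp_all add: bij_adj_swap)
lemma sM_xv: "sM i (xv j) = xv (adj_swap i j)"
  unfolding sM_def by (subst monaut_xv) (simp_all add: bij_adj_swap)
lemma alg_hom_omM: "1 \<le> k \<Longrightarrow> alg_hom (omM k)"
  unfolding omM_def by (rule alg_hom_monaut) (simp_all add: bij_cyc)
lemma omM_xv: "1 \<le> k \<Longrightarrow> omM k (xv j) = cK (if j = k then qK else 1) * xv (cyc k j)"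
  unfolding omM_def by (subst monaut_xv) (simp_all add: bij_cyc)
lemma alg_hom_omMinv: "1 \<le> k \<Longrightarrow> alg_hom (omMinv k)"
  unfolding omMinv_def by (rule alg_hom_monaut) (simp_all add: bij_cyc_inv)
lemma omMinv_xv: "1 \<le> k \<Longrightarrow> omMinv k (xv j) = cK (if j = 1 then inverse qK else 1) * xv (cyc_inv k j)"
  unfolding omMinv_def by (subst monaut_xv) (simp_all add: bij_cyc_inv)
lemma alg_hom_tauM: "alg_hom (tauM i)"
  unfolding tauM_def by (rule alg_hom_monaut) simp_all
lemma tauM_xv: "tauM i (xv j) = cK (if j = i then qK else 1) * xv j"
  unfolding tauM_def by (subst monaut_xv) simp_all

lemmas sM_rules = alg_hom_rules[OF alg_hom_sM]
lemmas omM_rules = alg_hom_rules[OF alg_hom_omM]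

lemma sM_emb: "sM i (emb f) = emb (swap_pol i f)"
proof -
  have *: "monaut (adj_swap i) (\<lambda>_. 1) (emb f) = emb (monsub (adj_swap i) (\<lambda>_. 1) f)"
    by (rule monaut_emb[OF bij_adj_swap]) simp
  show ?thesis
    unfolding sM_def * by (simp add: monsub_def swap_pol_def adj_swap_def)
qed

lemma sM_sM [simp]: "sM i (sM i z) = z"
  by (rule alg_hom_ext[OF alg_hom_comp[OF alg_hom_sM alg_hom_sM] alg_hom_id]) (simp add: sM_xv)

lemma sM_commute: "i + 1 < j \<or> j + 1 < i \<Longrightarrow> sM i (sM j z) = sM j (sM i z)"
  by (rule alg_hom_ext[OF alg_hom_comp[OF alg_hom_sM alg_hom_sM] alg_hom_comp[OF alg_hom_sM alg_hom_sM]])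
     (auto simp add: sM_xv adj_swap_def)

lemma sM_braid: "sM i (sM (i + 1) (sM i z)) = sM (i + 1) (sM i (sM (i + 1) z))"
  by (rule alg_hom_ext[OF alg_hom_comp[OF alg_hom_sM alg_hom_comp[OF alg_hom_sM alg_hom_sM]]
      alg_hom_comp[OF alg_hom_sM alg_hom_comp[OF alg_hom_sM alg_hom_sM]]])
     (auto simp add: sM_xv adj_swap_def)

lemma omM_omMinv: assumes k: "1 \<le> k" shows "omM k (omMinv k z) = z" "omMinv k (omM k z) = z"
proof -
  note [simp] = omM_xv[OF k] omMinv_xv[OF k] alg_hom_rules[OF alg_hom_omM[OF k]]
     alg_hom_rules[OF alg_hom_omMinv[OF k]]
  have *: "cK (inverse qK) * (cK qK * w) = w" "cK qK * (cK (inverse qK) * w) = w" for w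
    by (simp_all flip: mult.assoc emb_mult Cst_mult)
  show "omM k (omMinv k z) = z"
    by (rule alg_hom_ext[OF alg_hom_comp[OF alg_hom_omM[OF k] alg_hom_omMinv[OF k]] alg_hom_id])
       (use k in \<open>auto simp add: cyc_cyc_inv * cyc_inv_def cyc_def\<close>)
  show "omMinv k (omM k z) = z"
    by (rule alg_hom_ext[OF alg_hom_comp[OF alg_hom_omMinv[OF k] alg_hom_omM[OF k]] alg_hom_id])
       (use k in \<open>auto simp add: cyc_cyc_inv * cyc_inv_def cyc_def\<close>)
qed

lemma omM_sM: assumes "1 \<le> i" "i + 2 \<le> k" shows "omM k (sM i z) = sM (i + 1) (omM k z)"
proof -
  have k: "1 \<le> k" using assms by simp
  note [simp] = omM_xv[OF k] alg_hom_rules[OF alg_hom_omM[OF k]] sM_rules sM_xv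
  show ?thesis
    by (rule alg_hom_ext[OF alg_hom_comp[OF alg_hom_omM[OF k] alg_hom_sM]
          alg_hom_comp[OF alg_hom_sM alg_hom_omM[OF k]]])
       (use assms in \<open>auto simp: adj_swap_def cyc_def\<close>)
qed

lemma omM_omM_sM: assumes "2 \<le> k" shows "omM k (omM k (sM (k - 1) z)) = sM 1 (omM k (omM k z))"
proof -
  have k: "1 \<le> k" using assms by simp
  note [simp] = omM_xv[OF k] alg_hom_rules[OF alg_hom_omM[OF k]] sM_rules sM_xv
  note h = alg_hom_comp[OF alg_hom_omM[OF k] alg_hom_omM[OF k]]
  obtain n where n: "k = n + 2" using assms by (metis add.commute le_Suc_ex)
  note [simp] = omM_xv[OF k, unfolded n, simplified] alg_hom_rules[OF alg_hom_omM[OF k], unfolded n, simplified]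
  show ?thesis
  proof (rule alg_hom_ext[OF alg_hom_comp[OF h alg_hom_sM] alg_hom_comp[OF alg_hom_sM h]])
    fix i
    consider "i = k" | "i = k - 1" | "i = 0" | "i > k" | "1 \<le> i" "i < k - 1" by linarith
    then show "omM k (omM k (sM (k - 1) (xv i))) = sM 1 (omM k (omM k (xv i)))"
      by cases (simp_all add: adj_swap_def cyc_def n)
  qed
qed

section \<open>Demazure-Lusztig operators\<close>

definition aT :: "nat \<Rightarrow> ratfun" where
  "aT i = (1 - cK tK) * xv i / (xv i - xv (i + 1))"
definition bT :: "nat \<Rightarrow> ratfun" where
  "bT i = (cK tK * xv i - xv (i + 1)) / (xv i - xv (i + 1))"

definition TM :: "nat \<Rightarrow> ratfun \<Rightarrow> ratfun" where
  "TM i v = aT i * v + bT i * sM i v"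

definition TIM :: "nat \<Rightarrow> ratfun \<Rightarrow> ratfun" where
  "TIM i v = cK (inverse tK) * (TM i v + cK (tK - 1) * v)"

lemma xv_neq [simp]: "xv i - xv (Suc i) \<noteq> 0" "xv (Suc i) - xv i \<noteq> 0" by simp_all

lemma bT_nonzero: "bT i \<noteq> 0"
proof -
  have "Cst tK * Var i \<noteq> Var (i + 1)"
    using Cst_Var_eq_iff[of tK i 1 "i + 1"] by auto
  then show ?thesis by (simp add: bT_def flip: emb_mult)
qed

lemma TM_add: "TM i (u + v) = TM i u + TM i v"
  by (simp add: TM_def sM_rules algebra_simps)
lemma TM_cK: "TM i (cK c * v) = cK c * TM i v"
  by (simp add: TM_def sM_rules algebra_simps)
lemma TM_mult: "sM i f = f \<Longrightarrow> TM i (f * v) = f * TM i v"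
  by (simp add: TM_def sM_rules algebra_simps)

lemma sM_aT: "sM i (aT i) = (1 - cK tK) * xv (i + 1) / (xv (i + 1) - xv i)"
  and sM_bT: "sM i (bT i) = (cK tK * xv (i + 1) - xv i) / (xv (i + 1) - xv i)"
  by (simp_all add: aT_def bT_def sM_rules sM_xv adj_swap_def)

text \<open>The two coefficients of \<open>v\<close> and \<open>sM i v\<close> are compared; each comparison is an identity in the
  variables \<open>x_i\<close>, \<open>x_(i+1)\<close> and \<open>t\<close>.\<close>

lemma TM_quadratic: "TM i (TM i v) = (1 - cK tK) * TM i v + cK tK * v"
proof -
  have *: "\<lbrakk>x \<noteq> y\<rbrakk> \<Longrightarrow> (1 - t) * x / (x - y) * ((1 - t) * x / (x - y))
      + (t * x - y) / (x - y) * ((t * y - x) / (y - x)) = (1 - t) * ((1 - t) * x / (x - y)) + t"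
    for x y t :: ratfun
    by (simp add: divide_simps) (simp add: algebra_simps)
  have **: "x \<noteq> y \<Longrightarrow> (1 - t) * x / (x - y) + (1 - t) * y / (y - x) = 1 - t" for x y t :: ratfun
    by (simp add: divide_simps) (simp add: algebra_simps)
  have 1: "aT i * aT i + bT i * sM i (bT i) = (1 - cK tK) * aT i + cK tK"
    unfolding sM_bT unfolding aT_def bT_def by (rule *) simp
  have 2: "aT i + sM i (aT i) = 1 - cK tK"
    unfolding sM_aT unfolding aT_def by (rule **) simp
  have "TM i (TM i v) = (aT i * aT i + bT i * sM i (bT i)) * v + (aT i + sM i (aT i)) * bT i * sM i v"
    by (simp add: TM_def sM_rules algebra_simps)
  also have "\<dots> = (1 - cK tK) * TM i v + cK tK * v"
    unfolding 1 2 by (simp add: TM_def algebra_simps)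
  finally show ?thesis .
qed

lemma TM_TIM [simp]: "TM i (TIM i v) = v" "TIM i (TM i v) = v"
proof -
  have *: "cK (inverse tK) * ((1 - cK tK) * w + cK tK * v + (cK tK - 1) * w) = v" for w
  proof -
    have *: "(1 - cK tK) * w + cK tK * v + (cK tK - 1) * w = cK tK * v" by (simp add: algebra_simps)
    show ?thesis unfolding * by (simp flip: mult.assoc emb_mult Cst_mult)
  qed
  show "TM i (TIM i v) = v" "TIM i (TM i v) = v"
    unfolding TIM_def TM_cK TM_add TM_quadratic
    using *[of "TM i v"] by (simp_all add: Cst_diff emb_diff)
qed

lemma TM_commute:
  assumes "i + 1 < j \<or> j + 1 < i" shows "TM i (TM j v) = TM j (TM i v)"
proof -
  have "sM i (aT j) = aT j" "sM i (bT j) = bT j" "sM j (aT i) = aT i" "sM j (bT i) = bT i"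
    using assms by (auto simp: aT_def bT_def sM_rules sM_xv adj_swap_def)
  then show ?thesis
    by (simp add: TM_def sM_rules sM_commute[OF assms] algebra_simps)
qed

text \<open>Both sides expand in the six images of \<open>v\<close> under the permutations of three variables. For
  the three longest permutations the coefficients agree up to the order of the factors, the other
  three comparisons are the rational identities \<open>e1\<close> to \<open>e3\<close>.\<close>

lemma TM_braid: "TM i (TM (i + 1) (TM i v)) = TM (i + 1) (TM i (TM (i + 1) v))"
proof -
  define x y z t where "x = xv i" and "y = xv (i + 1)" and "z = xv (i + 2)" and "t = cK tK"
  have neq: "x \<noteq> y" "y \<noteq> z" "x \<noteq> z" by (simp_all add: x_def y_def z_def)
  define A B where "A u v = (1 - t) * u / (u - v)" and "B u v = (t * u - v) / (u - v)" for u v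
  have s: "sM i x = y" "sM i y = x" "sM i z = z" "sM (i+1) x = x" "sM (i+1) y = z" "sM (i+1) z = y"
     "sM i t = t" "sM (i+1) t = t"
    by (simp_all add: x_def y_def z_def t_def sM_xv adj_swap_def sM_rules)
  note s = s s[unfolded Suc_eq_plus1[symmetric]]
  have sA: "sM j (A u v) = A (sM j u) (sM j v)" "sM j (B u v) = B (sM j u) (sM j v)" for j u v
    by (simp_all add: A_def B_def sM_rules t_def)
  have T1: "TM i v = A x y * v + B x y * sM i v" for v
    by (simp add: TM_def aT_def bT_def A_def B_def x_def y_def t_def)
  have T2: "TM (i+1) v = A y z * v + B y z * sM (i+1) v" for v
    by (simp add: TM_def aT_def bT_def A_def B_def z_def y_def t_def)
  note br = sM_braid[of i]
  \<comment> \<open>In terms of the differences of the variables all denominators are monomials in \<open>P\<close>, \<open>Q\<close>, \<open>P + Q\<close>.\<close>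
  obtain P Q where PQ: "x = y + P" "z = y - Q" "P \<noteq> 0" "Q \<noteq> 0" "P + Q \<noteq> 0"
    using neq that[of "x - y" "y - z"] by simp
  have e1: "A x y * A y z * A x y + B x y * A x z * B y x
      = A y z * A x y * A y z + B y z * A x z * B z y"
    unfolding A_def B_def PQ using PQ(3-) by (simp add: divide_simps) (simp add: algebra_simps)
  have e2: "A x y * A y z * B x y + B x y * A x z * A y x = A y z * B x y * A x z"
    unfolding A_def B_def PQ using PQ(3-) by (simp add: divide_simps) (simp add: algebra_simps)
  have e3: "A x y * B y z * A x z = A y z * A x y * B y z + B y z * A x z * A z y"
    unfolding A_def B_def PQ using PQ(3-) by (simp add: divide_simps) (simp add: algebra_simps)
  have L: "TM i (TM (i + 1) (TM i v)) =
      (A x y * A y z * A x y + B x y * A x z * B y x) * v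
      + (A x y * A y z * B x y + B x y * A x z * A y x) * sM i v
      + A x y * B y z * A x z * sM (i+1) v
      + A x y * B y z * B x z * sM (i+1) (sM i v)
      + B x y * B x z * A y z * sM i (sM (i+1) v)
      + B x y * B x z * B y z * sM i (sM (i+1) (sM i v))"
    unfolding T1 T2 by (simp add: sM_rules sA s algebra_simps)
  have R: "TM (i + 1) (TM i (TM (i + 1) v)) =
      (A y z * A x y * A y z + B y z * A x z * B z y) * v
      + A y z * B x y * A x z * sM i v
      + (A y z * A x y * B y z + B y z * A x z * A z y) * sM (i+1) v
      + B y z * B x z * A x y * sM (i+1) (sM i v)
      + A y z * B x y * B x z * sM i (sM (i+1) v)
      + B y z * B x z * B x y * sM (i+1) (sM i (sM (i+1) v))"
    unfolding T1 T2 by (simp add: sM_rules sA s algebra_simps)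
  show ?thesis unfolding L R e1 e2 e3 br by (simp add: algebra_simps)
qed

lemma TM_xv: "TM i (xv i * v) = (1 - cK tK) * xv i * v + xv (i + 1) * TM i v"
  and TM_xv_Suc: "TM i (xv (i + 1) * v) = xv i * (TM i v + cK (tK - 1) * v)"
proof -
  have *: "\<lbrakk>x \<noteq> y\<rbrakk> \<Longrightarrow> (1 - t) * x / (x - y) * (x - y) = (1 - t) * x"
    for x y t :: ratfun by simp
  have 1: "aT i * (xv i - xv (i + 1)) = (1 - cK tK) * xv i"
    unfolding aT_def by (rule *) simp
  have "TM i (xv i * v) - xv (i + 1) * TM i v = aT i * (xv i - xv (i + 1)) * v"
    by (simp add: TM_def sM_rules sM_xv adj_swap_def algebra_simps)
  then show "TM i (xv i * v) = (1 - cK tK) * xv i * v + xv (i + 1) * TM i v"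
    unfolding 1 by (simp add: algebra_simps)
  have "TM i (xv (i + 1) * v) - xv i * TM i v = - (aT i * (xv i - xv (i + 1))) * v"
    by (simp add: TM_def sM_rules sM_xv adj_swap_def algebra_simps)
  then show "TM i (xv (i + 1) * v) = xv i * (TM i v + cK (tK - 1) * v)"
    unfolding 1 by (simp add: algebra_simps Cst_diff emb_diff)
qed

lemma TM_xv_other: "j \<noteq> i \<Longrightarrow> j \<noteq> i + 1 \<Longrightarrow> TM i (xv j * v) = xv j * TM i v"
  by (rule TM_mult) (simp add: sM_xv adj_swap_def)

text \<open>The coefficients of the operators are homogeneous of degree zero in the two variables, so a
  common scalar, such as the \<open>q\<close> coming from the shift, cancels.\<close>

lemma alg_hom_TM:
  assumes u: "alg_hom u" and "\<And>z. u (sM i z) = sM j (u z)"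
    and "u (xv i) = cK c * xv j" "u (xv (i + 1)) = cK c * xv (j + 1)" and c: "c \<noteq> 0"
  shows "u (TM i v) = TM j (u v)"
proof -
  have "\<lbrakk>x \<noteq> y; d \<noteq> 0\<rbrakk> \<Longrightarrow> (1 - t) * (d * x) / (d * x - d * y) = (1 - t) * x / (x - y)"
    "\<lbrakk>x \<noteq> y; d \<noteq> 0\<rbrakk> \<Longrightarrow> (t * (d * x) - d * y) / (d * x - d * y) = (t * x - y) / (x - y)"
    for x y d t :: ratfun
    by (simp_all add: divide_simps) (simp_all add: algebra_simps)
  then have "u (aT i) = aT j" "u (bT i) = bT j"
    using c by (simp_all add: aT_def bT_def alg_hom_rules[OF u] assms(3) assms(4)[simplified])
  then show ?thesis by (simp add: TM_def alg_hom_rules[OF u] assms(2))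
qed

lemma sM_TM_commute: "i + 1 < j \<or> j + 1 < i \<Longrightarrow> sM i (TM j v) = TM j (sM i v)"
  by (rule alg_hom_TM[OF alg_hom_sM, of _ _ _ 1]) (auto simp: sM_commute sM_xv adj_swap_def)

lemma omM_TM: assumes "1 \<le> i" "i + 2 \<le> k" shows "omM k (TM i v) = TM (i + 1) (omM k v)"
  by (rule alg_hom_TM[OF alg_hom_omM, of _ _ _ 1])
     (use assms in \<open>simp_all add: omM_sM[OF assms, simplified] omM_xv cyc_def\<close>)

lemma omM_omM_TM: assumes "2 \<le> k" shows "omM k (omM k (TM (k - 1) v)) = TM 1 (omM k (omM k v))"
proof -
  have k: "1 \<le> k" using assms by simp
  note h = alg_hom_comp[OF alg_hom_omM[OF k] alg_hom_omM[OF k]]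
  show ?thesis
    by (rule alg_hom_TM[OF h, of _ _ qK])
       (use assms in \<open>simp_all only: omM_omM_sM omM_xv[OF k] omM_rules[OF k], auto simp: cyc_def\<close>)
qed

text \<open>Since \<open>aT i + bT i = 1\<close>, the operator \<open>TM i - 1\<close> is a nonzero multiple of \<open>sM i - 1\<close>. Symmetry can
  therefore be tested with \<open>T\<close>'s, which obey the braid relations with the other operators.\<close>

lemma TM_fixed_iff: "TM i v = v \<longleftrightarrow> sM i v = v"
proof -
  have *: "x \<noteq> y \<Longrightarrow> (1 - t) * x / (x - y) + (t * x - y) / (x - y) = 1" for x y t :: ratfun
    by (simp add: divide_simps) (simp add: algebra_simps)
  have a: "aT i = 1 - bT i" using *[of "xv i" "xv (i + 1)" "cK tK"]
    by (simp add: aT_def bT_def algebra_simps)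
  have "TM i v - v = bT i * (sM i v - v)" unfolding TM_def a by (simp add: algebra_simps)
  then show ?thesis using bT_nonzero[of i] by (metis eq_iff_diff_eq_0 mult_eq_0_iff)
qed

section \<open>Free algebras and their quotients\<close>

definition words_in :: "'g set \<Rightarrow> 'g falg set" where
  "words_in G = {a. \<forall>w\<in>Poly_Mapping.keys a. set (letters w) \<subseteq> G}"

lemma letters_zero [simp]: "letters 0 = []" by (simp add: zero_fword_def)
lemma letters_add [simp]: "letters (u + v) = letters u @ letters v" by (simp add: plus_fword_def)

lemma words_in_zero [simp]: "0 \<in> words_in G" by (simp add: words_in_def)
lemma words_in_scal [simp]: "scal c \<in> words_in G" by (simp add: words_in_def scal_def)
lemma words_in_single: "set (letters w) \<subseteq> G \<Longrightarrow> Poly_Mapping.single w c \<in> words_in G"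
  by (simp add: words_in_def)
lemma words_in_one [simp]: "1 \<in> words_in G" by (simp add: words_in_def)
lemma words_in_gen [simp]: "gen g \<in> words_in G \<longleftrightarrow> g \<in> G" by (simp add: words_in_def gen_def)
lemma words_in_add: "a \<in> words_in G \<Longrightarrow> b \<in> words_in G \<Longrightarrow> a + b \<in> words_in G"
  using keys_add[of a b] unfolding words_in_def by blast
lemma words_in_uminus: "a \<in> words_in G \<Longrightarrow> - a \<in> words_in G"
  unfolding words_in_def by (auto simp: in_keys_iff)
lemma words_in_diff: "a \<in> words_in G \<Longrightarrow> b \<in> words_in G \<Longrightarrow> a - b \<in> words_in G"
  using words_in_add[of a G "- b"] by (simp add: words_in_uminus)
lemma words_in_mult: assumes "a \<in> words_in G" "b \<in> words_in G" shows "a * b \<in> words_in G"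
  unfolding words_in_def
proof safe
  fix w g assume "w \<in> Poly_Mapping.keys (a * b)" "g \<in> set (letters w)"
  then obtain u v where "w = u + v" "u \<in> Poly_Mapping.keys a" "v \<in> Poly_Mapping.keys b"
    using keys_mult[of a b] by auto
  then show "g \<in> G" using assms \<open>g \<in> set (letters w)\<close> by (auto simp: words_in_def)
qed
lemma words_in_prod_list: "(\<And>a. a \<in> set as \<Longrightarrow> a \<in> words_in G) \<Longrightarrow> prod_list as \<in> words_in G"
  by (induction as) (auto intro: words_in_mult)
lemma words_in_mono: "a \<in> words_in G \<Longrightarrow> G \<subseteq> H \<Longrightarrow> a \<in> words_in H"
  by (auto simp: words_in_def)
lemma words_in_Tinv: "GT i \<in> G \<Longrightarrow> Tinv i \<in> words_in G"
  unfolding Tinv_def by (intro words_in_mult words_in_add) simp_all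

lemmas words_in_intros = words_in_add words_in_diff words_in_mult words_in_Tinv

lemma gen_word: "prod_list (map gen gs) = Poly_Mapping.single (Fword gs) 1"
  by (induction gs)
     (simp_all add: gen_def mult_single plus_fword_def flip: zero_fword_def)

lemma single_as_word: "Poly_Mapping.single w c = scal c * prod_list (map gen (letters w))"
  by (simp add: gen_word scal_def mult_single)

lemma scal_zero [simp]: "scal 0 = 0" by (simp add: scal_def)
lemma scal_one [simp]: "scal 1 = 1" by (simp add: scal_def)
lemma scal_add: "scal (a + b) = scal a + scal b" by (simp add: scal_def single_add)
lemma scal_diff: "scal (a - b) = scal a - scal b" by (simp add: scal_def single_diff)
lemma scal_mult: "scal (a * b) = scal a * scal b" by (simp add: scal_def mult_single)
lemma scal_central: "scal c * a = a * scal c"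
  by (induction a rule: poly_mapping_additive_induct)
     (simp_all add: scal_def mult_single algebra_simps)
lemma scal_left_commute: "a * (scal c * b) = scal c * (a * b)"
  by (metis mult.assoc scal_central)

lemma words_in_induct [consumes 1, case_names zero single add]:
  assumes "a \<in> words_in G" "P 0"
  and single: "\<And>c gs. set gs \<subseteq> G \<Longrightarrow> P (scal c * prod_list (map gen gs))"
  and add: "\<And>a b. P a \<Longrightarrow> P b \<Longrightarrow> a \<in> words_in G \<Longrightarrow> b \<in> words_in G \<Longrightarrow> P (a + b)"
  shows "P a"
proof -
  let ?s = "\<lambda>A. \<Sum>w\<in>A. Poly_Mapping.single w (Poly_Mapping.lookup a w)"
  have "P (?s A) \<and> ?s A \<in> words_in G"
    if "finite A" "A \<subseteq> Poly_Mapping.keys a" for A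
    using that
  proof (induction A)
    case (insert w A)
    have w: "set (letters w) \<subseteq> G" using insert assms(1) by (auto simp: words_in_def)
    let ?b = "Poly_Mapping.single w (Poly_Mapping.lookup a w)"
    have "P ?b" unfolding single_as_word using w by (rule single)
    then show ?case using insert words_in_single[OF w]
      by (auto intro: add words_in_add)
  qed (simp add: assms)
  then show ?thesis using poly_mapping_sum_single[of a] by (metis finite_keys order_refl)
qed

subsection \<open>The ideal of relations\<close>

lemma free_alg_simps [simp]:
  "carrier (free_alg G) = words_in G" "mult (free_alg G) = (*)" "one (free_alg G) = 1"
  "zero (free_alg G) = 0" "add (free_alg G) = (+)"
  by (simp_all add: free_alg_def words_in_def)

lemma ring_free_alg: "ring (free_alg G)"
proof (rule ringI)
  show "abelian_group (free_alg G)"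
  proof (rule abelian_groupI)
    fix a assume "a \<in> carrier (free_alg G)"
    then show "\<exists>b\<in>carrier (free_alg G). b \<oplus>\<^bsub>free_alg G\<^esub> a = \<zero>\<^bsub>free_alg G\<^esub>"
      by (intro bexI[of _ "- a"]) (auto simp: words_in_uminus)
  qed (auto simp: words_in_add algebra_simps)
  show "monoid (free_alg G)"
    by (rule monoidI) (auto simp: words_in_mult mult.assoc)
qed (auto simp: algebra_simps)

lemma a_inv_free_alg: assumes "a \<in> words_in G" shows "\<ominus>\<^bsub>free_alg G\<^esub> a = - a"
proof -
  interpret ring "free_alg G" by (rule ring_free_alg)
  have "- a \<oplus>\<^bsub>free_alg G\<^esub> a = \<zero>\<^bsub>free_alg G\<^esub>" by simp
  then show ?thesis using minus_equality[of "- a" a] assms by (simp add: words_in_uminus)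
qed

abbreviation rel_ideal :: "'g set \<Rightarrow> 'g falg set \<Rightarrow> 'g falg set" where
  "rel_ideal G R \<equiv> Idl\<^bsub>free_alg G\<^esub> R"

context
  fixes G :: "'g set" and R :: "'g falg set"
  assumes R: "R \<subseteq> words_in G"
begin

lemma ideal_rel_ideal: "ideal (rel_ideal G R) (free_alg G)"
  using ring.genideal_ideal[OF ring_free_alg[of G]] R by simp

lemma rel_ideal_relator: "r \<in> R \<Longrightarrow> r \<in> rel_ideal G R"
  using ring.genideal_self[OF ring_free_alg[of G]] R by auto

lemma rel_ideal_zero: "0 \<in> rel_ideal G R"
  using additive_subgroup.zero_closed[OF ideal.axioms(1)[OF ideal_rel_ideal]] by simp

lemma rel_ideal_add: "a \<in> rel_ideal G R \<Longrightarrow> b \<in> rel_ideal G R \<Longrightarrow> a + b \<in> rel_ideal G R"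
  using additive_subgroup.a_closed[OF ideal.axioms(1)[OF ideal_rel_ideal]] by simp

lemma rel_ideal_left: "a \<in> words_in G \<Longrightarrow> b \<in> rel_ideal G R \<Longrightarrow> a * b \<in> rel_ideal G R"
  using ideal.I_l_closed[OF ideal_rel_ideal, of b a] by simp

lemma rel_ideal_right: "a \<in> words_in G \<Longrightarrow> b \<in> rel_ideal G R \<Longrightarrow> b * a \<in> rel_ideal G R"
  using ideal.I_r_closed[OF ideal_rel_ideal, of b a] by simp

text \<open>The set \<open>K\<close> is an ideal only after intersection with the words in the given generators.\<close>

lemma rel_ideal_least:
  assumes "\<And>r. r \<in> R \<Longrightarrow> r \<in> K" "0 \<in> K"
    "\<And>a b. a \<in> K \<Longrightarrow> b \<in> K \<Longrightarrow> a + b \<in> K" "\<And>a. a \<in> K \<Longrightarrow> - a \<in> K"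
    "\<And>a b. a \<in> words_in G \<Longrightarrow> b \<in> K \<Longrightarrow> b \<in> words_in G \<Longrightarrow> a * b \<in> K"
    "\<And>a b. a \<in> words_in G \<Longrightarrow> b \<in> K \<Longrightarrow> b \<in> words_in G \<Longrightarrow> b * a \<in> K"
  assumes "a \<in> rel_ideal G R"
  shows "a \<in> K"
proof -
  have "ideal (K \<inter> words_in G) (free_alg G)"
  proof (rule idealI[OF ring_free_alg])
    show "subgroup (K \<inter> words_in G) (add_monoid (free_alg G))"
    proof (rule group.subgroupI)
      show "Group.group (add_monoid (free_alg G))"
        using ring_free_alg abelian_group.a_group ring_def by blast
      fix a assume a: "a \<in> K \<inter> words_in G"
      then have "inv\<^bsub>add_monoid (free_alg G)\<^esub> a = - a"
        using a_inv_free_alg[of a G] by (simp add: a_inv_def)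
      then show "inv\<^bsub>add_monoid (free_alg G)\<^esub> a \<in> K \<inter> words_in G"
        using a assms(4) by (simp add: words_in_uminus)
    qed (use assms in \<open>auto simp: words_in_add\<close>)
  qed (use assms in \<open>auto simp: words_in_mult\<close>)
  then have "rel_ideal G R \<subseteq> K \<inter> words_in G"
    by (rule ring.genideal_minimal[OF ring_free_alg]) (use assms(1) R in auto)
  then show ?thesis using assms(7) by blast
qed

lemma ring_presented: "ring (presented_alg G R)"
  unfolding presented_alg_def by (rule ideal.quotient_is_ring[OF ideal_rel_ideal])

lemma pres_class_hom: "pres_class G R \<in> ring_hom (free_alg G) (presented_alg G R)"
  unfolding presented_alg_def
  using ideal.rcos_ring_hom[OF ideal_rel_ideal] by (simp add: pres_class_def[abs_def])

lemma pres_class_carrier: "a \<in> words_in G \<Longrightarrow> pres_class G R a \<in> carrier (presented_alg G R)"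
  using ring_hom_closed[OF pres_class_hom] by simp

lemma pres_class_add: "a \<in> words_in G \<Longrightarrow> b \<in> words_in G \<Longrightarrow>
    pres_class G R (a + b) = pres_class G R a \<oplus>\<^bsub>presented_alg G R\<^esub> pres_class G R b"
  using ring_hom_add[OF pres_class_hom] by simp

lemma pres_class_mult: "a \<in> words_in G \<Longrightarrow> b \<in> words_in G \<Longrightarrow>
    pres_class G R (a * b) = pres_class G R a \<otimes>\<^bsub>presented_alg G R\<^esub> pres_class G R b"
  using ring_hom_mult[OF pres_class_hom] by simp

lemma pres_class_one: "pres_class G R 1 = \<one>\<^bsub>presented_alg G R\<^esub>"
  using ring_hom_one[OF pres_class_hom] by simp

lemma pres_class_zero_iff:
  assumes "a \<in> words_in G"
  shows "pres_class G R a = \<zero>\<^bsub>presented_alg G R\<^esub> \<longleftrightarrow> a \<in> rel_ideal G R"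
proof -
  interpret I: ideal "rel_ideal G R" "free_alg G" by (rule ideal_rel_ideal)
  have z: "\<zero>\<^bsub>presented_alg G R\<^esub> = rel_ideal G R"
    by (simp add: presented_alg_def FactRing_def)
  show ?thesis
    unfolding z pres_class_def
    using I.a_rcos_self[of a] I.a_rcos_const[of a] assms by auto
qed

lemma pres_class_zero: "pres_class G R 0 = \<zero>\<^bsub>presented_alg G R\<^esub>"
  by (simp add: pres_class_zero_iff rel_ideal_zero)

lemma pres_class_uminus: assumes "a \<in> words_in G"
  shows "pres_class G R (- a) = \<ominus>\<^bsub>presented_alg G R\<^esub> pres_class G R a"
proof -
  interpret P: ring "presented_alg G R" by (rule ring_presented)
  have "pres_class G R (- a) \<oplus>\<^bsub>presented_alg G R\<^esub> pres_class G R a = \<zero>\<^bsub>presented_alg G R\<^esub>"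
    using pres_class_add[of "- a" a] assms by (simp add: words_in_uminus pres_class_zero)
  then show ?thesis
    using P.minus_equality assms pres_class_carrier words_in_uminus by metis
qed

lemma pres_class_eq_iff:
  assumes "a \<in> words_in G" "b \<in> words_in G"
  shows "pres_class G R a = pres_class G R b \<longleftrightarrow> a - b \<in> rel_ideal G R"
proof -
  interpret P: ring "presented_alg G R" by (rule ring_presented)
  have "pres_class G R (a - b) = pres_class G R a \<ominus>\<^bsub>presented_alg G R\<^esub> pres_class G R b"
    using pres_class_add[of a "- b"] pres_class_uminus[of b] assms
    by (simp add: words_in_uminus a_minus_def)
  then show ?thesis
    using pres_class_zero_iff[of "a - b"] assms P.r_right_minus_eq pres_class_carrier
    by (simp add: words_in_diff)
qed

lemma pres_class_surj:
  assumes "C \<in> carrier (presented_alg G R)"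
  obtains a where "a \<in> words_in G" "C = pres_class G R a"
  using assms that
  by (auto simp: presented_alg_def FactRing_def A_RCOSETS_def' pres_class_def)

end

text \<open>The ideal of relations only absorbs elements in the given generators. For calculations it is
  convenient to have an ideal of the free algebra on all letters; deleting the words with other
  letters is a ring homomorphism, along which the ideal is pulled back.\<close>

definition restrict_words :: "'g set \<Rightarrow> 'g falg \<Rightarrow> 'g falg" where
  "restrict_words G a = (\<Sum>w\<in>Poly_Mapping.keys a.
     if set (letters w) \<subseteq> G then Poly_Mapping.single w (Poly_Mapping.lookup a w) else 0)"

lemma lookup_restrict_words:
  "Poly_Mapping.lookup (restrict_words G a) w = (if set (letters w) \<subseteq> G then Poly_Mapping.lookup a w else 0)"
proof -
  have "Poly_Mapping.lookup (restrict_words G a) w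
      = (\<Sum>v\<in>Poly_Mapping.keys a. if v = w then (if set (letters w) \<subseteq> G then Poly_Mapping.lookup a w else 0) else 0)"
    unfolding restrict_words_def lookup_sum
    by (rule sum.cong) (auto simp: lookup_single when_def)
  then show ?thesis by (simp add: in_keys_iff)
qed

lemma restrict_words_words: "restrict_words G a \<in> words_in G"
  unfolding words_in_def by (auto simp: in_keys_iff lookup_restrict_words split: if_splits)

lemma restrict_words_id: "a \<in> words_in G \<Longrightarrow> restrict_words G a = a"
  by (rule poly_mapping_eqI) (auto simp: lookup_restrict_words words_in_def in_keys_iff)

lemma restrict_words_add: "restrict_words G (a + b) = restrict_words G a + restrict_words G b"
  by (rule poly_mapping_eqI) (simp add: lookup_restrict_words lookup_add)

lemma restrict_words_zero [simp]: "restrict_words G 0 = 0"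
  by (simp add: restrict_words_id)

lemma restrict_words_single: "restrict_words G (Poly_Mapping.single w c)
    = (if set (letters w) \<subseteq> G then Poly_Mapping.single w c else 0)"
  by (rule poly_mapping_eqI) (simp add: lookup_restrict_words lookup_single when_def)

lemma restrict_words_mult: "restrict_words G (a * b) = restrict_words G a * restrict_words G b"
proof (induction a rule: poly_mapping_additive_induct)
  case (single u c)
  show ?case
    by (induction b rule: poly_mapping_additive_induct)
       (simp_all add: restrict_words_single restrict_words_add mult_single algebra_simps)
qed (simp_all add: restrict_words_add algebra_simps)

locale two_sided_ideal =
  fixes S :: "'a::ring_1 set"
  assumes zero: "0 \<in> S"
    and add: "a \<in> S \<Longrightarrow> b \<in> S \<Longrightarrow> a + b \<in> S"
    and left: "b \<in> S \<Longrightarrow> a * b \<in> S"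
    and right: "b \<in> S \<Longrightarrow> b * a \<in> S"
begin

definition cg :: "'a \<Rightarrow> 'a \<Rightarrow> bool" (infix \<open>\<asymp>\<close> 50) where "a \<asymp> b \<longleftrightarrow> a - b \<in> S"

lemma uminus: "a \<in> S \<Longrightarrow> - a \<in> S"
  using left[of a "- 1"] by simp

lemma cg_refl [simp, intro]: "a \<asymp> a" by (simp add: cg_def zero)
lemma cg_sym: "a \<asymp> b \<Longrightarrow> b \<asymp> a" using uminus[of "a - b"] by (simp add: cg_def)
lemma cg_trans [trans]: "a \<asymp> b \<Longrightarrow> b \<asymp> c \<Longrightarrow> a \<asymp> c"
  using add[of "a - b" "b - c"] by (simp add: cg_def)
lemma cg_add: "a \<asymp> a' \<Longrightarrow> b \<asymp> b' \<Longrightarrow> a + b \<asymp> a' + b'"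
  using add[of "a - a'" "b - b'"] by (simp add: cg_def algebra_simps)
lemma cg_left: "a \<asymp> b \<Longrightarrow> c * a \<asymp> c * b"
  using left[of "a - b" c] by (simp add: cg_def algebra_simps)
lemma cg_right: "a \<asymp> b \<Longrightarrow> a * c \<asymp> b * c"
  using right[of "a - b" c] by (simp add: cg_def algebra_simps)
lemma cg_sum: "(\<And>i. i \<in> A \<Longrightarrow> f i \<asymp> g i) \<Longrightarrow> sum f A \<asymp> sum g A"
  by (induction A rule: infinite_finite_induct) (auto intro: cg_add)

lemma cg_tail2: "a * b \<asymp> c \<Longrightarrow> a * (b * v) \<asymp> c * v"
  using cg_right[of "a * b" c v] by (simp add: mult.assoc)

end

section \<open>Linear actions of a free algebra\<close>

text \<open>The module is a subset \<open>V\<close> of a type, and the letters need to act linearly on it only, because the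
  limit operators are meaningful on the almost symmetric module only.\<close>

locale free_action =
  fixes sc :: "coef \<Rightarrow> 'v::ab_group_add \<Rightarrow> 'v" and V :: "'v set" and G :: "'g set"
    and act1 :: "'g \<Rightarrow> 'v \<Rightarrow> 'v"
  assumes sc_add_left: "sc (a + b) v = sc a v + sc b v"
    and sc_add_right: "sc a (v + w) = sc a v + sc a w"
    and sc_mult: "sc (a * b) v = sc a (sc b v)"
    and sc_one: "sc 1 v = v"
    and V_zero: "0 \<in> V" and V_add: "v \<in> V \<Longrightarrow> w \<in> V \<Longrightarrow> v + w \<in> V"
    and V_sc: "v \<in> V \<Longrightarrow> sc a v \<in> V"
    and act1_closed: "g \<in> G \<Longrightarrow> v \<in> V \<Longrightarrow> act1 g v \<in> V"
    and act1_add: "g \<in> G \<Longrightarrow> v \<in> V \<Longrightarrow> w \<in> V \<Longrightarrow> act1 g (v + w) = act1 g v + act1 g w"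
    and act1_sc: "g \<in> G \<Longrightarrow> v \<in> V \<Longrightarrow> act1 g (sc a v) = sc a (act1 g v)"
begin

definition act :: "'g falg \<Rightarrow> 'v \<Rightarrow> 'v" where
  "act a v = (\<Sum>w\<in>Poly_Mapping.keys a. sc (Poly_Mapping.lookup a w) (foldr act1 (letters w) v))"

lemma sc_zero_left [simp]: "sc 0 v = 0" using sc_add_left[of 0 0 v] by simp
lemma sc_zero_right [simp]: "sc a 0 = 0" using sc_add_right[of a 0 0] by simp

lemma act_superset:
  assumes "finite A" "Poly_Mapping.keys a \<subseteq> A"
  shows "act a v = (\<Sum>w\<in>A. sc (Poly_Mapping.lookup a w) (foldr act1 (letters w) v))"
  unfolding act_def
  by (rule sum.mono_neutral_left) (use assms in \<open>auto simp: not_in_keys_iff_lookup_eq_zero\<close>)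

lemma act_zero [simp]: "act 0 v = 0" by (simp add: act_def)

lemma act_add: "act (a + b) v = act a v + act b v"
proof -
  let ?A = "Poly_Mapping.keys a \<union> Poly_Mapping.keys b"
  have "Poly_Mapping.keys (a + b) \<subseteq> ?A" by (rule keys_add)
  then show ?thesis
    by (simp add: act_superset[of ?A] lookup_add sc_add_left sum.distrib)
qed

lemma act_uminus: "act (- a) v = - act a v"
  using act_add[of a "- a" v] by (simp add: eq_neg_iff_add_eq_0 add.commute)

lemma act_diff: "act (a - b) v = act a v - act b v"
  using act_add[of a "- b" v] by (simp add: act_uminus)

lemma act_sum: "act (sum f A) v = (\<Sum>i\<in>A. act (f i) v)"
  by (induction A rule: infinite_finite_induct) (simp_all add: act_add)

lemma act_single: "act (Poly_Mapping.single w c) v = sc c (foldr act1 (letters w) v)"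
  by (cases "c = 0") (simp_all add: act_def)

lemma act_word: "act (scal c * prod_list (map gen gs)) v = sc c (foldr act1 gs v)"
  by (simp add: gen_word scal_def mult_single act_single)

lemma act_scal: "act (scal c) v = sc c v"
  using act_word[of c "[]"] by simp

lemma act_one [simp]: "act 1 v = v"
  using act_scal[of 1] by (simp add: sc_one)

lemma act_gen: "act (gen g) v = act1 g v"
  using act_word[of 1 "[g]"] by (simp add: sc_one)

lemma word_closed: "set gs \<subseteq> G \<Longrightarrow> v \<in> V \<Longrightarrow> foldr act1 gs v \<in> V"
  by (induction gs) (auto intro: act1_closed)

lemma word_add: "set gs \<subseteq> G \<Longrightarrow> v \<in> V \<Longrightarrow> w \<in> V \<Longrightarrow>
    foldr act1 gs (v + w) = foldr act1 gs v + foldr act1 gs w"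
  by (induction gs) (auto simp: act1_add word_closed)

lemma word_sc: "set gs \<subseteq> G \<Longrightarrow> v \<in> V \<Longrightarrow> foldr act1 gs (sc c v) = sc c (foldr act1 gs v)"
  by (induction gs) (auto simp: act1_sc word_closed)

lemma act_closed: "a \<in> words_in G \<Longrightarrow> v \<in> V \<Longrightarrow> act a v \<in> V"
  by (induction rule: words_in_induct)
     (auto simp: V_zero act_word act_add intro: V_sc word_closed V_add)

lemma act_add_right: "a \<in> words_in G \<Longrightarrow> v \<in> V \<Longrightarrow> w \<in> V \<Longrightarrow> act a (v + w) = act a v + act a w"
  by (induction rule: words_in_induct) (auto simp: act_word act_add word_add sc_add_right)

lemma act_sc: "a \<in> words_in G \<Longrightarrow> v \<in> V \<Longrightarrow> act a (sc c v) = sc c (act a v)"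
proof (induction rule: words_in_induct)
  case (single d gs)
  have *: "sc d (sc c w) = sc c (sc d w)" for w
    by (metis sc_mult mult.commute)
  show ?case unfolding act_word word_sc[OF single] by (rule *)
qed (simp_all add: act_add sc_add_right)

lemma act_zero_right: "a \<in> words_in G \<Longrightarrow> act a 0 = 0"
  using act_sc[of a 0 0] V_zero by simp

lemma act_mult:
  assumes a: "a \<in> words_in G" and b: "b \<in> words_in G" and v: "v \<in> V"
  shows "act (a * b) v = act a (act b v)"
  using b
proof (induction b rule: words_in_induct)
  case (single d hs)
  show ?case using a
  proof (induction a rule: words_in_induct)
    case (single c gs)
    have "scal c * prod_list (map gen gs) * (scal d * prod_list (map gen hs))
        = scal (c * d) * prod_list (map gen (gs @ hs))"
      by (simp add: scal_mult mult.assoc scal_left_commute[of "prod_list (map gen gs)" d])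
    then show ?case
      using word_sc[OF single word_closed[OF \<open>set hs \<subseteq> G\<close> v], of d]
      by (simp only: act_word) (simp add: sc_mult)
  qed (simp_all add: distrib_right act_add)
next
  case (add b b')
  then show ?case
    using act_add_right[OF a act_closed[OF _ v] act_closed[OF _ v]]
    by (simp add: distrib_left act_add)
qed (simp add: act_zero_right[OF a])

lemma rel_ideal_acts_zero:
  assumes R: "R \<subseteq> words_in G" and zero: "\<And>r v. r \<in> R \<Longrightarrow> v \<in> V \<Longrightarrow> act r v = 0"
    and "a \<in> rel_ideal G R" "v \<in> V"
  shows "act a v = 0"
proof -
  have "a \<in> {a. \<forall>v\<in>V. act a v = 0}"
  proof (rule rel_ideal_least[OF R _ _ _ _ _ _ assms(3)])
    fix a b assume ab: "a \<in> words_in G" "b \<in> {a. \<forall>v\<in>V. act a v = 0}" "b \<in> words_in G"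
    then show "a * b \<in> {a. \<forall>v\<in>V. act a v = 0}" "b * a \<in> {a. \<forall>v\<in>V. act a v = 0}"
      by (simp_all add: act_mult act_closed act_zero_right)
  qed (auto simp: zero act_add act_uminus)
  then show ?thesis using assms(4) by blast
qed

end

section \<open>The polynomial representation of the DAHA of type GL\<close>

lemma TIM_add: "TIM i (u + v) = TIM i u + TIM i v"
  by (simp add: TIM_def TM_add algebra_simps)
lemma TIM_cK: "TIM i (cK c * v) = cK c * TIM i v"
  by (simp add: TIM_def TM_cK distrib_left mult.left_commute)
lemma TIM_mult: "sM i f = f \<Longrightarrow> TIM i (f * v) = f * TIM i v"
  by (simp add: TIM_def TM_mult algebra_simps)

lemma TM_TIM_commute: "i + 1 < j \<or> j + 1 < i \<Longrightarrow> TM i (TIM j v) = TIM j (TM i v)"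
  using TM_commute[of i j] by (simp add: TIM_def TM_add TM_cK)
lemma TIM_TM_commute: "i + 1 < j \<or> j + 1 < i \<Longrightarrow> TIM i (TM j v) = TM j (TIM i v)"
  using TM_TIM_commute[of j i] by auto

lemma TIM_eqI: "TM i v = w \<Longrightarrow> TIM i w = v" by auto

lemma TIM_braid: "TIM (i + 1) (TIM i (TM (i + 1) v)) = TM i (TIM (i + 1) (TIM i v))"
  using TM_braid[of i "TIM (i + 1) (TIM i v)"]
  by (metis TM_TIM(1) TM_TIM(2))

text \<open>The factor commutes with the chain except where the braid relation turns its index from \<open>i + 1\<close>
  to \<open>i\<close>. With \<open>S\<close> as a parameter this covers chains of \<open>T\<close>'s and chains of inverses.\<close>

lemma fold_chain_shift:
  assumes comm: "\<And>j i v. i + 1 < j \<or> j + 1 < i \<Longrightarrow> S j (TM i v) = TM i (S j v)"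
    and braid: "\<And>i v. S (i + 1) (S i (TM (i + 1) v)) = TM i (S (i + 1) (S i v))"
    and "a \<le> i" "i + 1 < b"
  shows "fold S [a..<b] (TM (i + 1) v) = TM i (fold S [a..<b] v)"
proof -
  have out: "(\<And>j. j \<in> set js \<Longrightarrow> i + 1 < j \<or> j + 1 < i) \<Longrightarrow> fold S js (TM i v) = TM i (fold S js v)"
    for js i v
    by (induction js arbitrary: v) (auto simp: comm)
  have "[a..<b] = [a..<i] @ [i, i + 1] @ [i + 2..<b]"
  proof -
    have "[a..<b] = [a..<i] @ [i..<b]" using assms by (metis less_imp_le add_lessD1 upt_add_eq_append le_add_diff_inverse)
    moreover have "[i..<b] = i # (i + 1) # [i + 2..<b]"
      using assms by (simp add: upt_conv_Cons)
    ultimately show ?thesis by simp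
  qed
  then show ?thesis
    using out[of "[a..<i]" "i + 1"] out[of "[i + 2..<b]" i] braid by simp
qed

lemmas fold_TM_shift = fold_chain_shift[of TM, OF TM_commute TM_braid[symmetric]]
lemmas fold_TIM_shift = fold_chain_shift[of TIM, OF TIM_TM_commute TIM_braid]

lemma fold_TM_outside: "(\<And>j. j \<in> set js \<Longrightarrow> i + 1 < j \<or> j + 1 < i) \<Longrightarrow>
    fold TM js (TM i v) = TM i (fold TM js v)"
proof (induction js arbitrary: v)
  case (Cons j js)
  have "i + 1 < j \<or> j + 1 < i" using Cons.prems by simp
  then have "TM j (TM i v) = TM i (TM j v)" by (intro TM_commute) auto
  then show ?case using Cons by simp
qed simp
lemma fold_TIM_outside: "(\<And>j. j \<in> set js \<Longrightarrow> i + 1 < j \<or> j + 1 < i) \<Longrightarrow>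
    fold TIM js (TM i v) = TM i (fold TIM js v)"
proof (induction js arbitrary: v)
  case (Cons j js)
  have "i + 1 < j \<or> j + 1 < i" using Cons.prems by simp
  then have "TIM j (TM i v) = TM i (TIM j v)" by (intro TIM_TM_commute) auto
  then show ?case using Cons by simp
qed simp

lemma fold_TM_add: "fold TM js (u + v) = fold TM js u + fold TM js v"
  and fold_TM_cK: "fold TM js (cK c * v) = cK c * fold TM js v"
  and fold_TIM_add: "fold TIM js (u + v) = fold TIM js u + fold TIM js v"
  and fold_TIM_cK: "fold TIM js (cK c * v) = cK c * fold TIM js v"
  by (induction js arbitrary: u v) (simp_all add: TM_add TM_cK TIM_add TIM_cK)

lemma fold_TM_mult: "(\<And>j. j \<in> set js \<Longrightarrow> sM j f = f) \<Longrightarrow> fold TM js (f * v) = f * fold TM js v"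
  by (induction js arbitrary: v) (simp_all add: TM_mult)
lemma fold_TIM_mult: "(\<And>j. j \<in> set js \<Longrightarrow> sM j f = f) \<Longrightarrow> fold TIM js (f * v) = f * fold TIM js v"
  by (induction js arbitrary: v) (simp_all add: TIM_mult)

text \<open>These are the operators \<open>opY\<close> without the projection \<open>pr1\<close>. In contrast to the latter they satisfy
  all relations of the DAHA at every finite rank.\<close>

definition YM :: "nat \<Rightarrow> nat \<Rightarrow> ratfun \<Rightarrow> ratfun" where
  "YM k i v = cK (tK ^ (k + 1 - i)) * fold TM [1..<i] (omM k (fold TIM [i..<k] v))"

definition YIM :: "nat \<Rightarrow> nat \<Rightarrow> ratfun \<Rightarrow> ratfun" where
  "YIM k i v = foldr TM [i..<k] (omMinv k (foldr TIM [1..<i] (cK (inverse tK ^ (k + 1 - i)) * v)))"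

lemma foldr_fold_TM_TIM: "foldr TM js (fold TIM js v) = v" "foldr TIM js (fold TM js v) = v"
  "fold TIM js (foldr TM js v) = v" "fold TM js (foldr TIM js v) = v"
  by (induction js arbitrary: v) simp_all

lemma cK_tK_inverse [simp]: "cK (inverse tK ^ n) * (cK (tK ^ n) * v) = v"
  "cK (tK ^ n) * (cK (inverse tK ^ n) * v) = v"
  "cK tK * (cK (inverse tK) * v) = v" "cK (inverse tK) * (cK tK * v) = v"
  by (simp_all flip: mult.assoc emb_mult Cst_mult power_mult_distrib)

lemma YM_YIM: assumes "1 \<le> k" shows "YM k i (YIM k i v) = v" "YIM k i (YM k i v) = v"
  unfolding YM_def YIM_def
  by (simp_all only: foldr_fold_TM_TIM omM_omMinv[OF assms] cK_tK_inverse fold_TM_cK)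

lemma YM_add: "1 \<le> k \<Longrightarrow> YM k i (u + v) = YM k i u + YM k i v"
  by (simp add: YM_def fold_TM_add fold_TIM_add omM_rules algebra_simps)
lemma YM_cK: "1 \<le> k \<Longrightarrow> YM k i (cK c * v) = cK c * YM k i v"
  by (simp add: YM_def fold_TM_cK fold_TIM_cK omM_rules mult.left_commute)

lemma YIM_add: "1 \<le> k \<Longrightarrow> YIM k i (u + v) = YIM k i u + YIM k i v"
  by (metis YM_YIM YM_add)
lemma YIM_cK: "1 \<le> k \<Longrightarrow> YIM k i (cK c * v) = cK c * YIM k i v"
  by (metis YM_YIM YM_cK)

lemma YM_Suc: assumes "1 \<le> i" "i < k" shows "YM k (i + 1) v = cK (inverse tK) * TM i (YM k i (TM i v))"
proof -
  have "[i..<k] = i # [i + 1..<k]" using assms by (simp add: upt_conv_Cons)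
  moreover have "k + 1 - i = Suc (k + 1 - (i + 1))" using assms by simp
  moreover have "[1..<i + 1] = [1..<i] @ [i]" using assms by simp
  ultimately show ?thesis
    by (simp add: YM_def TM_cK Cst_mult emb_mult mult.assoc)
qed

lemma omM_TIM: assumes "1 \<le> i" "i + 2 \<le> k" shows "omM k (TIM i v) = TIM (i + 1) (omM k v)"
  using omM_TM[OF assms, of "TIM i v"] by (metis TM_TIM)

lemma TM_YM_commute:
  assumes "1 \<le> i" "i < k" "1 \<le> j" "j \<le> k" "j \<noteq> i" "j \<noteq> i + 1"
  shows "TM i (YM k j v) = YM k j (TM i v)"
proof (cases "j < i")
  case True
  then obtain l where l: "i = l + 1" "j \<le> l" by (metis add.commute less_eq_Suc_le less_natE plus_1_eq_Suc le_add1)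
  have "fold TIM [j..<k] (TM i v) = TM l (fold TIM [j..<k] v)"
    unfolding l by (rule fold_TIM_shift) (use assms l in auto)
  moreover have "omM k (TM l w) = TM i (omM k w)" for w
    unfolding l by (rule omM_TM) (use assms l in auto)
  moreover have "fold TM [1..<j] (TM i w) = TM i (fold TM [1..<j] w)" for w
    by (rule fold_TM_outside) (use l in auto)
  ultimately show ?thesis by (simp add: YM_def TM_cK)
next
  case False
  then have j: "i + 1 < j" using assms by simp
  have "fold TIM [j..<k] (TM i v) = TM i (fold TIM [j..<k] v)"
    by (rule fold_TIM_outside) (use j in auto)
  moreover have "omM k (TM i w) = TM (i + 1) (omM k w)" for w
    by (rule omM_TM) (use assms j in auto)
  moreover have "fold TM [1..<j] (TM (i + 1) w) = TM i (fold TM [1..<j] w)" for w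
    by (rule fold_TM_shift) (use assms j in auto)
  ultimately show ?thesis by (simp add: YM_def TM_cK)
qed

text \<open>Up to scalars \<open>Y_1\<close> is the shift times a chain \<open>D\<close> of inverse \<open>T\<close>'s. Moving both shifts to the
  left turns \<open>Y_1 T_1 Y_1\<close> into \<open>\<omega>^2 E D\<close>, where \<open>T_1\<close> in front becomes \<open>T_(k-1)\<close> behind \<open>\<omega>^2\<close>, and the
  chains turn \<open>T_(k-1)\<close> in front of them into \<open>T_1\<close> behind them.\<close>

lemma YM_1_TM_1:
  assumes k: "2 \<le> k"
  shows "TM 1 (YM k 1 (TM 1 (YM k 1 v))) = YM k 1 (TM 1 (YM k 1 (TM 1 v)))"
proof -
  define D E where "D = fold TIM [1..<k]" and "E = fold TIM [1..<k - 1]"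
  define F where "F = fold TIM [2..<k]"
  have D1: "D (TM 1 w) = F w" for w
  proof -
    have "[1..<k] = 1 # [2..<k]" using k by (simp add: upt_conv_Cons numeral_2_eq_2)
    then show ?thesis unfolding D_def F_def by simp
  qed
  have DE: "D w = TIM (k - 1) (E w)" for w
  proof -
    have "[1..<k] = [1..<k - 1] @ [k - 1]" using k
      by (metis One_nat_def Suc_diff_Suc Suc_le_eq diff_zero le_add_diff_inverse2 less_imp_le numeral_2_eq_2 plus_1_eq_Suc upt_Suc_append zero_less_Suc diff_Suc_1 less_Suc_eq_le le_simps(3) Suc_1 add.commute)
    then show ?thesis unfolding D_def E_def by simp
  qed

  have omE: "omM k (fold TIM js w) = fold TIM (map Suc js) (omM k w)"
    if "\<And>j. j \<in> set js \<Longrightarrow> 1 \<le> j \<and> j + 2 \<le> k" for js w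
    using that
  proof (induction js arbitrary: w)
    case (Cons j js)
    then show ?case using omM_TIM[of j k] by simp
  qed simp
  have Fmap: "[2..<k] = map Suc [1..<k - 1]"
    using k by (simp add: map_Suc_upt numeral_2_eq_2)
  have FE: "F (omM k w) = omM k (E w)" for w
    unfolding F_def E_def Fmap by (rule omE[symmetric]) (use k in auto)
  have DF: "D (fold TIM (map Suc js) w) = fold TIM js (D w)"
    if "\<And>j. j \<in> set js \<Longrightarrow> 1 \<le> j \<and> j + 1 < k" for js w
    using that
  proof (induction js arbitrary: w)
    case (Cons j js)
    have "D (TM (j + 1) u) = TM j (D u)" for u
      unfolding D_def by (rule fold_TIM_shift) (use Cons in auto)
    then have "D (TIM (j + 1) u) = TIM j (D u)" for u by (metis TM_TIM)
    then show ?case using Cons by simp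
  qed simp
  have "TM (k - 1) (E (D w)) = E (F w)" for w
  proof -
    have "E (D w) = D (F w)" unfolding E_def F_def Fmap by (rule DF[symmetric]) auto
    then show ?thesis by (simp add: DE)
  qed
  note key = this
  have ED1: "E (D (TM 1 w)) = E (F w)" for w by (simp only: D1)
  define c where "c = cK (tK ^ k)"
  have Y: "YM k 1 w = c * omM k (D w)" for w
    by (simp add: YM_def c_def D_def)
  have k1: "1 \<le> k" using k by simp
  have c: "D (c * w) = c * D w" "omM k (c * w) = c * omM k w" "TM 1 (c * w) = c * TM 1 w" for w
    unfolding D_def c_def by (simp_all only: fold_TIM_cK omM_rules[OF k1] TM_cK)
  have YTY: "YM k 1 (TM 1 (YM k 1 w)) = c * (c * omM k (omM k (E (D w))))" for w
    unfolding Y by (simp only: D1 c FE)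
  have "TM 1 (YM k 1 (TM 1 (YM k 1 v))) = c * (c * omM k (omM k (E (F v))))"
    by (simp only: YTY c omM_omM_TM[OF k, symmetric] key)
  then show ?thesis by (simp only: YTY ED1)
qed

text \<open>All cases follow from the one of \<open>Y_1\<close> and \<open>Y_2\<close>, since \<open>Y_(j+1)\<close> is built from \<open>Y_j\<close> and \<open>T_j\<close>, and
  \<open>T_j\<close> commutes with the \<open>Y\<close>'s of other indices.\<close>

lemma YM_commute:
  assumes "1 \<le> i" "i \<le> k" "1 \<le> j" "j \<le> k"
  shows "YM k i (YM k j v) = YM k j (YM k i v)"
proof -
  have one: "YM k 1 (YM k j v) = YM k j (YM k 1 v)" if "2 \<le> j" "j \<le> k" for j v
    using that
  proof (induction j arbitrary: v rule: dec_induct)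
    case base
    then have k: "2 \<le> k" by simp
    have 2: "YM k 2 w = cK (inverse tK) * TM 1 (YM k 1 (TM 1 w))" for w
      using YM_Suc[of 1 k w] k by (simp add: numeral_2_eq_2)
    show ?case unfolding 2 using k by (simp add: YM_cK YM_1_TM_1[OF k, simplified])
  next
    case (step j)
    have S: "YM k (Suc j) w = cK (inverse tK) * TM j (YM k j (TM j w))" for w
      using YM_Suc[of j k w] step by simp
    have "YM k 1 (TM j w) = TM j (YM k 1 w)" for w
      by (rule TM_YM_commute[symmetric]) (use step in auto)
    then show ?case unfolding S using step by (simp add: YM_cK)
  qed
  have less: "YM k i (YM k j v) = YM k j (YM k i v)" if "1 \<le> i" "i < j" "j \<le> k" for i j v
    using that
  proof (induction i arbitrary: v rule: dec_induct)
    case base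
    then show ?case using one[of j] by simp
  next
    case (step i)
    have S: "YM k (Suc i) w = cK (inverse tK) * TM i (YM k i (TM i w))" for w
      using YM_Suc[of i k w] step by simp
    have "TM i (YM k j w) = YM k j (TM i w)" for w
      by (rule TM_YM_commute) (use step in auto)
    then show ?case unfolding S using step by (simp add: YM_cK)
  qed
  show ?thesis
    using less[of i j] less[of j i] assms by (cases i j rule: linorder_cases) auto
qed

lemma YM_1_TM_xv:
  assumes k: "2 \<le> k" shows "YM k 1 (TM 1 (xv 1 * v)) = xv 2 * YM k 1 (TM 1 v)"
proof -
  have 1: "[1..<k] = 1 # [2..<k]" using k by (simp add: upt_conv_Cons numeral_2_eq_2)
  have "fold TIM [2..<k] (xv 1 * v) = xv 1 * fold TIM [2..<k] v"
    by (rule fold_TIM_mult) (auto simp: sM_xv adj_swap_def)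
  moreover have "omM k (xv 1 * w) = xv 2 * omM k w" for w
    using k by (simp add: omM_rules omM_xv cyc_def numeral_2_eq_2)
  ultimately show ?thesis
    using k 1 by (simp add: YM_def 1)
qed

definition eM :: "nat \<Rightarrow> ratfun" where "eM r = emb (\<Prod>i=1..r. Var i)"

lemma eM_prod: "eM r = (\<Prod>i=1..r. xv i)"
proof -
  have "emb (prod f A) = (\<Prod>i\<in>A. emb (f i))" for f :: "nat \<Rightarrow> pol" and A
    by (induction A rule: infinite_finite_induct) (simp_all add: emb_mult)
  then show ?thesis by (simp add: eM_def)
qed

lemma alg_hom_prod: "alg_hom u \<Longrightarrow> u (prod f A) = (\<Prod>i\<in>A. u (f i))"
  by (induction A rule: infinite_finite_induct) (simp_all add: alg_hom_rules)

lemma sM_eM: assumes "1 \<le> i" "i \<noteq> r" shows "sM i (eM r) = eM r"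
proof -
  have "sM i (eM r) = (\<Prod>j=1..r. xv (adj_swap i j))"
    by (simp add: eM_prod alg_hom_prod[OF alg_hom_sM] sM_xv)
  also have "\<dots> = eM r"
    unfolding eM_prod
    by (rule prod.reindex_bij_witness[of _ "adj_swap i" "adj_swap i"])
       (use assms in \<open>auto simp: adj_swap_def split: if_splits\<close>)
  finally show ?thesis .
qed

lemma omM_eM: assumes k: "1 \<le> k" shows "omM k (eM k) = cK qK * eM k"
proof -
  have "omM k (eM k) = (\<Prod>j=1..k. cK (if j = k then qK else 1)) * (\<Prod>j=1..k. xv (cyc k j))"
    by (simp add: eM_prod alg_hom_prod[OF alg_hom_omM[OF k]] omM_xv[OF k] prod.distrib)
  also have "(\<Prod>j=1..k. cK (if j = k then qK else 1)) = cK qK"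
    using k by (subst prod.remove[of _ k]) auto
  also have "(\<Prod>j=1..k. xv (cyc k j)) = eM k"
    unfolding eM_prod
    by (rule prod.reindex_bij_witness[of _ "cyc_inv k" "cyc k"])
       (use k in \<open>auto simp: cyc_def cyc_inv_def\<close>)
  finally show ?thesis .
qed

lemma YM_eM: assumes k: "1 \<le> k" "1 \<le> i" "i \<le> k" shows "YM k i (eM k * v) = cK qK * eM k * YM k i v"
proof -
  have "fold TIM [i..<k] (eM k * v) = eM k * fold TIM [i..<k] v"
    by (rule fold_TIM_mult) (use k in \<open>auto intro!: sM_eM\<close>)
  moreover have "fold TM [1..<i] (eM k * w) = eM k * fold TM [1..<i] w" for w
    by (rule fold_TM_mult) (use k in \<open>auto intro!: sM_eM\<close>)
  ultimately show ?thesis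
    by (simp add: YM_def omM_eM[OF k(1)] omM_rules[OF k(1)] fold_TM_cK mult.assoc mult.left_commute)
qed

text \<open>Letters outside rank \<open>k\<close> act by zero; the action then ignores the words that are deleted when
  relations are applied in the free algebra on all letters.\<close>

definition opM :: "nat \<Rightarrow> dgen \<Rightarrow> ratfun \<Rightarrow> ratfun" where
  "opM k g v = (if g \<in> daha_gens k then (case g of GT i \<Rightarrow> TM i v | GX i \<Rightarrow> xv i * v
     | GY i \<Rightarrow> YM k i v | GXi i \<Rightarrow> v / xv i | GYi i \<Rightarrow> YIM k i v) else 0)"

definition actM :: "nat \<Rightarrow> dgen falg \<Rightarrow> ratfun \<Rightarrow> ratfun" where
  "actM k = free_action.act (\<lambda>c v. cK c * v) (opM k)"

lemma daha_gens_simps [simp]: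
  "GT i \<in> daha_gens k \<longleftrightarrow> 1 \<le> i \<and> i < k" "GX i \<in> daha_gens k \<longleftrightarrow> 1 \<le> i \<and> i \<le> k"
  "GY i \<in> daha_gens k \<longleftrightarrow> 1 \<le> i \<and> i \<le> k" "GXi i \<in> daha_gens k \<longleftrightarrow> 1 \<le> i \<and> i \<le> k"
  "GYi i \<in> daha_gens k \<longleftrightarrow> 1 \<le> i \<and> i \<le> k"
  by (auto simp: daha_gens_def)

lemma sdaha_gens_simps [simp]:
  "GT i \<in> sdaha_gens \<longleftrightarrow> 1 \<le> i" "GX i \<in> sdaha_gens \<longleftrightarrow> 1 \<le> i" "GY i \<in> sdaha_gens \<longleftrightarrow> 1 \<le> i"
  "GXi i \<notin> sdaha_gens" "GYi i \<notin> sdaha_gens"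
  by (auto simp: sdaha_gens_def)

lemma free_action_opM: "free_action (\<lambda>c v. cK c * v) UNIV UNIV (opM k)"
proof
  fix g :: dgen and a v w
  show "opM k g (v + w) = opM k g v + opM k g w"
    by (cases g) (simp_all add: opM_def TM_add YM_add YIM_add algebra_simps add_divide_distrib)
  show "opM k g (cK a * v) = cK a * opM k g v"
    by (cases g) (simp_all add: opM_def TM_cK YM_cK YIM_cK mult.left_commute)
qed (simp_all add: Cst_hom emb_hom algebra_simps)

interpretation MA: free_action "\<lambda>c v. cK c * v" UNIV UNIV "opM k"
  rewrites "free_action.act (\<lambda>c v. cK c * v) (opM k) = actM k" for k
  by (rule free_action_opM) (simp add: actM_def)

lemma words_in_UNIV [simp]: "a \<in> words_in UNIV" by (simp add: words_in_def)

lemma actM_mult: "actM k (a * b) v = actM k a (actM k b v)"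
  by (rule MA.act_mult) simp_all

lemmas actM_simps = actM_mult MA.act_add MA.act_diff MA.act_gen MA.act_scal MA.act_uminus

lemma daha_relatorsI:
  "i \<in> I \<Longrightarrow> j \<in> I \<Longrightarrow> i + 1 < j \<or> j + 1 < i \<Longrightarrow> TT i * TT j - TT j * TT i \<in> daha_relators I J"
  "i \<in> I \<Longrightarrow> i + 1 \<in> I \<Longrightarrow> TT i * TT (i + 1) * TT i - TT (i + 1) * TT i * TT (i + 1) \<in> daha_relators I J"
  "i \<in> I \<Longrightarrow> (TT i - 1) * (TT i + scal tK) \<in> daha_relators I J"
  "i \<in> I \<Longrightarrow> scal tK * Tinv i * XX i * Tinv i - XX (i + 1) \<in> daha_relators I J"
  "i \<in> I \<Longrightarrow> j \<in> J \<Longrightarrow> j \<noteq> i \<Longrightarrow> j \<noteq> i + 1 \<Longrightarrow> TT i * XX j - XX j * TT i \<in> daha_relators I J"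
  "i \<in> J \<Longrightarrow> j \<in> J \<Longrightarrow> XX i * XX j - XX j * XX i \<in> daha_relators I J"
  "i \<in> I \<Longrightarrow> scal (inverse tK) * TT i * YY i * TT i - YY (i + 1) \<in> daha_relators I J"
  "i \<in> I \<Longrightarrow> j \<in> J \<Longrightarrow> j \<noteq> i \<Longrightarrow> j \<noteq> i + 1 \<Longrightarrow> TT i * YY j - YY j * TT i \<in> daha_relators I J"
  "i \<in> J \<Longrightarrow> j \<in> J \<Longrightarrow> YY i * YY j - YY j * YY i \<in> daha_relators I J"
  "1 \<in> I \<Longrightarrow> YY 1 * TT 1 * XX 1 - XX 2 * YY 1 * TT 1 \<in> daha_relators I J"
  unfolding daha_relators_def by blast+

lemma daha_relators_cases:
  assumes "r \<in> daha_relators I J"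
  obtains (TT) i j where "r = TT i * TT j - TT j * TT i" "i \<in> I" "j \<in> I" "i + 1 < j \<or> j + 1 < i"
  | (braid) i where "r = TT i * TT (i + 1) * TT i - TT (i + 1) * TT i * TT (i + 1)" "i \<in> I" "i + 1 \<in> I"
  | (quad) i where "r = (TT i - 1) * (TT i + scal tK)" "i \<in> I"
  | (X) i where "r = scal tK * Tinv i * XX i * Tinv i - XX (i + 1)" "i \<in> I"
  | (TX) i j where "r = TT i * XX j - XX j * TT i" "i \<in> I" "j \<in> J" "j \<noteq> i" "j \<noteq> i + 1"
  | (XX) i j where "r = XX i * XX j - XX j * XX i" "i \<in> J" "j \<in> J"
  | (Y) i where "r = scal (inverse tK) * TT i * YY i * TT i - YY (i + 1)" "i \<in> I"
  | (TY) i j where "r = TT i * YY j - YY j * TT i" "i \<in> I" "j \<in> J" "j \<noteq> i" "j \<noteq> i + 1"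
  | (YY) i j where "r = YY i * YY j - YY j * YY i" "i \<in> J" "j \<in> J"
  | (YTX) "r = YY 1 * TT 1 * XX 1 - XX 2 * YY 1 * TT 1" "1 \<in> I"
  using assms unfolding daha_relators_def by blast

lemma daha_relators_mono: "I \<subseteq> I' \<Longrightarrow> J \<subseteq> J' \<Longrightarrow> daha_relators I J \<subseteq> daha_relators I' J'"
proof (rule subsetI)
  fix r assume IJ: "I \<subseteq> I'" "J \<subseteq> J'" and "r \<in> daha_relators I J"
  from this(3) show "r \<in> daha_relators I' J'"
    by (cases rule: daha_relators_cases; hypsubst; intro daha_relatorsI; use IJ in blast)
qed

lemma daha_relators_words:
  assumes "GT ` I \<subseteq> G" "GX ` J \<subseteq> G" "GY ` J \<subseteq> G" "I \<subseteq> J" "Suc ` I \<subseteq> J"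
  shows "daha_relators I J \<subseteq> words_in G"
proof -
  have "\<And>i. i \<in> I \<Longrightarrow> GT i \<in> G" "\<And>i. i \<in> J \<Longrightarrow> GX i \<in> G" "\<And>i. i \<in> J \<Longrightarrow> GY i \<in> G"
    "\<And>i. i \<in> I \<Longrightarrow> i \<in> J" "\<And>i. i \<in> I \<Longrightarrow> Suc i \<in> J"
    using assms by auto
  then show ?thesis
    unfolding daha_relators_def
    by (auto intro!: words_in_intros) (simp add: numeral_2_eq_2)?
qed

lemma sdaha_relators_words: "sdaha_relators \<subseteq> words_in sdaha_gens"
  unfolding sdaha_relators_def by (rule daha_relators_words) auto

lemma Xprod_words: "(\<And>i. 1 \<le> i \<Longrightarrow> i \<le> k \<Longrightarrow> GX i \<in> G) \<Longrightarrow> Xprod k \<in> words_in G"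
  unfolding Xprod_def by (rule words_in_prod_list) auto

lemma gl_relators_words: assumes "1 \<le> k" shows "gl_relators k \<subseteq> words_in (daha_gens k)"
proof -
  have "daha_relators {1..<k} {1..k} \<subseteq> words_in (daha_gens k)"
    by (rule daha_relators_words) auto
  moreover have "Xprod k \<in> words_in (daha_gens k)" by (rule Xprod_words) simp
  ultimately show ?thesis
    using assms unfolding gl_relators_def by (auto intro!: words_in_intros)
qed

lemma actM_Xprod: assumes "r \<le> k" shows "actM k (Xprod r) v = eM r * v"
  using assms
proof (induction r arbitrary: v)
  case 0
  then show ?case by (simp add: Xprod_def eM_def)
next
  case (Suc r)
  have "Xprod (Suc r) = Xprod r * XX (Suc r)" by (simp add: Xprod_def)
  then show ?case using Suc by (simp add: actM_simps opM_def eM_prod)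
qed

lemma actM_Tinv: "1 \<le> i \<Longrightarrow> i < k \<Longrightarrow> actM k (Tinv i) v = TIM i v"
  by (simp add: Tinv_def actM_simps opM_def TIM_def)

lemma TIM_xv: "cK tK * TIM i (xv i * TIM i v) = xv (i + 1) * v"
proof -
  have "TM i (xv (i + 1) * v) = cK tK * (xv i * TIM i v)"
    unfolding TM_xv_Suc by (simp add: TIM_def mult.left_commute[of _ "xv i"])
  then have "xv (i + 1) * v = TIM i (cK tK * (xv i * TIM i v))" by (metis TM_TIM(2))
  then show ?thesis by (simp add: TIM_cK)
qed

lemma daha_relators_act_zero:
  assumes "r \<in> daha_relators {1..<k} {1..k}" shows "actM k r v = 0"
proof -
  have quad: "TM i (TM i v) + cK tK * TM i v - (TM i v + cK tK * v) = 0" for i v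
    by (simp add: TM_quadratic algebra_simps)
  show ?thesis
    using assms unfolding daha_relators_def
    apply (elim UnE)
             apply (auto simp: actM_simps opM_def TM_commute)[1]
            apply (auto simp: actM_simps opM_def TM_braid[simplified])[1]
           apply (auto simp: actM_simps opM_def TM_add TM_cK quad)[1]
          apply (auto simp: actM_simps actM_Tinv opM_def TIM_xv[simplified])[1]
         apply (auto simp: actM_simps opM_def TM_xv_other)[1]
        apply (auto simp: actM_simps opM_def)[1]
       apply (auto simp: actM_simps opM_def YM_Suc[simplified])[1]
      apply (auto simp: actM_simps opM_def TM_YM_commute)[1]
     apply (auto simp: actM_simps opM_def YM_commute)[1]
    apply (auto simp: actM_simps opM_def YM_1_TM_xv[simplified])[1]
    done
qed

lemma gl_relators_act_zero:
  assumes k: "1 \<le> k" and "r \<in> gl_relators k" shows "actM k r v = 0"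
proof -
  consider "r \<in> daha_relators {1..<k} {1..k}"
    | i where "1 \<le> i" "i \<le> k" "r \<in> {XX i * XI i - 1, XI i * XX i - 1, YY i * YI i - 1, YI i * YY i - 1}"
    | "r = YY 1 * Xprod k - scal qK * Xprod k * YY 1"
    using assms(2) unfolding gl_relators_def by auto
  then show ?thesis
  proof cases
    case 1
    then show ?thesis by (rule daha_relators_act_zero)
  next
    case (2 i)
    then show ?thesis by (auto simp: actM_simps opM_def YM_YIM)
  next
    case 3
    then show ?thesis
      using k YM_eM[of k 1 v] by (simp add: actM_simps actM_Xprod opM_def mult.assoc)
  qed
qed

abbreviation gl_ideal :: "nat \<Rightarrow> dgen falg set" where
  "gl_ideal k \<equiv> rel_ideal (daha_gens k) (gl_relators k)"

lemma gl_ideal_act_zero: "1 \<le> k \<Longrightarrow> a \<in> gl_ideal k \<Longrightarrow> actM k a v = 0"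
proof -
  assume k: "1 \<le> k" and a: "a \<in> gl_ideal k"
  interpret A: free_action "\<lambda>c v. cK c * v" UNIV "daha_gens k" "opM k"
    using free_action_opM[of k] unfolding free_action_def by auto
  show "actM k a v = 0"
    unfolding actM_def
    by (rule A.rel_ideal_acts_zero[OF gl_relators_words[OF k] _ a])
       (use gl_relators_act_zero[OF k] in \<open>auto simp: actM_def\<close>)
qed

section \<open>Normal forms in the DAHA of type GL\<close>

definition Tw :: "nat list \<Rightarrow> dgen falg" where "Tw b = prod_list (map TT b)"
definition Xw :: "nat list \<Rightarrow> dgen falg" where "Xw b = prod_list (map XX b)"
definition Yw :: "nat list \<Rightarrow> dgen falg" where "Yw b = prod_list (map YY b)"

lemma word_simps [simp]:
  "Tw [] = 1" "Tw (i # b) = TT i * Tw b" "Tw (b @ b') = Tw b * Tw b'"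
  "Xw [] = 1" "Xw (i # b) = XX i * Xw b" "Xw (b @ b') = Xw b * Xw b'"
  "Yw [] = 1" "Yw (i # b) = YY i * Yw b" "Yw (b @ b') = Yw b * Yw b'"
  by (simp_all add: Tw_def Xw_def Yw_def)

text \<open>One word for each permutation of \<open>n\<close> letters: a permutation of \<open>n + 1\<close> letters is a cycle that
  moves the last letter to its place, times a permutation of \<open>n\<close> letters.\<close>

fun perm_words :: "nat \<Rightarrow> nat list set" where
  "perm_words 0 = {[]}"
| "perm_words (Suc n) = {[i..<Suc n] @ b | i b. 1 \<le> i \<and> i \<le> Suc n \<and> b \<in> perm_words n}"

lemma perm_words_SucI:
  "1 \<le> i \<Longrightarrow> i \<le> Suc n \<Longrightarrow> b \<in> perm_words n \<Longrightarrow> [i..<Suc n] @ b \<in> perm_words (Suc n)"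
  by (simp only: perm_words.simps) blast

lemma perm_words_letters: "b \<in> perm_words n \<Longrightarrow> j \<in> set b \<Longrightarrow> 1 \<le> j \<and> j < n"
  by (induction n arbitrary: b) (fastforce simp: less_Suc_eq_le)+

lemma perm_words_Nil: "[] \<in> perm_words n"
proof (induction n)
  case (Suc n)
  have "[] = [Suc n..<Suc n] @ []" by simp
  then show ?case using Suc by (fastforce simp del: upt_Suc)
qed simp

lemma finite_perm_words: "finite (perm_words n)"
proof (induction n)
  case (Suc n)
  have "perm_words (Suc n) \<subseteq> (\<lambda>(i, b). [i..<Suc n] @ b) ` ({1..Suc n} \<times> perm_words n)"
    by (force simp del: upt_Suc)
  then show ?case by (rule finite_subset) (use Suc in simp)
qed simp

definition relS :: "nat \<Rightarrow> dgen falg set" where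
  "relS k = {a. restrict_words (daha_gens k) a \<in> gl_ideal k}"

lemma relS_iff: "a \<in> words_in (daha_gens k) \<Longrightarrow> a \<in> relS k \<longleftrightarrow> a \<in> gl_ideal k"
  by (simp add: relS_def restrict_words_id)

lemma opM_outside: "g \<notin> daha_gens k \<Longrightarrow> opM k g v = 0" by (simp add: opM_def)

lemma actM_restrict_words: "actM k (restrict_words (daha_gens k) a) v = actM k a v"
proof (induction a rule: poly_mapping_additive_induct)
  case (single w c)
  have z: "opM k g 0 = 0" for g using MA.act1_sc[of g 0 k 0] by simp
  have "foldr (opM k) gs v = 0" if "\<not> set gs \<subseteq> daha_gens k" for gs
    using that
  proof (induction gs)
    case (Cons g gs)
    then show ?case by (cases "g \<in> daha_gens k") (auto simp: z opM_outside)
  qed simp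
  then show ?case by (simp add: restrict_words_single MA.act_single)
qed (simp_all add: restrict_words_add MA.act_add)

lemma relS_act_zero: "1 \<le> k \<Longrightarrow> a \<in> relS k \<Longrightarrow> actM k a v = 0"
  using gl_ideal_act_zero[of k "restrict_words (daha_gens k) a" v]
  by (simp add: relS_def actM_restrict_words)

definition pos_gens :: "nat \<Rightarrow> dgen set" where
  "pos_gens n = GT ` {1..<n} \<union> GX ` {1..n} \<union> GY ` {1..n}"

lemmas scal_move [simp] = scal_central[of _ "gen g" for g, symmetric]
  scal_left_commute[of "gen g" for g]

lemma scal_scal: "scal a * (scal b * c) = scal (a * b) * c"
  by (simp add: scal_mult mult.assoc)

locale gl_daha =
  fixes k :: nat
  assumes k: "2 \<le> k"
begin

lemma k1: "1 \<le> k" using k by simp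

sublocale two_sided_ideal "relS k"
proof
  note w = gl_relators_words[OF k1]
  show "0 \<in> relS k" by (simp add: relS_def rel_ideal_zero[OF w])
  show "a \<in> relS k \<Longrightarrow> b \<in> relS k \<Longrightarrow> a + b \<in> relS k" for a b
    by (simp add: relS_def restrict_words_add rel_ideal_add[OF w])
  show "b \<in> relS k \<Longrightarrow> a * b \<in> relS k" for a b
    by (simp add: relS_def restrict_words_mult rel_ideal_left[OF w] restrict_words_words)
  show "b \<in> relS k \<Longrightarrow> b * a \<in> relS k" for a b
    by (simp add: relS_def restrict_words_mult rel_ideal_right[OF w] restrict_words_words)
qed

notation cg (infix \<open>\<asymp>\<close> 50)

lemma relator: "l - r \<in> gl_relators k \<Longrightarrow> l \<asymp> r"
  using relS_iff[of "l - r"] gl_relators_words[OF k1] rel_ideal_relator[OF gl_relators_words[OF k1]]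
  unfolding cg_def by blast

lemma daha_relator: "l - r \<in> daha_relators {1..<k} {1..k} \<Longrightarrow> l \<asymp> r"
  by (rule relator) (simp add: gl_relators_def)

lemma cg_act: "a \<asymp> b \<Longrightarrow> actM k a v = actM k b v"
  using relS_act_zero[OF k1, of "a - b" v] by (simp add: cg_def MA.act_diff)

lemma TT_comm: assumes "1 \<le> i" "i < k" "1 \<le> j" "j < k" "i + 1 < j \<or> j + 1 < i"
  shows "TT i * TT j \<asymp> TT j * TT i"
  by (intro daha_relator daha_relatorsI) (use assms in auto)

lemma TT_braid: assumes "1 \<le> i" "i + 1 < k"
  shows "TT i * TT (i + 1) * TT i \<asymp> TT (i + 1) * TT i * TT (i + 1)"
  by (intro daha_relator daha_relatorsI) (use assms in auto)

lemma TT_quad: assumes "1 \<le> i" "i < k"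
  shows "TT i * TT i \<asymp> scal (1 - tK) * TT i + scal tK"
proof (rule daha_relator)
  have "TT i * TT i - (scal (1 - tK) * TT i + scal tK) = (TT i - 1) * (TT i + scal tK)"
    by (simp add: algebra_simps scal_diff)
  then show "TT i * TT i - (scal (1 - tK) * TT i + scal tK) \<in> daha_relators {1..<k} {1..k}"
    using daha_relatorsI(3)[of i "{1..<k}" "{1..k}"] assms by simp
qed

lemma X_rel: assumes "1 \<le> i" "i < k" shows "scal tK * Tinv i * XX i * Tinv i \<asymp> XX (i + 1)"
  by (intro daha_relator daha_relatorsI) (use assms in auto)

lemma TX_comm: assumes "1 \<le> i" "i < k" "1 \<le> j" "j \<le> k" "j \<noteq> i" "j \<noteq> i + 1"
  shows "TT i * XX j \<asymp> XX j * TT i"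
  by (intro daha_relator daha_relatorsI) (use assms in auto)

lemma XX_comm: assumes "1 \<le> i" "i \<le> k" "1 \<le> j" "j \<le> k" shows "XX i * XX j \<asymp> XX j * XX i"
  by (intro daha_relator daha_relatorsI) (use assms in auto)

lemma Y_rel: assumes "1 \<le> i" "i < k" shows "scal (inverse tK) * TT i * YY i * TT i \<asymp> YY (i + 1)"
  by (intro daha_relator daha_relatorsI) (use assms in auto)

lemma TY_comm: assumes "1 \<le> i" "i < k" "1 \<le> j" "j \<le> k" "j \<noteq> i" "j \<noteq> i + 1"
  shows "TT i * YY j \<asymp> YY j * TT i"
  by (intro daha_relator daha_relatorsI) (use assms in auto)

lemma YY_comm: assumes "1 \<le> i" "i \<le> k" "1 \<le> j" "j \<le> k" shows "YY i * YY j \<asymp> YY j * YY i"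
  by (intro daha_relator daha_relatorsI) (use assms in auto)

lemma YTX: "YY 1 * TT 1 * XX 1 \<asymp> XX 2 * YY 1 * TT 1"
  by (intro daha_relator daha_relatorsI) (use k in auto)

lemma X_XI: assumes "1 \<le> i" "i \<le> k" shows "XX i * XI i \<asymp> 1" "XI i * XX i \<asymp> 1"
  by (rule relator, use assms in \<open>unfold gl_relators_def, auto\<close>)+

lemma Y_Xprod: "YY 1 * Xprod k \<asymp> scal qK * Xprod k * YY 1"
  by (rule relator) (simp add: gl_relators_def)

lemma TT_Tinv: assumes "1 \<le> i" "i < k" shows "TT i * Tinv i \<asymp> 1" "Tinv i * TT i \<asymp> 1"
proof -
  have "scal (inverse tK) * (TT i * TT i + scal (tK - 1) * TT i)
     \<asymp> scal (inverse tK) * (scal (1 - tK) * TT i + scal tK + scal (tK - 1) * TT i)"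
    by (intro cg_left cg_add TT_quad assms cg_refl)
  also have "\<dots> = 1"
  proof -
    have *: "scal (1 - tK) * TT i + scal tK + scal (tK - 1) * TT i = scal tK"
      by (simp add: scal_diff algebra_simps)
    show ?thesis unfolding * by (simp flip: scal_mult)
  qed
  finally have *: "scal (inverse tK) * (TT i * TT i + scal (tK - 1) * TT i) \<asymp> 1" .
  then show "TT i * Tinv i \<asymp> 1" "Tinv i * TT i \<asymp> 1"
    by (simp_all add: Tinv_def algebra_simps)
qed

lemma Tinv_scal: "scal tK * Tinv i = TT i + scal (tK - 1)"
  by (simp add: Tinv_def scal_scal)

text \<open>With these relations of Bernstein type every \<open>T\<close> can be moved to the left of a \<open>Y\<close> and to the
  right of an \<open>X\<close>, without introducing inverses.\<close>

lemma YT: assumes "1 \<le> i" "i < k"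
  shows "YY i * TT i \<asymp> TT i * YY (i + 1) + scal (tK - 1) * YY (i + 1)"
    and "YY (i + 1) * TT i \<asymp> scal (1 - tK) * YY (i + 1) + TT i * YY i"
proof -
  have rel: "YY (i + 1) \<asymp> scal (inverse tK) * (TT i * (YY i * TT i))"
    using cg_sym[OF Y_rel[OF assms]] by (simp add: mult.assoc)
  have "(TT i + scal (tK - 1)) * YY (i + 1)
     \<asymp> (scal tK * Tinv i) * (scal (inverse tK) * (TT i * (YY i * TT i)))"
    unfolding Tinv_scal by (rule cg_left[OF rel])
  also have "\<dots> = Tinv i * (TT i * (YY i * TT i))"
    by (simp add: mult.assoc scal_left_commute[of _ "inverse tK"] scal_scal)
  also have "\<dots> \<asymp> YY i * TT i"
    using cg_tail2[OF TT_Tinv(2)[OF assms], of "YY i * TT i"] by simp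
  finally show "YY i * TT i \<asymp> TT i * YY (i + 1) + scal (tK - 1) * YY (i + 1)"
    by (simp add: cg_sym distrib_right)
  have "YY (i + 1) * TT i \<asymp> scal (inverse tK) * (TT i * (YY i * TT i)) * TT i"
    by (rule cg_right[OF rel])
  also have "\<dots> = scal (inverse tK) * (TT i * (YY i * (TT i * TT i)))" by (simp add: mult.assoc)
  also have "\<dots> \<asymp> scal (inverse tK) * (TT i * (YY i * (scal (1 - tK) * TT i + scal tK)))"
    by (intro cg_left TT_quad assms)
  also have "\<dots> = scal (1 - tK) * (scal (inverse tK) * (TT i * (YY i * TT i))) + TT i * YY i"
    by (simp add: distrib_left scal_scal mult.commute)
  also have "\<dots> \<asymp> scal (1 - tK) * YY (i + 1) + TT i * YY i"
    by (intro cg_add cg_left cg_sym[OF rel] cg_refl)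
  finally show "YY (i + 1) * TT i \<asymp> scal (1 - tK) * YY (i + 1) + TT i * YY i" .
qed

lemma TX: assumes "1 \<le> i" "i < k"
  shows "TT i * XX (i + 1) \<asymp> XX i * TT i + scal (tK - 1) * XX i"
    and "TT i * XX i \<asymp> scal (1 - tK) * XX i + XX (i + 1) * TT i"
proof -
  have rel: "XX (i + 1) \<asymp> Tinv i * (XX i * (scal tK * Tinv i))"
    using cg_sym[OF X_rel[OF assms]] by (simp add: mult.assoc scal_left_commute[of "Tinv i"])
  have "TT i * XX (i + 1) \<asymp> TT i * (Tinv i * (XX i * (scal tK * Tinv i)))"
    by (rule cg_left[OF rel])
  also have "\<dots> \<asymp> XX i * (scal tK * Tinv i)"
    using cg_tail2[OF TT_Tinv(1)[OF assms], of "XX i * (scal tK * Tinv i)"] by simp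
  also have "\<dots> = XX i * TT i + scal (tK - 1) * XX i"
    unfolding Tinv_scal by (simp add: distrib_left)
  finally show 1: "TT i * XX (i + 1) \<asymp> XX i * TT i + scal (tK - 1) * XX i" .
  have X: "XX i \<asymp> scal (inverse tK) * (TT i * (XX (i + 1) * TT i))"
  proof -
    have "TT i * (XX (i + 1) * TT i) \<asymp> TT i * (Tinv i * (XX i * (scal tK * Tinv i)) * TT i)"
      by (intro cg_left cg_right rel)
    also have "\<dots> = scal tK * (TT i * (Tinv i * (XX i * (Tinv i * TT i))))"
      by (simp add: mult.assoc scal_left_commute[of "Tinv i"])
    also have "\<dots> \<asymp> scal tK * (XX i * (Tinv i * TT i))"
      using cg_left[OF cg_tail2[OF TT_Tinv(1)[OF assms]]] by simp
    also have "\<dots> \<asymp> scal tK * (XX i * 1)" by (intro cg_left TT_Tinv assms)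
    finally have "scal (inverse tK) * (TT i * (XX (i + 1) * TT i)) \<asymp> scal (inverse tK) * (scal tK * XX i)"
      by (intro cg_left) simp
    also have "\<dots> = XX i" by (simp add: scal_scal)
    finally show ?thesis by (rule cg_sym)
  qed
  have "TT i * XX i \<asymp> TT i * (scal (inverse tK) * (TT i * (XX (i + 1) * TT i)))"
    by (rule cg_left[OF X])
  also have "\<dots> = scal (inverse tK) * ((TT i * TT i) * (XX (i + 1) * TT i))" by (simp add: mult.assoc)
  also have "\<dots> \<asymp> scal (inverse tK) * ((scal (1 - tK) * TT i + scal tK) * (XX (i + 1) * TT i))"
    by (intro cg_left cg_right TT_quad assms)
  also have "\<dots> = scal (1 - tK) * (scal (inverse tK) * (TT i * (XX (i + 1) * TT i))) + XX (i + 1) * TT i"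
    by (simp add: distrib_left distrib_right scal_scal mult.assoc mult.commute)
  also have "\<dots> \<asymp> scal (1 - tK) * XX i + XX (i + 1) * TT i"
    by (intro cg_add cg_left cg_sym[OF X] cg_refl)
  finally show "TT i * XX i \<asymp> scal (1 - tK) * XX i + XX (i + 1) * TT i" .
qed

lemma Tw_commute:
  assumes "1 \<le> j" "j < k" "\<And>i. i \<in> set b \<Longrightarrow> 1 \<le> i \<and> i < k \<and> (i + 1 < j \<or> j + 1 < i)"
  shows "TT j * Tw b \<asymp> Tw b * TT j"
  using assms(3)
proof (induction b)
  case (Cons i b)
  have "TT j * Tw (i # b) = (TT j * TT i) * Tw b" by (simp add: mult.assoc)
  also have "\<dots> \<asymp> (TT i * TT j) * Tw b" using assms Cons.prems[of i] by (intro cg_right TT_comm) auto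
  also have "\<dots> = TT i * (TT j * Tw b)" by (simp add: mult.assoc)
  also have "\<dots> \<asymp> TT i * (Tw b * TT j)" using Cons by (intro cg_left) auto
  finally show ?case by (simp add: mult.assoc)
qed simp

lemma Tw_shift:
  assumes "1 \<le> i" "i \<le> j" "j + 1 < n" "n \<le> k"
  shows "TT (j + 1) * Tw [i..<n] \<asymp> Tw [i..<n] * TT j"
proof -
  have split: "[i..<n] = [i..<j] @ j # (j + 1) # [j + 2..<n]"
  proof -
    have "[i..<n] = [i..<j] @ [j..<n]" using assms by (metis less_imp_le add_lessD1 upt_add_eq_append le_add_diff_inverse)
    then show ?thesis using assms by (simp add: upt_conv_Cons)
  qed
  define A B where "A = Tw [i..<j]" and "B = Tw [j + 2..<n]"
  have "TT (j + 1) * Tw [i..<n] = TT (j + 1) * A * (TT j * TT (j + 1) * B)"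
    unfolding split A_def B_def by (simp add: mult.assoc)
  also have "\<dots> \<asymp> A * TT (j + 1) * (TT j * TT (j + 1) * B)"
    unfolding A_def by (intro cg_right Tw_commute) (use assms in auto)
  also have "\<dots> = A * ((TT (j + 1) * TT j * TT (j + 1)) * B)" by (simp add: mult.assoc)
  also have "\<dots> \<asymp> A * ((TT j * TT (j + 1) * TT j) * B)"
    by (intro cg_left cg_right cg_sym[OF TT_braid]) (use assms in auto)
  also have "\<dots> = A * (TT j * (TT (j + 1) * (TT j * B)))" by (simp add: mult.assoc)
  also have "\<dots> \<asymp> A * (TT j * (TT (j + 1) * (B * TT j)))"
    unfolding B_def by (intro cg_left Tw_commute) (use assms in auto)
  also have "\<dots> = Tw [i..<n] * TT j"
    unfolding split A_def B_def by (simp add: mult.assoc)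
  finally show ?thesis .
qed

subsection \<open>The span of the words in the \<open>T\<close>'s and \<open>Y\<close>'s\<close>

inductive_set Tspan :: "nat \<Rightarrow> dgen falg set" for n where
  base: "b \<in> perm_words n \<Longrightarrow> Tw b \<in> Tspan n"
| add: "a \<in> Tspan n \<Longrightarrow> b \<in> Tspan n \<Longrightarrow> a + b \<in> Tspan n"
| scal: "a \<in> Tspan n \<Longrightarrow> scal c * a \<in> Tspan n"
| closed: "a \<in> Tspan n \<Longrightarrow> a \<asymp> b \<Longrightarrow> b \<in> Tspan n"

lemma Tspan_chain:
  assumes "a \<in> Tspan n" "1 \<le> i" "i \<le> Suc n" shows "Tw [i..<Suc n] * a \<in> Tspan (Suc n)"
  using assms(1)
proof induction
  case (base b)
  have "[i..<Suc n] @ b \<in> perm_words (Suc n)" using base assms by (intro perm_words_SucI)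
  then show ?case using Tspan.base by (metis word_simps(3))
next
  case (add a b)
  then show ?case by (simp add: distrib_left Tspan.add del: upt_Suc)
next
  case (scal a c)
  then show ?case by (simp add: scal_left_commute[of _ c] Tspan.scal del: upt_Suc)
next
  case (closed a b)
  then show ?case using Tspan.closed cg_left by blast
qed

text \<open>Multiplication of a word \<open>T_i \<dots> T_n b\<close> by \<open>T_j\<close> either prolongs the first chain, or is resolved by
  the quadratic relation, or passes the chain and acts on \<open>b\<close>.\<close>

lemma TT_Tspan:
  assumes "n \<le> k" "1 \<le> j" "j < n" "a \<in> Tspan n" shows "TT j * a \<in> Tspan n"
  using assms
proof (induction n arbitrary: j a)
  case (Suc n)
  from Suc.prems(4) show ?case
  proof induction
    case (base b)
    then obtain i b' where b: "b = [i..<Suc n] @ b'" "1 \<le> i" "i \<le> Suc n" "b' \<in> perm_words n" by auto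
    have b'T: "Tw b' \<in> Tspan n" using b by (intro Tspan.base)
    consider "j + 1 < i" | "j + 1 = i" | "j = i" | l where "j = l + 1" "i \<le> l"
      by (metis Suc_eq_plus1 Suc_leI linorder_neqE_nat le_neq_implies_less less_natE le_add1 add.commute add_Suc)
    then show ?case
    proof cases
      case 1
      have "TT j * Tw b = (TT j * Tw [i..<Suc n]) * Tw b'" by (simp add: b mult.assoc del: upt_Suc)
      also have "\<dots> \<asymp> (Tw [i..<Suc n] * TT j) * Tw b'"
        by (intro cg_right Tw_commute) (use 1 Suc.prems b in auto)
      also have "\<dots> = Tw [i..<Suc n] * (TT j * Tw b')" by (simp add: mult.assoc)
      finally have *: "TT j * Tw b \<asymp> Tw [i..<Suc n] * (TT j * Tw b')" .
      have "TT j * Tw b' \<in> Tspan n" using 1 Suc.prems b by (intro Suc.IH b'T) auto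
      then show ?thesis using Tspan.closed[OF Tspan_chain cg_sym[OF *]] b by blast
    next
      case 2
      have "[j..<Suc n] = j # [i..<Suc n]" using 2 b by (subst upt_conv_Cons) (auto simp del: upt_Suc)
      then have jb: "j # b = [j..<Suc n] @ b'" unfolding b by simp
      have "j # b \<in> perm_words (Suc n)"
        unfolding jb using b Suc.prems 2 by (intro perm_words_SucI) auto
      then show ?thesis using Tspan.base[of "j # b"] by simp
    next
      case 3
      define c where "c = [i + 1..<Suc n] @ b'"
      have bc: "b = j # c" unfolding b c_def 3 using Suc.prems 3 by (simp add: upt_conv_Cons del: upt_Suc)
      have c: "Tw c \<in> Tspan (Suc n)" unfolding c_def 
        using b Suc.prems 3 by (intro Tspan.base perm_words_SucI) auto
      have "(scal (1 - tK) * TT j + scal tK) * Tw c = scal (1 - tK) * Tw b + scal tK * Tw c"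
        unfolding bc by (simp add: distrib_right mult.assoc)
      moreover have "TT j * Tw b \<asymp> (scal (1 - tK) * TT j + scal tK) * Tw c"
        unfolding bc using cg_tail2[OF TT_quad[of j]] Suc.prems by simp
      moreover have "scal (1 - tK) * Tw b + scal tK * Tw c \<in> Tspan (Suc n)"
        by (intro Tspan.add Tspan.scal c Tspan.base[OF base])
      ultimately show ?thesis using Tspan.closed cg_sym by metis
    next
      case (4 l)
      have "TT j * Tw b = (TT (l + 1) * Tw [i..<Suc n]) * Tw b'" by (simp add: b 4 mult.assoc del: upt_Suc)
      also have "\<dots> \<asymp> (Tw [i..<Suc n] * TT l) * Tw b'"
        by (intro cg_right Tw_shift) (use 4 Suc.prems b in auto)
      also have "\<dots> = Tw [i..<Suc n] * (TT l * Tw b')" by (simp add: mult.assoc)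
      finally have *: "TT j * Tw b \<asymp> Tw [i..<Suc n] * (TT l * Tw b')" .
      have "TT l * Tw b' \<in> Tspan n" using 4 Suc.prems b by (intro Suc.IH b'T) auto
      then show ?thesis using Tspan.closed[OF Tspan_chain cg_sym[OF *]] b by blast
    qed
  next
    case (add a b)
    then show ?case by (simp add: distrib_left Tspan.add)
  next
    case (scal a c)
    then show ?case by (simp add: Tspan.scal)
  next
    case (closed a b)
    then show ?case using Tspan.closed cg_left by blast
  qed
qed simp

definition Y_words :: "nat \<Rightarrow> nat list set" where
  "Y_words n = {L. sorted L \<and> set L \<subseteq> {1..k} \<and> length L \<le> n}"

inductive_set TYspan :: "nat \<Rightarrow> dgen falg set" for n where
  base: "b \<in> perm_words k \<Longrightarrow> L \<in> Y_words n \<Longrightarrow> Tw b * Yw L \<in> TYspan n"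
| add: "a \<in> TYspan n \<Longrightarrow> b \<in> TYspan n \<Longrightarrow> a + b \<in> TYspan n"
| scal: "a \<in> TYspan n \<Longrightarrow> scal c * a \<in> TYspan n"
| closed: "a \<in> TYspan n \<Longrightarrow> a \<asymp> b \<Longrightarrow> b \<in> TYspan n"

lemma Tspan_Yw: "a \<in> Tspan k \<Longrightarrow> L \<in> Y_words n \<Longrightarrow> a * Yw L \<in> TYspan n"
proof (induction rule: Tspan.induct)
  case (closed a b)
  then show ?case using TYspan.closed cg_right by blast
qed (auto simp: distrib_right mult.assoc intro: TYspan.base TYspan.add TYspan.scal)

lemma TT_TYspan: assumes "1 \<le> j" "j < k" "a \<in> TYspan n" shows "TT j * a \<in> TYspan n"
  using assms(3)
proof induction
  case (base b L)
  then have "TT j * Tw b * Yw L \<in> TYspan n"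
    using assms by (intro Tspan_Yw TT_Tspan Tspan.base) auto
  then show ?case by (simp add: mult.assoc)
next
  case (add a b)
  then show ?case by (simp add: distrib_left TYspan.add)
next
  case (scal a c)
  then show ?case by (simp add: TYspan.scal)
next
  case (closed a b)
  then show ?case using TYspan.closed cg_left by blast
qed

lemma TYspan_cg_eq: "a * b * v \<asymp> E \<Longrightarrow> E = R \<Longrightarrow> R \<in> TYspan n \<Longrightarrow> a * (b * v) \<in> TYspan n"
  using TYspan.closed cg_sym by (simp add: mult.assoc)

lemma TYspan_cg_assoc: "a * b * v \<asymp> c * d * v \<Longrightarrow> c * (d * v) \<in> TYspan n \<Longrightarrow> a * (b * v) \<in> TYspan n"
  by (rule TYspan_cg_eq[of a b v "c * d * v"]) (simp_all add: mult.assoc)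

lemma Yw_insort: assumes "set L \<subseteq> {1..k}" "1 \<le> j" "j \<le> k" shows "YY j * Yw L \<asymp> Yw (insort j L)"
  using assms(1)
proof (induction L)
  case (Cons i L)
  show ?case
  proof (cases "j \<le> i")
    case False
    have "YY j * Yw (i # L) = YY j * YY i * Yw L" by (simp add: mult.assoc)
    also have "\<dots> \<asymp> YY i * YY j * Yw L" using Cons assms by (intro cg_right YY_comm) auto
    also have "\<dots> = YY i * (YY j * Yw L)" by (simp add: mult.assoc)
    also have "\<dots> \<asymp> YY i * Yw (insort j L)" using Cons by (intro cg_left) auto
    finally show ?thesis using False by simp
  qed simp
qed simp

text \<open>The letter \<open>Y_j\<close> passes the word in the \<open>T\<close>'s by the Bernstein relations, changing its index on the
  way; this is why the induction is for all \<open>j\<close> at once.\<close>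

lemma YY_TYspan: assumes "1 \<le> j" "j \<le> k" "a \<in> TYspan n" shows "YY j * a \<in> TYspan (Suc n)"
  using assms(3)
proof induction
  case (base b L)
  have "YY j * (Tw b * Yw L) \<in> TYspan (Suc n)" if "set b \<subseteq> {1..<k}" "1 \<le> j" "j \<le> k" for b j
    using that
  proof (induction b arbitrary: j)
    case Nil
    have L: "set L \<subseteq> {1..k}" "sorted L" "length L \<le> n" using base by (auto simp: Y_words_def)
    have "Tw [] * Yw (insort j L) \<in> TYspan (Suc n)"
      using L Nil by (intro TYspan.base perm_words_Nil)
        (auto simp: Y_words_def sorted_insort set_insort_key)
    then have "Yw (insort j L) \<in> TYspan (Suc n)" by simp
    then show ?case using TYspan.closed cg_sym[OF Yw_insort[OF L(1) Nil(2,3)]] by simp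
  next
    case (Cons i b)
    define v where "v = Tw b * Yw L"
    have IH: "YY j * v \<in> TYspan (Suc n)" if "1 \<le> j" "j \<le> k" for j
      using Cons that unfolding v_def by auto
    have i: "1 \<le> i" "i < k" using Cons by auto
    consider "j \<noteq> i" "j \<noteq> i + 1" | "j = i" | "j = i + 1" by blast
    then have "YY j * (TT i * v) \<in> TYspan (Suc n)"
    proof cases
      case 1
      have "YY j * TT i * v \<asymp> TT i * YY j * v"
        using 1 i Cons by (intro cg_right cg_sym[OF TY_comm]) auto
      moreover have "TT i * (YY j * v) \<in> TYspan (Suc n)" using i Cons by (intro TT_TYspan IH) auto
      ultimately show ?thesis by (rule TYspan_cg_assoc)
    next
      case 2
      have "YY j * TT i * v \<asymp> (TT i * YY (i + 1) + scal (tK - 1) * YY (i + 1)) * v"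
        unfolding 2 by (intro cg_right YT i)
      moreover have "(TT i * YY (i + 1) + scal (tK - 1) * YY (i + 1)) * v
          = TT i * (YY (i + 1) * v) + scal (tK - 1) * (YY (i + 1) * v)"
        by (simp add: distrib_right mult.assoc)
      moreover have "TT i * (YY (i + 1) * v) + scal (tK - 1) * (YY (i + 1) * v) \<in> TYspan (Suc n)"
        using i by (intro TYspan.add TYspan.scal TT_TYspan IH) auto
      ultimately show ?thesis by (rule TYspan_cg_eq)
    next
      case 3
      have "YY j * TT i * v \<asymp> (scal (1 - tK) * YY (i + 1) + TT i * YY i) * v"
        unfolding 3 by (intro cg_right YT i)
      moreover have "(scal (1 - tK) * YY (i + 1) + TT i * YY i) * v
          = scal (1 - tK) * (YY (i + 1) * v) + TT i * (YY i * v)"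
        by (simp add: distrib_right mult.assoc)
      moreover have "scal (1 - tK) * (YY (i + 1) * v) + TT i * (YY i * v) \<in> TYspan (Suc n)"
        using i by (intro TYspan.add TYspan.scal TT_TYspan IH) auto
      ultimately show ?thesis by (rule TYspan_cg_eq)
    qed
    then show ?case by (simp add: v_def mult.assoc)
  qed
  moreover have "set b \<subseteq> {1..<k}" using perm_words_letters[OF base(1)] by auto
  ultimately show ?case using assms by simp
next
  case (add a b)
  then show ?case by (simp add: distrib_left TYspan.add)
next
  case (scal a c)
  then show ?case by (simp add: TYspan.scal)
next
  case (closed a b)
  then show ?case using TYspan.closed cg_left by blast
qed

lemma Tw_TYspan: "set b \<subseteq> {1..<k} \<Longrightarrow> a \<in> TYspan n \<Longrightarrow> Tw b * a \<in> TYspan n"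
  by (induction b) (auto simp: mult.assoc intro: TT_TYspan)

text \<open>This represents \<open>t^k \<omega>\<close>. Unlike \<open>Y_1\<close> it merely permutes the \<open>X\<close>'s, up to \<open>q\<close>, when it passes them, and
  together with the \<open>T\<close>'s it generates \<open>Y_1\<close>.\<close>

definition om :: "dgen falg" where "om = YY 1 * Tw [1..<k]"

lemma om_TYspan: "a \<in> TYspan n \<Longrightarrow> om * a \<in> TYspan (Suc n)"
  unfolding om_def mult.assoc by (intro YY_TYspan Tw_TYspan) (use k in auto)

lemma om_TT: assumes "1 \<le> j" "j + 1 < k" shows "om * TT j \<asymp> TT (j + 1) * om"
proof -
  have "om * TT j = YY 1 * (Tw [1..<k] * TT j)" by (simp add: om_def mult.assoc)
  also have "\<dots> \<asymp> YY 1 * (TT (j + 1) * Tw [1..<k])"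
    by (intro cg_left cg_sym[OF Tw_shift]) (use assms in auto)
  also have "\<dots> = YY 1 * TT (j + 1) * Tw [1..<k]" by (simp add: mult.assoc)
  also have "\<dots> \<asymp> TT (j + 1) * YY 1 * Tw [1..<k]"
    by (intro cg_right cg_sym[OF TY_comm]) (use assms in auto)
  finally show ?thesis by (simp add: om_def mult.assoc)
qed

lemma om_Tinv: assumes "1 \<le> j" "j + 1 < k" shows "om * Tinv j \<asymp> Tinv (j + 1) * om"
proof -
  have "om * Tinv j = scal (inverse tK) * (om * TT j + scal (tK - 1) * om)"
    by (simp add: Tinv_def distrib_left scal_left_commute[of om] scal_central[of _ om])
  also have "\<dots> \<asymp> scal (inverse tK) * (TT (j + 1) * om + scal (tK - 1) * om)"
    by (intro cg_left cg_add om_TT assms cg_refl)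
  finally show ?thesis by (simp add: Tinv_def distrib_right mult.assoc)
qed

lemma TX_Tw: assumes "1 \<le> j" "j \<le> k" "\<And>i. i \<in> set b \<Longrightarrow> 1 \<le> i \<and> i < k \<and> j \<noteq> i \<and> j \<noteq> i + 1"
  shows "Tw b * XX j \<asymp> XX j * Tw b"
  using assms(3)
proof (induction b)
  case (Cons i b)
  have "Tw (i # b) * XX j = TT i * (Tw b * XX j)" by (simp add: mult.assoc)
  also have "\<dots> \<asymp> TT i * (XX j * Tw b)" using Cons by (intro cg_left) auto
  also have "\<dots> = TT i * XX j * Tw b" by (simp add: mult.assoc)
  also have "\<dots> \<asymp> XX j * TT i * Tw b" using Cons.prems[of i] assms by (intro cg_right TX_comm) auto
  finally show ?case by (simp add: mult.assoc)
qed simp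

lemma om_XX: assumes "1 \<le> j" "j < k" shows "om * XX j \<asymp> XX (j + 1) * om"
  using assms
proof (induction j rule: dec_induct)
  case base
  have s: "[1..<k] = 1 # [2..<k]" using k by (simp add: upt_conv_Cons numeral_2_eq_2)
  have "om * XX 1 = YY 1 * TT 1 * (Tw [2..<k] * XX 1)" unfolding om_def s by (simp add: mult.assoc)
  also have "\<dots> \<asymp> YY 1 * TT 1 * (XX 1 * Tw [2..<k])"
    by (intro cg_left TX_Tw) (use k in auto)
  also have "\<dots> = YY 1 * TT 1 * XX 1 * Tw [2..<k]" by (simp add: mult.assoc)
  also have "\<dots> \<asymp> XX 2 * YY 1 * TT 1 * Tw [2..<k]" by (intro cg_right YTX)
  finally show ?case unfolding om_def s by (simp add: mult.assoc numeral_2_eq_2)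
next
  case (step j)
  then have j: "1 \<le> j" "j < k" "j + 1 < k" by auto
  have "om * XX (Suc j) \<asymp> om * (scal tK * Tinv j * XX j * Tinv j)"
    using cg_left[OF cg_sym[OF X_rel[OF j(1,2)]]] by simp
  also have "\<dots> = scal tK * (om * Tinv j * (XX j * Tinv j))"
    by (simp add: mult.assoc scal_left_commute[of om])
  also have "\<dots> \<asymp> scal tK * (Tinv (j + 1) * om * (XX j * Tinv j))"
    by (intro cg_left cg_right om_Tinv j)
  also have "\<dots> = scal tK * (Tinv (j + 1) * (om * XX j * Tinv j))" by (simp add: mult.assoc)
  also have "\<dots> \<asymp> scal tK * (Tinv (j + 1) * (XX (j + 1) * om * Tinv j))"
    using step by (intro cg_left cg_right) auto
  also have "\<dots> = scal tK * (Tinv (j + 1) * (XX (j + 1) * (om * Tinv j)))" by (simp add: mult.assoc)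
  also have "\<dots> \<asymp> scal tK * (Tinv (j + 1) * (XX (j + 1) * (Tinv (j + 1) * om)))"
    by (intro cg_left om_Tinv j)
  also have "\<dots> = scal tK * Tinv (j + 1) * XX (j + 1) * Tinv (j + 1) * om" by (simp add: mult.assoc)
  also have "\<dots> \<asymp> XX (j + 1 + 1) * om" using j by (intro cg_right X_rel) auto
  finally show ?case by simp
qed

lemma Xw_swap:
  assumes "set b \<subseteq> {1..k}" "1 \<le> j" "j \<le> k" shows "XX j * Xw b \<asymp> Xw b * XX j"
  using assms(1)
proof (induction b)
  case (Cons i b)
  have "XX j * Xw (i # b) = XX j * XX i * Xw b" by (simp add: mult.assoc)
  also have "\<dots> \<asymp> XX i * XX j * Xw b" using Cons assms by (intro cg_right XX_comm) auto
  also have "\<dots> = XX i * (XX j * Xw b)" by (simp add: mult.assoc)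
  also have "\<dots> \<asymp> XX i * (Xw b * XX j)" using Cons by (intro cg_left) auto
  finally show ?case by (simp add: mult.assoc)
qed simp

lemma Xw_perm:
  assumes "set b \<subseteq> {1..k}" "mset b = mset c" shows "Xw b \<asymp> Xw c"
  using assms
proof (induction b arbitrary: c)
  case (Cons i b)
  then obtain c1 c2 where c: "c = c1 @ i # c2"
    by (metis list.set_intros(1) mset_eq_setD split_list)
  have eq: "mset b = mset (c1 @ c2)" using Cons c by simp
  have "set c1 \<subseteq> set (i # b)" using mset_eq_setD[OF Cons.prems(2)] c by auto
  then have set: "set c1 \<subseteq> {1..k}" using Cons.prems(1) by blast
  have "Xw (i # b) = XX i * Xw b" by simp
  also have "\<dots> \<asymp> XX i * Xw (c1 @ c2)"
    using Cons.IH[of "c1 @ c2"] Cons.prems(1) eq by (intro cg_left) auto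
  also have "\<dots> = XX i * Xw c1 * Xw c2" by (simp add: mult.assoc)
  also have "\<dots> \<asymp> Xw c1 * XX i * Xw c2" using Cons by (intro cg_right Xw_swap set) auto
  finally show ?case by (simp add: c mult.assoc)
qed simp

lemma Xprod_Xw: "Xprod n = Xw [1..<Suc n]" by (simp add: Xprod_def Xw_def)

lemma TT_Xpair: assumes "1 \<le> i" "i < k"
  shows "TT i * (XX i * XX (i + 1)) \<asymp> XX i * XX (i + 1) * TT i"
proof -
  have "TT i * (XX i * XX (i + 1)) \<asymp> (scal (1 - tK) * XX i + XX (i + 1) * TT i) * XX (i + 1)"
    using cg_right[OF TX(2)[OF assms], of "XX (i + 1)"] by (simp add: mult.assoc)
  also have "\<dots> = scal (1 - tK) * (XX i * XX (i + 1)) + XX (i + 1) * (TT i * XX (i + 1))"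
    by (simp add: distrib_right mult.assoc)
  also have "\<dots> \<asymp> scal (1 - tK) * (XX i * XX (i + 1)) + XX (i + 1) * (XX i * TT i + scal (tK - 1) * XX i)"
    by (intro cg_add cg_left TX assms cg_refl)
  also have "\<dots> = scal (1 - tK) * (XX i * XX (i + 1)) + (XX (i + 1) * XX i) * TT i + scal (tK - 1) * (XX (i + 1) * XX i)"
    by (simp add: distrib_left mult.assoc)
  also have "\<dots> \<asymp> scal (1 - tK) * (XX i * XX (i + 1)) + (XX i * XX (i + 1)) * TT i + scal (tK - 1) * (XX i * XX (i + 1))"
    by (intro cg_add cg_left cg_right XX_comm cg_refl) (use assms in auto)
  also have "\<dots> = XX i * XX (i + 1) * TT i"
    by (simp add: scal_diff algebra_simps)
  finally show ?thesis .
qed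

lemma TX_Xw: assumes "1 \<le> i" "i < k" "\<And>j. j \<in> set b \<Longrightarrow> 1 \<le> j \<and> j \<le> k \<and> j \<noteq> i \<and> j \<noteq> i + 1"
  shows "TT i * Xw b \<asymp> Xw b * TT i"
  using assms(3)
proof (induction b)
  case (Cons j b)
  have "TT i * Xw (j # b) = TT i * XX j * Xw b" by (simp add: mult.assoc)
  also have "\<dots> \<asymp> XX j * TT i * Xw b" using Cons.prems[of j] assms by (intro cg_right TX_comm) auto
  also have "\<dots> = XX j * (TT i * Xw b)" by (simp add: mult.assoc)
  also have "\<dots> \<asymp> XX j * (Xw b * TT i)" using Cons by (intro cg_left) auto
  finally show ?case by (simp add: mult.assoc)
qed simp

lemma TT_Xprod: assumes "1 \<le> i" "i < k" shows "TT i * Xprod k \<asymp> Xprod k * TT i"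
proof -
  have split: "[1..<Suc k] = [1..<i] @ i # (i + 1) # [i + 2..<Suc k]"
  proof -
    have "[1..<Suc k] = [1..<i] @ [i..<Suc k]" using assms
      by (metis le_SucI less_imp_le upt_add_eq_append le_add_diff_inverse)
    then show ?thesis using assms by (simp add: upt_conv_Cons del: upt_Suc)
  qed
  define A B where "A = Xw [1..<i]" and "B = Xw [i + 2..<Suc k]"
  have AB: "TT i * A \<asymp> A * TT i" "TT i * B \<asymp> B * TT i"
    unfolding A_def B_def by (intro TX_Xw; use assms in auto)+
  have "TT i * Xprod k = TT i * A * (XX i * XX (i + 1) * B)"
    unfolding Xprod_Xw split A_def B_def by (simp add: mult.assoc del: upt_Suc)
  also have "\<dots> \<asymp> A * TT i * (XX i * XX (i + 1) * B)" by (intro cg_right AB)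
  also have "\<dots> = A * (TT i * (XX i * XX (i + 1)) * B)" by (simp add: mult.assoc)
  also have "\<dots> \<asymp> A * (XX i * XX (i + 1) * TT i * B)"
    by (intro cg_left cg_right TT_Xpair assms)
  also have "\<dots> = A * (XX i * XX (i + 1) * (TT i * B))" by (simp add: mult.assoc)
  also have "\<dots> \<asymp> A * (XX i * XX (i + 1) * (B * TT i))" by (intro cg_left AB)
  also have "\<dots> = Xprod k * TT i"
    unfolding Xprod_Xw split A_def B_def by (simp add: mult.assoc del: upt_Suc)
  finally show ?thesis .
qed

lemma om_Xprod: "om * Xprod k \<asymp> scal qK * (Xprod k * om)"
proof -
  have "Tw b * Xprod k \<asymp> Xprod k * Tw b" if "set b \<subseteq> {1..<k}" for b
    using that
  proof (induction b)
    case (Cons i b)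
    have "Tw (i # b) * Xprod k = TT i * (Tw b * Xprod k)" by (simp add: mult.assoc)
    also have "\<dots> \<asymp> TT i * (Xprod k * Tw b)" using Cons by (intro cg_left) auto
    also have "\<dots> = TT i * Xprod k * Tw b" by (simp add: mult.assoc)
    also have "\<dots> \<asymp> Xprod k * TT i * Tw b" using Cons by (intro cg_right TT_Xprod) auto
    finally show ?case by (simp add: mult.assoc)
  qed simp
  then have "Tw [1..<k] * Xprod k \<asymp> Xprod k * Tw [1..<k]" by simp
  then have "om * Xprod k \<asymp> YY 1 * (Xprod k * Tw [1..<k])"
    unfolding om_def mult.assoc by (rule cg_left)
  also have "\<dots> = YY 1 * Xprod k * Tw [1..<k]" by (simp add: mult.assoc)
  also have "\<dots> \<asymp> scal qK * Xprod k * YY 1 * Tw [1..<k]" by (intro cg_right Y_Xprod)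
  finally show ?thesis by (simp add: om_def mult.assoc)
qed

lemma cancel_Xw: assumes "set b \<subseteq> {1..k}" "Xw b * a \<asymp> Xw b * c" shows "a \<asymp> c"
  using assms
proof (induction b)
  case (Cons i b)
  have i: "1 \<le> i" "i \<le> k" using Cons by auto
  have "Xw b * a \<asymp> XI i * XX i * (Xw b * a)"
    using cg_sym[OF cg_right[OF X_XI(2)[OF i], of "Xw b * a"]] by simp
  also have "\<dots> \<asymp> XI i * XX i * (Xw b * c)"
    using cg_left[OF Cons.prems(2), of "XI i"] by (simp add: mult.assoc)
  also have "\<dots> \<asymp> Xw b * c"
    using cg_right[OF X_XI(2)[OF i], of "Xw b * c"] by simp
  finally show ?case using Cons by auto
qed simp

text \<open>In the relation between \<open>\<omega>\<close> and \<open>X_1 \<dots> X_k\<close> the first \<open>k - 1\<close> factors are shifted by \<open>\<omega>\<close>; the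
  resulting common factor \<open>X_2 \<dots> X_k\<close> can be cancelled because the \<open>X\<close>'s are invertible.\<close>

lemma om_XX_last: "om * XX k \<asymp> scal qK * (XX 1 * om)"
proof -
  have s: "[1..<Suc k] = 1 # [2..<Suc k]"
    using k by (simp add: upt_conv_Cons numeral_2_eq_2 del: upt_Suc)
  have shift: "om * Xw b \<asymp> Xw (map Suc b) * om" if "set b \<subseteq> {1..<k}" for b
    using that
  proof (induction b)
    case (Cons j b)
    have "om * Xw (j # b) = om * XX j * Xw b" by (simp add: mult.assoc)
    also have "\<dots> \<asymp> XX (j + 1) * om * Xw b" using Cons by (intro cg_right om_XX) auto
    also have "\<dots> = XX (j + 1) * (om * Xw b)" by (simp add: mult.assoc)
    also have "\<dots> \<asymp> XX (j + 1) * (Xw (map Suc b) * om)" using Cons by (intro cg_left) auto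
    finally show ?case by (simp add: mult.assoc)
  qed simp
  have "Xw [2..<Suc k] * (om * XX k) = Xw (map Suc [1..<k]) * om * XX k"
    by (simp add: map_Suc_upt numeral_2_eq_2 mult.assoc del: upt_Suc)
  also have "\<dots> \<asymp> om * Xw [1..<k] * XX k" by (intro cg_right cg_sym[OF shift]) auto
  also have "\<dots> = om * Xprod k" using k1 by (simp add: Xprod_Xw mult.assoc)
  also have "\<dots> \<asymp> scal qK * (Xprod k * om)" by (rule om_Xprod)
  also have "\<dots> = scal qK * (XX 1 * Xw [2..<Suc k] * om)"
    unfolding Xprod_Xw s by (simp del: upt_Suc)
  also have "\<dots> \<asymp> scal qK * (Xw [2..<Suc k] * XX 1 * om)"
    using k by (intro cg_left cg_right Xw_swap) auto
  also have "\<dots> = Xw [2..<Suc k] * (scal qK * (XX 1 * om))"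
    by (simp add: mult.assoc scal_left_commute[of "Xw _"] del: upt_Suc)
  finally show ?thesis by (rule cancel_Xw[rotated]) (use k in auto)
qed

subsection \<open>Every element without inverses has a normal form\<close>

text \<open>The letters \<open>X\<close> are put on the left. As a left multiplication by \<open>\<omega>\<close> maps \<open>X\<close>'s to \<open>X\<close>'s, closure
  under \<open>T\<close>'s and \<open>\<omega>\<close> is immediate from that of \<open>TYspan\<close>.\<close>

inductive_set normal :: "dgen falg set" where
  base: "a \<in> TYspan n \<Longrightarrow> a \<in> normal"
| add: "a \<in> normal \<Longrightarrow> b \<in> normal \<Longrightarrow> a + b \<in> normal"
| scal: "a \<in> normal \<Longrightarrow> scal c * a \<in> normal"
| XX: "a \<in> normal \<Longrightarrow> 1 \<le> j \<Longrightarrow> j \<le> k \<Longrightarrow> XX j * a \<in> normal"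
| closed: "a \<in> normal \<Longrightarrow> a \<asymp> b \<Longrightarrow> b \<in> normal"

lemma normal_cg_eq: "a * b * v \<asymp> E \<Longrightarrow> E = R \<Longrightarrow> R \<in> normal \<Longrightarrow> a * (b * v) \<in> normal"
  using normal.closed cg_sym by (simp add: mult.assoc)

lemma normal_cg_assoc: "a * b * v \<asymp> c * d * v \<Longrightarrow> c * (d * v) \<in> normal \<Longrightarrow> a * (b * v) \<in> normal"
  by (rule normal_cg_eq[of a b v "c * d * v"]) (simp_all add: mult.assoc)

lemma TT_normal: assumes "1 \<le> i" "i < k" "a \<in> normal" shows "TT i * a \<in> normal"
  using assms(3)
proof induction
  case (base a n)
  then show ?case using TT_TYspan assms normal.base by blast
next
  case (add a b)
  then show ?case by (simp add: distrib_left normal.add)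
next
  case (scal a c)
  then show ?case by (simp add: normal.scal)
next
  case (closed a b)
  then show ?case using normal.closed cg_left by blast
next
  case (XX a j)
  consider "j \<noteq> i" "j \<noteq> i + 1" | "j = i" | "j = i + 1" by blast
  then show ?case
  proof cases
    case 1
    have "TT i * XX j * a \<asymp> XX j * TT i * a" using 1 XX assms by (intro cg_right TX_comm) auto
    moreover have "XX j * (TT i * a) \<in> normal" using XX by (intro normal.XX)
    ultimately show ?thesis by (rule normal_cg_assoc)
  next
    case 2
    have "TT i * XX j * a \<asymp> (scal (1 - tK) * XX i + XX (i + 1) * TT i) * a"
      unfolding 2 by (intro cg_right TX assms)
    moreover have "(scal (1 - tK) * XX i + XX (i + 1) * TT i) * a
        = scal (1 - tK) * (XX i * a) + XX (i + 1) * (TT i * a)"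
      by (simp add: distrib_right mult.assoc)
    moreover have "scal (1 - tK) * (XX i * a) + XX (i + 1) * (TT i * a) \<in> normal"
      using XX assms by (intro normal.add normal.scal normal.XX) auto
    ultimately show ?thesis by (rule normal_cg_eq)
  next
    case 3
    have "TT i * XX j * a \<asymp> (XX i * TT i + scal (tK - 1) * XX i) * a"
      unfolding 3 by (intro cg_right TX assms)
    moreover have "(XX i * TT i + scal (tK - 1) * XX i) * a
        = XX i * (TT i * a) + scal (tK - 1) * (XX i * a)"
      by (simp add: distrib_right mult.assoc)
    moreover have "XX i * (TT i * a) + scal (tK - 1) * (XX i * a) \<in> normal"
      using XX assms by (intro normal.add normal.scal normal.XX) auto
    ultimately show ?thesis by (rule normal_cg_eq)
  qed
qed

lemma Tinv_normal: assumes "1 \<le> i" "i < k" "a \<in> normal" shows "Tinv i * a \<in> normal"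
proof -
  have "Tinv i * a = scal (inverse tK) * (TT i * a + scal (tK - 1) * a)"
    by (simp add: Tinv_def distrib_right mult.assoc)
  moreover have "scal (inverse tK) * (TT i * a + scal (tK - 1) * a) \<in> normal"
    by (intro normal.scal normal.add TT_normal assms)
  ultimately show ?thesis by simp
qed

lemma om_normal: assumes "a \<in> normal" shows "om * a \<in> normal"
  using assms
proof induction
  case (base a n)
  then show ?case using om_TYspan normal.base by blast
next
  case (add a b)
  then show ?case by (simp add: distrib_left normal.add)
next
  case (scal a c)
  then show ?case by (simp add: scal_left_commute[of om] normal.scal)
next
  case (closed a b)
  then show ?case using normal.closed cg_left by blast
next
  case (XX a j)
  show ?case
  proof (cases "j = k")
    case True
    have "om * XX j * a \<asymp> scal qK * (XX 1 * om) * a"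
      unfolding True by (intro cg_right om_XX_last)
    moreover have "scal qK * (XX 1 * om) * a = scal qK * (XX 1 * (om * a))" by (simp add: mult.assoc)
    moreover have "scal qK * (XX 1 * (om * a)) \<in> normal"
      using XX k by (intro normal.scal normal.XX) auto
    ultimately show ?thesis by (rule normal_cg_eq)
  next
    case False
    have "om * XX j * a \<asymp> XX (j + 1) * om * a"
      using XX False by (intro cg_right om_XX) auto
    moreover have "XX (j + 1) * (om * a) \<in> normal"
      using XX False by (intro normal.XX) auto
    ultimately show ?thesis by (rule normal_cg_assoc)
  qed
qed

lemma YY_normal: assumes "1 \<le> i" "i \<le> k" "a \<in> normal" shows "YY i * a \<in> normal"
  using assms
proof (induction i arbitrary: a rule: dec_induct)
  case base
  \<comment> \<open>Division by the \<open>T\<close>'s in \<open>\<omega>\<close> reduces multiplication by \<open>Y_1\<close> to that by \<open>\<omega>\<close>.\<close>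
  have "\<exists>c\<in>normal. Tw b * c \<asymp> a" if "set b \<subseteq> {1..<k}" for b
    using that \<open>a \<in> normal\<close>
  proof (induction b arbitrary: a)
    case (Cons i b)
    have i: "1 \<le> i" "i < k" using Cons by auto
    obtain c where c: "c \<in> normal" "Tw b * c \<asymp> Tinv i * a"
      using Cons.IH[of "Tinv i * a"] Cons.prems Tinv_normal[OF i] by auto
    have "Tw (i # b) * c = TT i * (Tw b * c)" by (simp add: mult.assoc)
    also have "\<dots> \<asymp> TT i * (Tinv i * a)" by (rule cg_left[OF c(2)])
    also have "\<dots> \<asymp> a" using cg_tail2[OF TT_Tinv(1)[OF i], of a] by simp
    finally show ?case using c by blast
  qed auto
  from this[of "[1..<k]"] obtain c where c: "c \<in> normal" "Tw [1..<k] * c \<asymp> a" by auto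
  have "om * c = YY 1 * (Tw [1..<k] * c)" by (simp add: om_def mult.assoc)
  also have "\<dots> \<asymp> YY 1 * a" by (rule cg_left[OF c(2)])
  finally show ?case using normal.closed[OF om_normal[OF c(1)]] by simp
next
  case (step i)
  have i: "1 \<le> i" "i < k" using step by auto
  have "scal (inverse tK) * TT i * YY i * TT i * a \<asymp> YY (i + 1) * a"
    by (intro cg_right Y_rel i)
  moreover have "scal (inverse tK) * (TT i * (YY i * (TT i * a))) \<in> normal"
    using step i by (intro normal.scal TT_normal step.IH) auto
  ultimately show ?case using normal.closed by (simp add: mult.assoc)
qed

lemma pos_words_normal: "a \<in> words_in (pos_gens k) \<Longrightarrow> a \<in> normal"
proof (induction rule: words_in_induct)
  case zero
  have "1 \<in> normal"
    using normal.base[OF TYspan.base[OF perm_words_Nil, of "[]" 0]] by (simp add: Y_words_def)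
  then show ?case using normal.scal[of 1 0] by simp
next
  case (single c gs)
  have "prod_list (map gen gs) \<in> normal" using single
  proof (induction gs)
    case Nil
    show ?case
      using normal.base[OF TYspan.base[OF perm_words_Nil, of "[]" 0]] by (simp add: Y_words_def)
  next
    case (Cons g gs)
    then show ?case by (auto simp: pos_gens_def intro: TT_normal normal.XX YY_normal)
  qed
  then show ?case by (rule normal.scal)
qed (rule normal.add)

end

section \<open>Faithfulness of the polynomial representation\<close>

subsection \<open>Independence of automorphisms\<close>

text \<open>Dedekind's argument: from a relation of minimal length a shorter one is obtained by evaluating
  at a product with an element that separates two of the characters.\<close>

lemma dedekind_independence:
  fixes \<chi> :: "'i \<Rightarrow> pol \<Rightarrow> ratfun"
  assumes "finite A"
    and "\<And>i f g. i \<in> A \<Longrightarrow> f \<in> Pk k \<Longrightarrow> g \<in> Pk k \<Longrightarrow> \<chi> i (f * g) = \<chi> i f * \<chi> i g"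
    and "\<And>i. i \<in> A \<Longrightarrow> \<chi> i 1 = 1"
    and "\<And>i j. i \<in> A \<Longrightarrow> j \<in> A \<Longrightarrow> i \<noteq> j \<Longrightarrow> \<exists>f\<in>Pk k. \<chi> i f \<noteq> \<chi> j f"
    and "\<And>f. f \<in> Pk k \<Longrightarrow> (\<Sum>i\<in>A. c i * \<chi> i f) = 0" "i \<in> A"
  shows "c i = 0"
  using assms
proof (induction A arbitrary: c i)
  case (insert a A)
  have c0: "c j = 0" if j: "j \<in> A" for j
  proof -
    obtain g where g: "g \<in> Pk k" "\<chi> j g \<noteq> \<chi> a g"
      using insert.prems(3)[of j a] j insert.hyps by auto
    have "c j * (\<chi> j g - \<chi> a g) = 0"
    proof (rule insert.IH[of "\<lambda>i. c i * (\<chi> i g - \<chi> a g)" j])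
      fix f assume f: "f \<in> Pk k"
      have "(\<Sum>i\<in>A. c i * (\<chi> i g - \<chi> a g) * \<chi> i f)
          = (\<Sum>i\<in>insert a A. c i * (\<chi> i g - \<chi> a g) * \<chi> i f)"
        using insert.hyps by simp
      also have "\<dots> = (\<Sum>i\<in>insert a A. c i * \<chi> i (g * f)) - \<chi> a g * (\<Sum>i\<in>insert a A. c i * \<chi> i f)"
        unfolding sum_distrib_left sum_subtractf[symmetric]
        by (rule sum.cong) (use insert.prems(1) f g in \<open>auto simp: algebra_simps\<close>)
      also have "\<dots> = 0"
        using insert.prems(4)[OF f] insert.prems(4)[OF Pk_mult[OF g(1) f]] by simp
      finally show "(\<Sum>i\<in>A. c i * (\<chi> i g - \<chi> a g) * \<chi> i f) = 0" .
    qed (use insert.prems j in auto)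
    then show ?thesis using g by simp
  qed
  have "c a * \<chi> a 1 = 0"
    using insert.prems(4)[of 1] insert.hyps c0 by simp
  then have "c a = 0" using insert.prems(2) by simp
  then show ?case using c0 insert.prems(5) by auto
qed simp

interpretation fs: vector_space "\<lambda>(c::ratfun) (\<phi>::pol \<Rightarrow> ratfun) x. c * \<phi> x"
  by unfold_locales (simp_all add: fun_eq_iff algebra_simps)

text \<open>This replaces a triangularity argument with respect to an order on the affine Weyl group: to
  see that the words in the \<open>T\<close>'s and \<open>Y\<close>'s are independent over rational functions, it is enough to
  find as many independent elements in their span, by comparison of cardinalities.\<close>

lemma (in vector_space) spanning_family_independent:
  assumes fin: "finite I" and inj: "inj_on u I" and ind: "independent (u ` I)"
    and span: "u ` I \<subseteq> span (g ` I)" and sum: "(\<Sum>i\<in>I. scale (c i) (g i)) = 0" and i: "i \<in> I"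
  shows "c i = 0"
proof -
  have card_le: "card I \<le> card B" if "u ` I \<subseteq> span B" "finite B" for B
    using independent_span_bound[OF that(2) ind that(1)] inj by (simp add: card_image)
  have injg: "inj_on g I"
  proof (rule eq_card_imp_inj_on[OF fin])
    show "card (g ` I) = card I"
      using card_le[OF span] fin card_image_le[OF fin, of g] by simp
  qed
  have "independent (g ` I)"
  proof
    assume "dependent (g ` I)"
    then obtain a where a: "a \<in> g ` I" "a \<in> span (g ` I - {a})" unfolding dependent_def by blast
    then have "span (g ` I) = span (g ` I - {a})"
      using span_redundant[OF a(2)] by (simp add: insert_absorb)
    then have "card I \<le> card (g ` I - {a})" using card_le span fin by simp
    moreover have "card (g ` I - {a}) < card I"
      using a fin injg by (metis card_Diff1_less card_image finite_imageI)
    ultimately show False by simp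
  qed
  moreover have "(\<Sum>v\<in>g ` I. scale (c (inv_into I g v)) v) = 0"
    using sum by (simp add: sum.reindex[OF injg] injg)
  ultimately have "c (inv_into I g (g i)) = 0"
    using independentD[of "g ` I" "g ` I" "\<lambda>v. c (inv_into I g v)" "g i"] fin i by simp
  then show ?thesis using injg i by simp
qed

context gl_daha
begin

subsection \<open>Polynomial coefficients of the normal form\<close>

text \<open>Polynomials are lifted to the free algebra by choosing the ordered word for each monomial.\<close>

definition canon_word :: "(nat \<Rightarrow>\<^sub>0 nat) \<Rightarrow> nat list" where
  "canon_word m = concat (map (\<lambda>i. replicate (Poly_Mapping.lookup m i) i) [1..<Suc k])"

lemma count_canon:
  "distinct xs \<Longrightarrow> count (mset (concat (map (\<lambda>i. replicate (f i) i) xs))) x = (if x \<in> set xs then f x else 0)"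
  by (induction xs) auto

lemma canon_word_set: "set (canon_word m) \<subseteq> {1..k}"
  by (auto simp: canon_word_def)

lemma canon_word_Cons:
  assumes "1 \<le> j" "j \<le> k"
  shows "mset (canon_word (Poly_Mapping.single j 1 + m)) = mset (j # canon_word m)"
proof (rule multiset_eqI)
  fix x
  show "count (mset (canon_word (Poly_Mapping.single j 1 + m))) x = count (mset (j # canon_word m)) x"
    unfolding canon_word_def
    using assms count_canon[OF distinct_upt, of "Poly_Mapping.lookup (Poly_Mapping.single j 1 + m)" 1 "Suc k" x]
      count_canon[OF distinct_upt, of "Poly_Mapping.lookup m" 1 "Suc k" x]
    by (auto simp: lookup_add lookup_single when_def simp del: upt_Suc)
qed

lemma canon_word_zero [simp]: "canon_word 0 = []"
  by (simp add: canon_word_def)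

definition Xpol :: "pol \<Rightarrow> dgen falg" where
  "Xpol p = (\<Sum>m\<in>Poly_Mapping.keys p. scal (Poly_Mapping.lookup p m) * Xw (canon_word m))"

lemma Xpol_superset:
  assumes "finite A" "Poly_Mapping.keys p \<subseteq> A"
  shows "Xpol p = (\<Sum>m\<in>A. scal (Poly_Mapping.lookup p m) * Xw (canon_word m))"
  unfolding Xpol_def
  by (rule sum.mono_neutral_left) (use assms in \<open>auto simp: not_in_keys_iff_lookup_eq_zero\<close>)

lemma Xpol_zero [simp]: "Xpol 0 = 0" by (simp add: Xpol_def)

lemma Xpol_add: "Xpol (p + q) = Xpol p + Xpol q"
proof -
  let ?A = "Poly_Mapping.keys p \<union> Poly_Mapping.keys q"
  have "Poly_Mapping.keys (p + q) \<subseteq> ?A" by (rule keys_add)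
  then show ?thesis
    by (simp add: Xpol_superset[of ?A] lookup_add scal_add sum.distrib distrib_right)
qed

lemma Xpol_single: "Xpol (Poly_Mapping.single m c) = scal c * Xw (canon_word m)"
  by (cases "c = 0") (simp_all add: Xpol_def)

lemma Xpol_Cst_mult: "Xpol (Cst c * p) = scal c * Xpol p"
  by (induction p rule: poly_mapping_additive_induct)
     (simp_all add: Xpol_add Xpol_single Cst_def mult_single scal_scal distrib_left)

lemma Xpol_Cst: "Xpol (Cst c) = scal c"
  by (simp add: Cst_def Xpol_single)

lemma Xpol_Var_mult: assumes "1 \<le> j" "j \<le> k" shows "Xpol (Var j * p) \<asymp> XX j * Xpol p"
proof (induction p rule: poly_mapping_additive_induct)
  case (single m c)
  have "Xpol (Var j * Poly_Mapping.single m c) = scal c * Xw (canon_word (Poly_Mapping.single j 1 + m))"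
    by (simp add: Var_def mult_single Xpol_single)
  also have "\<dots> \<asymp> scal c * Xw (j # canon_word m)"
    by (intro cg_left Xw_perm canon_word_set canon_word_Cons assms)
  finally show ?case by (simp add: Xpol_single)
qed (simp_all add: distrib_left Xpol_add cg_add)

lemma actM_Xpol: assumes "p \<in> Pk k" shows "actM k (Xpol p) v = emb p * v"
  using assms
proof (induction rule: Pk_induct)
  case (Var i p)
  have "actM k (Xpol (Var i * p)) v = actM k (XX i * Xpol p) v"
    by (intro cg_act Xpol_Var_mult Var)
  then show ?case using Var by (simp add: actM_simps opM_def emb_mult)
qed (simp_all add: Xpol_add Xpol_Cst actM_simps emb_add distrib_right)

abbreviation idx :: "nat \<Rightarrow> (nat list \<times> nat list) set" where
  "idx n \<equiv> perm_words k \<times> Y_words n"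

definition TY :: "nat list \<times> nat list \<Rightarrow> dgen falg" where
  "TY i = Tw (fst i) * Yw (snd i)"

lemma finite_idx: "finite (idx n)"
proof -
  have "Y_words n \<subseteq> {L. set L \<subseteq> {1..k} \<and> length L \<le> n}" by (auto simp: Y_words_def)
  then have "finite (Y_words n)" by (rule finite_subset) (rule finite_lists_length_le, simp)
  then show ?thesis using finite_perm_words by blast
qed

lemma idx_mono: "n \<le> m \<Longrightarrow> idx n \<subseteq> idx m"
  by (auto simp: Y_words_def)

definition has_form :: "dgen falg \<Rightarrow> bool" where
  "has_form a \<longleftrightarrow> (\<exists>n p. (\<forall>i. p i \<in> Pk k) \<and> (\<forall>i. i \<notin> idx n \<longrightarrow> p i = 0) \<and>
     a \<asymp> (\<Sum>i\<in>idx n. Xpol (p i) * TY i))"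

lemma has_form_cg: "has_form a \<Longrightarrow> a \<asymp> b \<Longrightarrow> has_form b"
  unfolding has_form_def using cg_trans cg_sym by blast

lemma has_form_add: assumes "has_form a" "has_form b" shows "has_form (a + b)"
proof -
  obtain n p where p: "\<And>i. p i \<in> Pk k" "\<And>i. i \<notin> idx n \<Longrightarrow> p i = 0"
    "a \<asymp> (\<Sum>i\<in>idx n. Xpol (p i) * TY i)" using assms(1) unfolding has_form_def by blast
  obtain m r where r: "\<And>i. r i \<in> Pk k" "\<And>i. i \<notin> idx m \<Longrightarrow> r i = 0"
    "b \<asymp> (\<Sum>i\<in>idx m. Xpol (r i) * TY i)" using assms(2) unfolding has_form_def by blast
  let ?N = "max n m"
  have sub: "idx n \<subseteq> idx ?N" "idx m \<subseteq> idx ?N" by (intro idx_mono; simp)+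
  have "(\<Sum>i\<in>idx n. Xpol (p i) * TY i) = (\<Sum>i\<in>idx ?N. Xpol (p i) * TY i)"
    by (rule sum.mono_neutral_left[OF finite_idx sub(1)]) (use p in auto)
  moreover have "(\<Sum>i\<in>idx m. Xpol (r i) * TY i) = (\<Sum>i\<in>idx ?N. Xpol (r i) * TY i)"
    by (rule sum.mono_neutral_left[OF finite_idx sub(2)]) (use r in auto)
  ultimately have "a + b \<asymp> (\<Sum>i\<in>idx ?N. Xpol (p i + r i) * TY i)"
    using cg_add[OF p(3) r(3)] by (simp add: Xpol_add distrib_right sum.distrib)
  moreover have "\<forall>i. p i + r i \<in> Pk k" using p r Pk_add by blast
  moreover have "p i + r i = 0" if "i \<notin> idx ?N" for i
  proof -
    have "i \<notin> idx n" "i \<notin> idx m" using sub that by blast+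
    then show ?thesis using p(2) r(2) by simp
  qed
  ultimately show ?thesis unfolding has_form_def by (intro exI[of _ ?N] exI[of _ "\<lambda>i. p i + r i"]) simp
qed

lemma has_form_scal: assumes "has_form a" shows "has_form (scal c * a)"
proof -
  obtain n p where p: "\<And>i. p i \<in> Pk k" "\<And>i. i \<notin> idx n \<Longrightarrow> p i = 0"
    "a \<asymp> (\<Sum>i\<in>idx n. Xpol (p i) * TY i)" using assms unfolding has_form_def by blast
  have "scal c * a \<asymp> (\<Sum>i\<in>idx n. Xpol (Cst c * p i) * TY i)"
    using cg_left[OF p(3), of "scal c"] by (simp add: Xpol_Cst_mult sum_distrib_left mult.assoc)
  then show ?thesis
    using p Pk_mult unfolding has_form_def
    by (intro exI[of _ n] exI[of _ "\<lambda>i. Cst c * p i"]) auto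
qed

lemma has_form_XX: assumes "has_form a" "1 \<le> j" "j \<le> k" shows "has_form (XX j * a)"
proof -
  obtain n p where p: "\<And>i. p i \<in> Pk k" "\<And>i. i \<notin> idx n \<Longrightarrow> p i = 0"
    "a \<asymp> (\<Sum>i\<in>idx n. Xpol (p i) * TY i)" using assms(1) unfolding has_form_def by blast
  have "XX j * a \<asymp> (\<Sum>i\<in>idx n. XX j * Xpol (p i) * TY i)"
    using cg_left[OF p(3), of "XX j"] by (simp add: sum_distrib_left mult.assoc)
  also have "\<dots> \<asymp> (\<Sum>i\<in>idx n. Xpol (Var j * p i) * TY i)"
    by (intro cg_sum cg_right cg_sym[OF Xpol_Var_mult] assms)
  finally show ?thesis
    using p Pk_mult[OF Pk_Var[OF assms(2,3)]] unfolding has_form_def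
    by (intro exI[of _ n] exI[of _ "\<lambda>i. Var j * p i"]) auto
qed

lemma has_form_TYspan: "a \<in> TYspan n \<Longrightarrow> has_form a"
proof (induction rule: TYspan.induct)
  case (base b L)
  let ?p = "\<lambda>i. if i = (b, L) then 1 else 0 :: pol"
  have "(\<Sum>i\<in>idx n. Xpol (?p i) * TY i) = (\<Sum>i\<in>idx n. if i = (b, L) then Xpol 1 * TY i else 0)"
    by (intro sum.cong) auto
  also have "\<dots> = Tw b * Yw L"
    using base finite_idx[of n] Xpol_Cst[of 1] by (simp add: TY_def)
  finally have "Tw b * Yw L \<asymp> (\<Sum>i\<in>idx n. Xpol (?p i) * TY i)" by simp
  then show ?case unfolding has_form_def
    using base by (intro exI[of _ n] exI[of _ ?p]) auto
qed (auto intro: has_form_add has_form_scal has_form_cg)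

lemma has_form_normal: "a \<in> normal \<Longrightarrow> has_form a"
  by (induction rule: normal.induct)
     (auto intro: has_form_add has_form_scal has_form_cg has_form_XX has_form_TYspan)

subsection \<open>Independence of the words in the \<open>T\<close>'s and \<open>Y\<close>'s\<close>

text \<open>The operators to be tested are only known to vanish on polynomials in the first \<open>k\<close> variables.
  Hence vectors are functions on polynomials, on which operators act by composition from the left;
  outside the polynomials considered they have the default value zero.\<close>

definition incl :: "pol \<Rightarrow> ratfun" where "incl f = (if f \<in> Pk k then emb f else 0)"

definition opspan :: "nat \<Rightarrow> (pol \<Rightarrow> ratfun) set" where
  "opspan n = fs.span ((\<lambda>i f. actM k (TY i) (incl f)) ` idx n)"

lemma opspan_TYspan: "a \<in> TYspan n \<Longrightarrow> (\<lambda>f. actM k a (incl f)) \<in> opspan n"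
proof (induction rule: TYspan.induct)
  case (base b L)
  then show ?case unfolding opspan_def
    by (intro fs.span_base image_eqI[of _ _ "(b, L)"]) (auto simp: TY_def)
next
  case (add a b)
  then have "(\<lambda>f. actM k a (incl f)) + (\<lambda>f. actM k b (incl f)) \<in> opspan n"
    unfolding opspan_def by (intro fs.span_add)
  then show ?case by (simp add: plus_fun_def actM_simps)
next
  case (scal a c)
  then have "(\<lambda>f. cK c * actM k a (incl f)) \<in> opspan n"
    unfolding opspan_def by (intro fs.span_scale)
  then show ?case by (simp add: actM_simps)
next
  case (closed a b)
  then show ?case using cg_act[of a b] by simp
qed

lemma TY_TYspan: "i \<in> idx n \<Longrightarrow> TY i \<in> TYspan n"
  by (auto simp: TY_def intro: TYspan.base)

lemma opspan_add: "\<phi> \<in> opspan n \<Longrightarrow> \<psi> \<in> opspan n \<Longrightarrow> (\<lambda>f. \<phi> f + \<psi> f) \<in> opspan n"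
  using fs.span_add[of \<phi> _ \<psi>] unfolding opspan_def by (simp add: plus_fun_def)
lemma opspan_diff: "\<phi> \<in> opspan n \<Longrightarrow> \<psi> \<in> opspan n \<Longrightarrow> (\<lambda>f. \<phi> f - \<psi> f) \<in> opspan n"
  using fs.span_diff[of \<phi> _ \<psi>] unfolding opspan_def by (simp add: fun_diff_def)
lemma opspan_scale: "\<phi> \<in> opspan n \<Longrightarrow> (\<lambda>f. c * \<phi> f) \<in> opspan n"
  using fs.span_scale[of \<phi>] unfolding opspan_def by blast
lemma opspan_mono: "\<phi> \<in> opspan n \<Longrightarrow> n \<le> m \<Longrightarrow> \<phi> \<in> opspan m"
  unfolding opspan_def using fs.span_mono[OF image_mono[OF idx_mono]] by blast

lemma opspan_induct [consumes 1, case_names zero step]: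
  assumes "\<phi> \<in> opspan n" "P (\<lambda>f. 0)"
    and "\<And>c i \<phi>. i \<in> idx n \<Longrightarrow> \<phi> \<in> opspan n \<Longrightarrow> P \<phi> \<Longrightarrow> P (\<lambda>f. c * actM k (TY i) (incl f) + \<phi> f)"
  shows "P \<phi>"
proof -
  have "P \<phi> \<and> \<phi> \<in> opspan n"
    using assms(1) unfolding opspan_def
  proof (induction rule: fs.span_induct_alt)
    case base
    then show ?case using assms(2) fs.span_zero by (simp add: zero_fun_def)
  next
    case (step c x y)
    then obtain i where i: "i \<in> idx n" "x = (\<lambda>f. actM k (TY i) (incl f))" by blast
    have "x \<in> opspan n" unfolding i(2) by (intro opspan_TYspan TY_TYspan i)
    then have "(\<lambda>f. c * x f) + y \<in> opspan n"
      using step(2) unfolding opspan_def by (intro fs.span_add fs.span_scale) auto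
    moreover have "P ((\<lambda>f. c * x f) + y)"
      using assms(3)[OF i(1), of y c] step(2) unfolding i(2) plus_fun_def opspan_def by blast
    ultimately show ?case unfolding opspan_def by blast
  qed
  then show ?thesis by blast
qed

text \<open>The operators are not linear over rational functions: \<open>T_j\<close> moves past a coefficient \<open>c\<close> by means
  of \<open>s_j c\<close>.\<close>

lemma opspan_TM: assumes "1 \<le> j" "j < k" "\<phi> \<in> opspan n" shows "(\<lambda>f. TM j (\<phi> f)) \<in> opspan n"
  using assms(3)
proof (induction rule: opspan_induct)
  case zero
  have "(\<lambda>f. 0) \<in> opspan n" using fs.span_zero unfolding opspan_def zero_fun_def .
  then show ?case by (simp add: TM_def sM_rules)
next
  case (step c i \<phi>)
  let ?x = "\<lambda>f. actM k (TY i) (incl f)"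
  have x: "?x \<in> opspan n" by (intro opspan_TYspan TY_TYspan step)
  have "(\<lambda>f. actM k (TT j * TY i) (incl f)) \<in> opspan n"
    by (intro opspan_TYspan TT_TYspan TY_TYspan step assms)
  then have Tx: "(\<lambda>f. TM j (?x f)) \<in> opspan n"
    using assms by (simp add: actM_simps opM_def)
  have "TM j (c * v + w) = aT j * c * v + (sM j c * (TM j v - aT j * v) + TM j w)" for v w
    by (simp add: TM_def sM_rules algebra_simps)
  then show ?case
    by (simp only:) (intro opspan_add opspan_scale opspan_diff x Tx step)
qed

lemma opspan_sM: assumes "1 \<le> j" "j < k" "\<phi> \<in> opspan n" shows "(\<lambda>f. sM j (\<phi> f)) \<in> opspan n"
proof -
  have "sM j v = inverse (bT j) * (TM j v - aT j * v)" for v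
    using bT_nonzero[of j] by (simp add: TM_def)
  then show ?thesis
    by (simp only:) (intro opspan_scale opspan_diff opspan_TM assms)
qed

lemma actM_Tw: "set b \<subseteq> {1..<k} \<Longrightarrow> actM k (Tw b) v = foldr TM b v"
  by (induction b) (simp_all add: actM_simps opM_def)

lemma actM_om: "actM k om v = cK (tK ^ k) * omM k v"
  using k actM_Tw[of "[1..<k]" v]
  by (simp add: om_def actM_simps opM_def YM_def foldr_fold_TM_TIM)

lemma opspan_omM: assumes "\<phi> \<in> opspan n" shows "(\<lambda>f. omM k (\<phi> f)) \<in> opspan (Suc n)"
  using assms
proof (induction rule: opspan_induct)
  case zero
  have "(\<lambda>f. 0) \<in> opspan (Suc n)" using fs.span_zero unfolding opspan_def zero_fun_def .
  then show ?case by (simp add: omM_rules[OF k1])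
next
  case (step c i \<phi>)
  let ?x = "\<lambda>f. actM k (TY i) (incl f)"
  have "(\<lambda>f. actM k (om * TY i) (incl f)) \<in> opspan (Suc n)"
    by (intro opspan_TYspan om_TYspan TY_TYspan step)
  then have "(\<lambda>f. cK (tK ^ k) * omM k (?x f)) \<in> opspan (Suc n)"
    by (simp add: actM_simps actM_om)
  then have "(\<lambda>f. cK (inverse tK ^ k) * (cK (tK ^ k) * omM k (?x f))) \<in> opspan (Suc n)"
    by (rule opspan_scale)
  then have "(\<lambda>f. omM k (?x f)) \<in> opspan (Suc n)" by simp
  then show ?case
    using step by (simp add: omM_rules[OF k1]) (intro opspan_add opspan_scale)
qed

lemma fold_sM_xv: "fold sM [1..<Suc n] (xv i) = (if i = 1 then xv (Suc n) else if 2 \<le> i \<and> i \<le> Suc n then xv (i - 1) else xv i)"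
proof (induction n)
  case (Suc n)
  have "fold sM [1..<Suc (Suc n)] (xv i) = sM (Suc n) (fold sM [1..<Suc n] (xv i))" by simp
  then show ?case unfolding Suc.IH by (auto simp: sM_xv adj_swap_def)
qed auto

lemma alg_hom_fold_sM: "alg_hom (fold sM js)"
proof (induction js)
  case Nil
  have "fold sM [] = (\<lambda>z. z)" by (simp add: fun_eq_iff)
  then show ?case using alg_hom_id by simp
next
  case (Cons j js)
  have "fold sM (j # js) = (\<lambda>z. fold sM js (sM j z))" by (simp add: fun_eq_iff)
  then show ?case using alg_hom_comp[OF Cons alg_hom_sM] by simp
qed

lemma tauM_1: "tauM 1 z = omM k (fold sM [1..<k] z)"
proof (rule alg_hom_ext[OF alg_hom_tauM alg_hom_comp[OF alg_hom_omM[OF k1] alg_hom_fold_sM]])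
  fix i
  obtain n where n: "k = Suc n" using k by (cases k) auto
  show "tauM 1 (xv i) = omM k (fold sM [1..<k] (xv i))"
    unfolding n fold_sM_xv using k n
    by (auto simp: tauM_xv omM_xv cyc_def)
qed

lemma tauM_Suc: "tauM (Suc j) z = sM j (tauM j (sM j z))"
  by (rule alg_hom_ext[OF alg_hom_tauM alg_hom_comp[OF alg_hom_sM alg_hom_comp[OF alg_hom_tauM alg_hom_sM]]])
     (auto simp: tauM_xv sM_xv adj_swap_def sM_rules)

lemma opspan_fold_sM: "set js \<subseteq> {1..<k} \<Longrightarrow> \<phi> \<in> opspan n \<Longrightarrow> (\<lambda>f. fold sM js (\<phi> f)) \<in> opspan n"
proof (induction js arbitrary: \<phi>)
  case (Cons j js)
  have "(\<lambda>f. sM j (\<phi> f)) \<in> opspan n" using Cons.prems by (intro opspan_sM) auto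
  then show ?case using Cons by simp
qed simp

lemma opspan_foldr_sM: "set js \<subseteq> {1..<k} \<Longrightarrow> \<phi> \<in> opspan n \<Longrightarrow> (\<lambda>f. foldr sM js (\<phi> f)) \<in> opspan n"
  by (induction js) (auto intro: opspan_sM)

lemma opspan_tauM: assumes "1 \<le> j" "j \<le> k" "\<phi> \<in> opspan n" shows "(\<lambda>f. tauM j (\<phi> f)) \<in> opspan (Suc n)"
  using assms
proof (induction j arbitrary: \<phi> rule: dec_induct)
  case base
  then show ?case unfolding tauM_1 by (intro opspan_omM opspan_fold_sM) auto
next
  case (step j)
  then show ?case unfolding tauM_Suc by (intro opspan_sM step.IH) auto
qed

text \<open>The automorphism \<open>\<tau>_(L_1) \<tau>_(L_2) \<dots> w\<close> with \<open>w\<close> the permutation given by a word \<open>b\<close>; the pairs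
  \<open>(b, L)\<close> are the indices of the words \<open>T_b Y_L\<close> as well.\<close>

definition autfun :: "nat list \<times> nat list \<Rightarrow> pol \<Rightarrow> ratfun" where
  "autfun i f = foldr tauM (snd i) (foldr sM (fst i) (incl f))"

text \<open>Each \<open>\<tau>_j\<close> is a product of transpositions with a single \<open>\<omega>\<close>, so it raises the bound on the length by
  one, like a letter \<open>Y\<close>.\<close>

lemma autfun_opspan: assumes "i \<in> idx n" shows "autfun i \<in> opspan n"
proof -
  have "(\<lambda>f. actM k (TY ([], [])) (incl f)) \<in> opspan 0"
    by (intro opspan_TYspan TY_TYspan) (auto simp: perm_words_Nil Y_words_def)
  then have "incl \<in> opspan 0" by (simp add: TY_def)
  then have "(\<lambda>f. foldr sM (fst i) (incl f)) \<in> opspan 0"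
    using assms perm_words_letters by (intro opspan_foldr_sM) auto
  then have "set L \<subseteq> {1..k} \<Longrightarrow> (\<lambda>f. foldr tauM L (foldr sM (fst i) (incl f))) \<in> opspan (length L)" for L
    by (induction L) (auto intro: opspan_tauM)
  from this[of "snd i"] show ?thesis
    using assms opspan_mono[of "autfun i" "length (snd i)" n]
    by (auto simp: autfun_def[abs_def] Y_words_def)
qed

lemma foldr_tauM_xv: "foldr tauM L (xv j) = cK (qK ^ count_list L j) * xv j"
  by (induction L) (simp_all add: tauM_xv alg_hom_rules[OF alg_hom_tauM] Cst_hom emb_hom)

lemma foldr_sM_xv: "foldr sM b (xv j) = xv (foldr adj_swap b j)"
  by (induction b) (simp_all add: sM_xv)

lemma autfun_Var: assumes "1 \<le> j" "j \<le> k"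
  shows "autfun (b, L) (Var j) = cK (qK ^ count_list L (foldr adj_swap b j)) * xv (foldr adj_swap b j)"
  using Pk_Var[OF assms] by (simp add: autfun_def incl_def foldr_sM_xv foldr_tauM_xv)

lemma foldr_adj_swap_chain: "i \<le> Suc n \<Longrightarrow> foldr adj_swap [i..<Suc n] (Suc n) = i"
proof (induction "Suc n - i" arbitrary: i)
  case 0
  then show ?case by simp
next
  case (Suc d)
  then have "[i..<Suc n] = i # [Suc i..<Suc n]" by (intro upt_conv_Cons) simp
  moreover have "foldr adj_swap [Suc i..<Suc n] (Suc n) = Suc i" using Suc by (intro Suc.hyps) auto
  ultimately show ?case by (simp add: adj_swap_def del: upt_Suc)
qed

lemma foldr_adj_swap_inj: "foldr adj_swap b x = foldr adj_swap b y \<Longrightarrow> x = y"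
  by (induction b) (auto dest: arg_cong[where f = "adj_swap _"], metis adj_swap_adj_swap)

lemma foldr_adj_swap_fix: "(\<And>i. i \<in> set b \<Longrightarrow> i + 1 < j) \<Longrightarrow> foldr adj_swap b j = j"
proof (induction b)
  case (Cons i b)
  have "adj_swap i j = j" using Cons.prems[of i] by (simp add: adj_swap_def)
  then show ?case using Cons by simp
qed simp

lemma foldr_adj_swap_range: "(\<And>i. i \<in> set b \<Longrightarrow> 1 \<le> i \<and> i < n) \<Longrightarrow> 1 \<le> j \<Longrightarrow> j \<le> n \<Longrightarrow>
    1 \<le> foldr adj_swap b j \<and> foldr adj_swap b j \<le> n"
  by (induction b) (force simp: adj_swap_def)+

lemma perm_words_eqI:
  assumes "b \<in> perm_words n" "c \<in> perm_words n"
    "\<And>j. 1 \<le> j \<Longrightarrow> j \<le> n \<Longrightarrow> foldr adj_swap b j = foldr adj_swap c j"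
  shows "b = c"
  using assms
proof (induction n arbitrary: b c)
  case (Suc n)
  from Suc.prems obtain i b' where b: "b = [i..<Suc n] @ b'" "1 \<le> i" "i \<le> Suc n" "b' \<in> perm_words n"
    by (simp only: perm_words.simps) blast
  from Suc.prems obtain l c' where c: "c = [l..<Suc n] @ c'" "1 \<le> l" "l \<le> Suc n" "c' \<in> perm_words n"
    by (simp only: perm_words.simps) blast
  have fix_last: "foldr adj_swap d (Suc n) = Suc n" if "d \<in> perm_words n" for d
    by (rule foldr_adj_swap_fix) (use perm_words_letters[OF that] in auto)
  have "foldr adj_swap b (Suc n) = i" "foldr adj_swap c (Suc n) = l"
    using b c fix_last foldr_adj_swap_chain by (simp_all del: upt_Suc)
  then have il: "i = l" using Suc.prems(3)[of "Suc n"] by simp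
  have "b' = c'"
  proof (rule Suc.IH[OF b(4) c(4)])
    fix j assume "1 \<le> j" "j \<le> n"
    then have "foldr adj_swap b j = foldr adj_swap c j" using Suc.prems(3) by simp
    then show "foldr adj_swap b' j = foldr adj_swap c' j"
      unfolding b c il by (auto dest: foldr_adj_swap_inj simp del: upt_Suc)
  qed
  then show ?case using b c il by simp
qed simp

lemma autfun_distinct:
  assumes "i \<in> idx n" "i' \<in> idx n" "\<And>j. 1 \<le> j \<Longrightarrow> j \<le> k \<Longrightarrow> autfun i (Var j) = autfun i' (Var j)"
  shows "i = i'"
proof -
  obtain b L c M where i: "i = (b, L)" "i' = (c, M)" by fastforce
  have bc: "b \<in> perm_words k" "c \<in> perm_words k" "L \<in> Y_words n" "M \<in> Y_words n"
    using assms(1,2) i by auto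
  have eq: "qK ^ count_list L (foldr adj_swap b j) = qK ^ count_list M (foldr adj_swap c j)
      \<and> foldr adj_swap b j = foldr adj_swap c j" if "1 \<le> j" "j \<le> k" for j
  proof -
    have "emb (Cst (qK ^ count_list L (foldr adj_swap b j)) * Var (foldr adj_swap b j))
      = emb (Cst (qK ^ count_list M (foldr adj_swap c j)) * Var (foldr adj_swap c j))"
      using assms(3)[OF that] unfolding i autfun_Var[OF that] emb_mult .
    then show ?thesis unfolding emb_eq_iff Cst_Var_eq_iff by (metis power_not_zero qK_nonzero)
  qed
  have "b = c" using perm_words_eqI[OF bc(1,2)] eq by blast
  moreover have "L = M"
  proof -
    have bij: "bij_betw (foldr adj_swap b) {1..k} {1..k}"
      unfolding bij_betw_def
    proof
      show "inj_on (foldr adj_swap b) {1..k}" by (auto intro!: inj_onI dest: foldr_adj_swap_inj)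
      then show "foldr adj_swap b ` {1..k} = {1..k}"
        using foldr_adj_swap_range[OF perm_words_letters[OF bc(1)]]
        by (intro endo_inj_surj) auto
    qed
    have "count_list L x = count_list M x" for x
    proof (cases "x \<in> {1..k}")
      case True
      then obtain j where "j \<in> {1..k}" "x = foldr adj_swap b j" using bij unfolding bij_betw_def by blast
      then show ?thesis using eq[of j] \<open>b = c\<close> by simp
    next
      case False
      then have "x \<notin> set L" "x \<notin> set M" using bc by (auto simp: Y_words_def)
      then show ?thesis by (simp add: count_list_0_iff)
    qed
    then have "mset L = mset M" by (intro multiset_eqI) (simp add: count_mset)
    moreover have "sorted L" "sorted M" using bc by (simp_all add: Y_words_def)
    ultimately show ?thesis using sorted_sort_id sorted_list_of_multiset_mset by metis
  qed
  ultimately show ?thesis using i by simp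
qed

lemma alg_hom_foldr: "(\<And>j. alg_hom (u j)) \<Longrightarrow> alg_hom (foldr u js)"
proof (induction js)
  case Nil
  have "foldr u [] = (\<lambda>z. z)" by (simp add: fun_eq_iff)
  then show ?case using alg_hom_id by simp
next
  case (Cons j js)
  have "foldr u (j # js) = (\<lambda>z. u j (foldr u js z))" by (simp add: fun_eq_iff)
  then show ?case using alg_hom_comp Cons by simp
qed

lemma TY_independent:
  assumes sum: "\<And>f. f \<in> Pk k \<Longrightarrow> (\<Sum>i\<in>idx n. c i * actM k (TY i) (emb f)) = 0" and i: "i \<in> idx n"
  shows "c i = 0"
proof (rule fs.spanning_family_independent[OF finite_idx, of autfun n "\<lambda>i f. actM k (TY i) (incl f)"])
  show "(\<Sum>i\<in>idx n. (\<lambda>f. c i * actM k (TY i) (incl f))) = 0"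
  proof
    fix f
    have "(\<Sum>i\<in>A. (\<lambda>f. h i f)) f = (\<Sum>i\<in>A. h i f)" for h :: "nat list \<times> nat list \<Rightarrow> pol \<Rightarrow> ratfun" and A
      by (induction A rule: infinite_finite_induct) simp_all
    then have "(\<Sum>i\<in>idx n. (\<lambda>f. c i * actM k (TY i) (incl f))) f = (\<Sum>i\<in>idx n. c i * actM k (TY i) (incl f))" .
    also have "\<dots> = 0"
    proof (cases "f \<in> Pk k")
      case False
      then show ?thesis using MA.act_zero_right[of _ k] by (simp add: incl_def)
    qed (use sum in \<open>simp add: incl_def\<close>)
    finally show "(\<Sum>i\<in>idx n. (\<lambda>f. c i * actM k (TY i) (incl f))) f = 0 f" by simp
  qed
  have dist: "i = i'" if "i \<in> idx n" "i' \<in> idx n" "\<forall>f\<in>Pk k. autfun i f = autfun i' f" for i i'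
  proof (rule autfun_distinct[OF that(1,2)])
    fix j assume "1 \<le> j" "j \<le> k"
    then have "Var j \<in> Pk k" by (rule Pk_Var)
    with that(3) show "autfun i (Var j) = autfun i' (Var j)" by blast
  qed
  show inj: "inj_on autfun (idx n)" 
  proof (rule inj_onI)
    fix i i' assume "i \<in> idx n" "i' \<in> idx n" "autfun i = autfun i'"
    then show "i = i'" using dist[of i i'] by metis
  qed
  show "autfun ` idx n \<subseteq> fs.span ((\<lambda>i f. actM k (TY i) (incl f)) ` idx n)"
    unfolding opspan_def[symmetric] by (rule image_subsetI) (rule autfun_opspan)
  have hom: "alg_hom (\<lambda>z. foldr tauM (snd i) (foldr sM (fst i) z))" for i :: "nat list \<times> nat list"
    by (rule alg_hom_comp[OF alg_hom_foldr[OF alg_hom_tauM] alg_hom_foldr[OF alg_hom_sM]])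
  show "fs.independent (autfun ` idx n)"
  proof (rule fs.independent_if_scalars_zero)
    fix d \<phi> assume d: "(\<Sum>\<phi>\<in>autfun ` idx n. (\<lambda>f. d \<phi> * \<phi> f)) = 0" and "\<phi> \<in> autfun ` idx n"
    then obtain i where i: "i \<in> idx n" "\<phi> = autfun i" by blast
    have "d (autfun i) = 0"
    proof (rule dedekind_independence[OF finite_idx, of n k autfun "\<lambda>i. d (autfun i)"])
      fix f assume "f \<in> Pk k"
      have "(\<Sum>i\<in>A. (\<lambda>f. h i f)) f = (\<Sum>i\<in>A. h i f)" for h :: "nat list \<times> nat list \<Rightarrow> pol \<Rightarrow> ratfun" and A
        by (induction A rule: infinite_finite_induct) simp_all
      then show "(\<Sum>i\<in>idx n. d (autfun i) * autfun i f) = 0"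
        using fun_cong[OF d[unfolded sum.reindex[OF inj]], of f] by (simp add: o_def)
    next
      fix i f g assume "f \<in> Pk k" "g \<in> Pk k"
      then show "autfun i (f * g) = autfun i f * autfun i g"
        using alg_hom_mult[OF hom] by (simp add: autfun_def incl_def Pk_mult emb_mult)
    next
      fix i show "autfun i 1 = 1" using alg_hom_one[OF hom] by (simp add: autfun_def incl_def)
    qed (use dist i in blast)+
    then show "d \<phi> = 0" using i by simp
  qed (simp add: finite_idx)
qed (rule i)

text \<open>In the normal form of \<open>a\<close> the coefficients of the words \<open>T_b Y_L\<close> are polynomials in the \<open>X\<close>'s. They
  vanish by independence over rational functions, so the normal form itself is zero.\<close>

theorem actM_faithful:
  assumes a: "a \<in> words_in (pos_gens k)" and zero: "\<And>f. f \<in> Pk k \<Longrightarrow> actM k a (emb f) = 0"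
  shows "a \<in> gl_ideal k"
proof -
  obtain n p where p: "\<And>i. p i \<in> Pk k" "a \<asymp> (\<Sum>i\<in>idx n. Xpol (p i) * TY i)"
    using has_form_normal[OF pos_words_normal[OF a]] unfolding has_form_def by blast
  have "(\<Sum>i\<in>idx n. emb (p i) * actM k (TY i) (emb f)) = 0" if "f \<in> Pk k" for f
  proof -
    have "actM k a (emb f) = actM k (\<Sum>i\<in>idx n. Xpol (p i) * TY i) (emb f)"
      by (rule cg_act[OF p(2)])
    then show ?thesis using zero[OF that] by (simp add: MA.act_sum actM_mult actM_Xpol p)
  qed
  then have "emb (p i) = 0" if "i \<in> idx n" for i
    using that by (rule TY_independent[where c = "\<lambda>i. emb (p i)"])
  then have "(\<Sum>i\<in>idx n. Xpol (p i) * TY i) = 0" by simp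
  then have "a \<in> relS k" using p(2) by (simp add: cg_def)
  moreover have "a \<in> words_in (daha_gens k)"
    using a by (rule words_in_mono) (auto simp: pos_gens_def)
  ultimately show ?thesis using relS_iff by blast
qed

end

section \<open>Operators on polynomials\<close>

lemma swap_pol_monsub: "swap_pol i = subst_pol (\<lambda>j. Var (adj_swap i j))"
  by (simp add: swap_pol_def adj_swap_def)

lemma swap_pol_hom:
  "swap_pol i (f + g) = swap_pol i f + swap_pol i g" "swap_pol i (f - g) = swap_pol i f - swap_pol i g"
  "swap_pol i (f * g) = swap_pol i f * swap_pol i g" "swap_pol i (Cst c) = Cst c"
  "swap_pol i (Var j) = Var (adj_swap i j)" "swap_pol i 0 = 0"
  by (simp_all add: swap_pol_monsub subst_pol_hom)

lemma swap_pol_swap_pol [simp]: "swap_pol i (swap_pol i f) = f"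
  using sM_sM[of i "emb f"] by (simp only: sM_emb emb_eq_iff)

lemma difference_quotient: "\<exists>g. g * (Var i - Var (i + 1)) = f - swap_pol i f"
proof (induction f rule: pol_induct)
  case (const c)
  then show ?case by (intro exI[of _ 0]) (simp add: swap_pol_hom)
next
  case (add f g)
  then obtain a b where "a * (Var i - Var (i + 1)) = f - swap_pol i f"
    "b * (Var i - Var (i + 1)) = g - swap_pol i g" by blast
  then show ?case by (intro exI[of _ "a + b"]) (simp add: swap_pol_hom algebra_simps)
next
  case (Var j f)
  then obtain a where a: "a * (Var i - Var (i + 1)) = f - swap_pol i f" by blast
  have "Var j * f - swap_pol i (Var j * f) = Var j * (f - swap_pol i f) + (Var j - Var (adj_swap i j)) * swap_pol i f"
    by (simp add: swap_pol_hom algebra_simps)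
  moreover have "\<exists>b. b * (Var i - Var (i + 1)) = Var j - Var (adj_swap i j)"
  proof -
    consider "j = i" | "j = i + 1" | "j \<noteq> i" "j \<noteq> i + 1" by blast
    then show ?thesis
    proof cases
      case 1
      then show ?thesis by (intro exI[of _ 1]) (simp add: adj_swap_def)
    next
      case 2
      then show ?thesis by (intro exI[of _ "- 1"]) (simp add: adj_swap_def)
    next
      case 3
      then show ?thesis by (intro exI[of _ 0]) (simp add: adj_swap_def)
    qed
  qed
  then obtain b where b: "b * (Var i - Var (i + 1)) = Var j - Var (adj_swap i j)" by blast
  have "(Var j * a + b * swap_pol i f) * (Var i - Var (i + 1))
      = Var j * (a * (Var i - Var (i + 1))) + (b * (Var i - Var (i + 1))) * swap_pol i f"
    by (simp add: algebra_simps)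
  ultimately show ?case unfolding a b by metis
qed

definition quot :: "nat \<Rightarrow> pol \<Rightarrow> pol" where
  "quot i f = (THE g. g * (Var i - Var (i + 1)) = f - swap_pol i f)"

lemma quot: "quot i f * (Var i - Var (i + 1)) = f - swap_pol i f"
  and quot_unique: "g * (Var i - Var (i + 1)) = f - swap_pol i f \<Longrightarrow> quot i f = g"
proof -
  have nz: "Var i - Var (i + 1) \<noteq> 0" by simp
  have "\<exists>!g. g * (Var i - Var (i + 1)) = f - swap_pol i f"
    using difference_quotient[of i f] nz by (metis mult_right_cancel)
  then show "quot i f * (Var i - Var (i + 1)) = f - swap_pol i f"
    unfolding quot_def by (rule theI')
  then show "quot i f = g" if "g * (Var i - Var (i + 1)) = f - swap_pol i f"
    using that nz by (metis mult_right_cancel)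
qed

lemma opT_quot: "opT i f = swap_pol i f + Cst (1 - tK) * Var i * quot i f"
  by (simp add: opT_def quot_def)

lemma emb_opT: "emb (opT i f) = TM i (emb f)"
proof -
  have q: "emb (quot i f) * (xv i - xv (i + 1)) = emb f - sM i (emb f)"
    using arg_cong[OF quot[of i f], of emb] by (simp only: emb_mult emb_diff sM_emb)
  have "\<lbrakk>x \<noteq> y; g * (x - y) = u - w\<rbrakk> \<Longrightarrow>
      w + (1 - t) * x * g = (1 - t) * x / (x - y) * u + (t * x - y) / (x - y) * w"
    for x y t u w g :: ratfun
  proof -
    assume xy: "x \<noteq> y" and g: "g * (x - y) = u - w"
    have g': "g = (u - w) / (x - y)" using xy g by (simp add: eq_divide_eq)
    show ?thesis unfolding g' using xy by (simp add: divide_simps) (simp add: algebra_simps)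
  qed
  from this[OF _ q, of "cK tK"] show ?thesis
    by (simp add: opT_quot emb_hom Cst_diff TM_def aT_def bT_def flip: sM_emb)
qed

definition TIP :: "nat \<Rightarrow> pol \<Rightarrow> pol" where
  "TIP i f = Cst (inverse tK) * (opT i f + Cst (tK - 1) * f)"

lemma emb_TIP: "emb (TIP i f) = TIM i (emb f)"
  by (simp add: TIP_def TIM_def emb_hom emb_opT)

lemma emb_fold_opT: "emb (fold opT js f) = fold TM js (emb f)"
  by (induction js arbitrary: f) (simp_all add: emb_opT)
lemma emb_fold_TIP: "emb (fold TIP js f) = fold TIM js (emb f)"
  by (induction js arbitrary: f) (simp_all add: emb_TIP)

lemmas to_ratfun = emb_eq_iff[symmetric] emb_opT emb_TIP emb_fold_opT emb_fold_TIP emb_hom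

lemma opT_add: "opT i (f + g) = opT i f + opT i g"
  and opT_Cst: "opT i (Cst c * f) = Cst c * opT i f"
  and opT_Var: "opT i (Var i * f) = Cst (1 - tK) * Var i * f + Var (i + 1) * opT i f"
  and opT_Var_Suc: "opT i (Var (i + 1) * f) = Var i * (opT i f + Cst (tK - 1) * f)"
  and opT_Var_other: "j \<noteq> i \<Longrightarrow> j \<noteq> i + 1 \<Longrightarrow> opT i (Var j * f) = Var j * opT i f"
  and TIP_add: "TIP i (f + g) = TIP i f + TIP i g"
  and TIP_Cst: "TIP i (Cst c * f) = Cst c * TIP i f"
  and opT_TIP: "opT i (TIP i f) = f" "TIP i (opT i f) = f"
  unfolding to_ratfun
  by (simp_all only: TM_add TM_cK TM_xv TM_xv_Suc TM_xv_other TIM_add TIM_cK TM_TIM Cst_diff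
      emb_diff Cst_one emb_one not_False_eq_True)

lemma fold_opT_add: "fold opT js (f + g) = fold opT js f + fold opT js g"
  and fold_opT_Cst: "fold opT js (Cst c * f) = Cst c * fold opT js f"
  and fold_TIP_add: "fold TIP js (f + g) = fold TIP js f + fold TIP js g"
  and fold_TIP_Cst: "fold TIP js (Cst c * f) = Cst c * fold TIP js f"
  by (induction js arbitrary: f g) (simp_all add: opT_add opT_Cst TIP_add TIP_Cst)

lemma opT_const: "opT i (Cst c) = Cst c"
proof -
  have "quot i (Cst c) = 0" by (rule quot_unique) (simp add: swap_pol_hom)
  then show ?thesis by (simp add: opT_quot swap_pol_hom)
qed

lemma opT_Pkd: assumes "1 \<le> i" "i < k" "f \<in> Pkd k d" shows "opT i f \<in> Pkd k d"
  using assms(3)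
proof (induction rule: Pkd_induct)
  case (Var d j f)
  have V: "g \<in> Pkd k d \<Longrightarrow> 1 \<le> l \<Longrightarrow> l \<le> k \<Longrightarrow> Var l * g \<in> Pkd k (Suc d)" for l g
    using Pkd_mult[OF Pkd_Var[of l k 1]] by fastforce
  consider "j \<noteq> i" "j \<noteq> i + 1" | "j = i" | "j = i + 1" by blast
  then show ?case
  proof cases
    case 1
    then show ?thesis using Var V opT_Var_other[of j i f] by simp
  next
    case 2
    then show ?thesis unfolding 2 opT_Var mult.assoc
      using Var assms by (intro Pkd_add Pkd_Cst_mult V) auto
  next
    case 3
    then show ?thesis unfolding 3 opT_Var_Suc
      using Var assms by (intro V Pkd_add Pkd_Cst_mult) auto
  qed
qed (simp_all add: opT_const opT_add Pkd_add)

lemma TIP_Pkd: "1 \<le> i \<Longrightarrow> i < k \<Longrightarrow> f \<in> Pkd k d \<Longrightarrow> TIP i f \<in> Pkd k d"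
  unfolding TIP_def by (intro Pkd_Cst_mult Pkd_add opT_Pkd)

lemma fold_opT_Pkd: "(\<And>j. j \<in> set js \<Longrightarrow> 1 \<le> j \<and> j < k) \<Longrightarrow> f \<in> Pkd k d \<Longrightarrow> fold opT js f \<in> Pkd k d"
proof (induction js arbitrary: f)
  case (Cons j js)
  have "opT j f \<in> Pkd k d" using Cons.prems(1)[of j] Cons.prems(2) by (intro opT_Pkd) auto
  then show ?case using Cons by simp
qed simp
lemma fold_TIP_Pkd: "(\<And>j. j \<in> set js \<Longrightarrow> 1 \<le> j \<and> j < k) \<Longrightarrow> f \<in> Pkd k d \<Longrightarrow> fold TIP js f \<in> Pkd k d"
proof (induction js arbitrary: f)
  case (Cons j js)
  have "TIP j f \<in> Pkd k d" using Cons.prems(1)[of j] Cons.prems(2) by (intro TIP_Pkd) auto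
  then show ?case using Cons by simp
qed simp

lemma opTinv_eq: assumes "1 \<le> i" "i < k" "f \<in> Pk k" shows "opTinv k i f = TIP i f"
proof -
  have "inj_on (opT i) (Pk k)" by (rule inj_onI) (metis opT_TIP(2))
  moreover have "TIP i f \<in> Pk k" using assms TIP_Pkd unfolding Pk_Un by blast
  ultimately have "inv_into (Pk k) (opT i) (opT i (TIP i f)) = TIP i f" by (rule inv_into_f_f)
  then show ?thesis by (simp add: opTinv_def opT_TIP)
qed

lemma fold_opTinv_eq: "(\<And>j. j \<in> set js \<Longrightarrow> 1 \<le> j \<and> j < k) \<Longrightarrow> f \<in> Pk k \<Longrightarrow> fold (opTinv k) js f = fold TIP js f"
proof (induction js arbitrary: f)
  case (Cons j js)
  have "TIP j f \<in> Pk k" using Cons.prems TIP_Pkd[of j k f] unfolding Pk_Un by auto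
  then show ?case using Cons opTinv_eq[of j k f] by simp
qed simp

lemma opT_fixed_iff: "opT i f = f \<longleftrightarrow> swap_pol i f = f"
  using TM_fixed_iff[of i "emb f"] unfolding emb_opT[symmetric] sM_emb emb_eq_iff .

lemma fold_TIP_fixed: assumes "\<And>j. j \<in> set js \<Longrightarrow> swap_pol j f = f" shows "fold TIP js f = f"
  using assms
proof (induction js)
  case (Cons j js)
  have "TIP j f = f" using Cons.prems[of j] opT_TIP(2)[of j f] opT_fixed_iff[of j f] by simp
  then show ?case using Cons by simp
qed simp

lemma swap_pol_opT: "i + 1 < j \<or> j + 1 < i \<Longrightarrow> swap_pol i (opT j f) = opT j (swap_pol i f)"
  unfolding to_ratfun sM_emb[symmetric] by (rule sM_TM_commute)

lemma subst_pol_opT: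
  assumes "\<And>f. swap_pol i (subst_pol \<tau> f) = subst_pol \<tau> (swap_pol i f)" "\<tau> i = Var i" "\<tau> (i + 1) = Var (i + 1)"
  shows "subst_pol \<tau> (opT i f) = opT i (subst_pol \<tau> f)"
proof -
  have "quot i (subst_pol \<tau> f) = subst_pol \<tau> (quot i f)"
    by (rule quot_unique, unfold assms(1))
       (use arg_cong[OF quot[of i f], of "subst_pol \<tau>"] assms in \<open>simp add: subst_pol_hom\<close>)
  then show ?thesis using assms by (simp add: opT_quot subst_pol_hom)
qed

lemma proj_hom: "proj k (f + g) = proj k f + proj k g" "proj k (f - g) = proj k f - proj k g"
  "proj k (f * g) = proj k f * proj k g" "proj k (Cst c) = Cst c"
  "proj k (Var j) = (if j = k then 0 else Var j)" "proj k 0 = 0" "proj k 1 = 1"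
  by (simp_all add: proj_def subst_pol_hom)

lemma proj_swap: "k \<noteq> i \<Longrightarrow> k \<noteq> i + 1 \<Longrightarrow> swap_pol i (proj k f) = proj k (swap_pol i f)"
  unfolding proj_def swap_pol_monsub subst_pol_subst_pol
  by (rule arg_cong[where f = "\<lambda>\<sigma>. subst_pol \<sigma> f"]) (auto simp: adj_swap_def)

lemma proj_opT: "k \<noteq> i \<Longrightarrow> k \<noteq> i + 1 \<Longrightarrow> proj k (opT i f) = opT i (proj k f)"
  unfolding proj_def by (rule subst_pol_opT) (use proj_swap[of k i] in \<open>auto simp: proj_def\<close>)

lemma proj_TIP: "k \<noteq> i \<Longrightarrow> k \<noteq> i + 1 \<Longrightarrow> proj k (TIP i f) = TIP i (proj k f)"
  by (simp add: TIP_def proj_hom proj_opT)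

lemma proj_fold_opT: "(\<And>j. j \<in> set js \<Longrightarrow> k \<noteq> j \<and> k \<noteq> j + 1) \<Longrightarrow> proj k (fold opT js f) = fold opT js (proj k f)"
  by (induction js arbitrary: f) (simp_all add: proj_opT)
lemma proj_fold_TIP: "(\<And>j. j \<in> set js \<Longrightarrow> k \<noteq> j \<and> k \<noteq> j + 1) \<Longrightarrow> proj k (fold TIP js f) = fold TIP js (proj k f)"
  by (induction js arbitrary: f) (simp_all add: proj_TIP)

lemma swap_TIP: "i + 1 < j \<or> j + 1 < i \<Longrightarrow> swap_pol i (TIP j f) = TIP j (swap_pol i f)"
  by (simp add: TIP_def swap_pol_hom swap_pol_opT)
lemma swap_fold_opT: "(\<And>j. j \<in> set js \<Longrightarrow> i + 1 < j \<or> j + 1 < i) \<Longrightarrow> swap_pol i (fold opT js f) = fold opT js (swap_pol i f)"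
  by (induction js arbitrary: f) (simp_all add: swap_pol_opT)
lemma swap_fold_TIP: "(\<And>j. j \<in> set js \<Longrightarrow> i + 1 < j \<or> j + 1 < i) \<Longrightarrow> swap_pol i (fold TIP js f) = fold TIP js (swap_pol i f)"
  by (induction js arbitrary: f) (simp_all add: swap_TIP)

definition omP :: "nat \<Rightarrow> pol \<Rightarrow> pol" where
  "omP k = subst_pol (\<lambda>j. if j = k then Cst qK * Var 1 else Var (j + 1))"

lemma varpi_omP: "varpi k f = pr1 (omP k f)" by (simp add: varpi_def omP_def)

lemma omP_hom: "omP k (f + g) = omP k f + omP k g" "omP k (f - g) = omP k f - omP k g"
  "omP k (f * g) = omP k f * omP k g" "omP k (Cst c) = Cst c"
  "omP k (Var j) = (if j = k then Cst qK * Var 1 else Var (j + 1))" "omP k 1 = 1"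
  by (simp_all add: omP_def subst_pol_hom)

lemma emb_omP: assumes "1 \<le> k" "f \<in> Pk k" shows "emb (omP k f) = omM k (emb f)"
proof -
  have "omP k f = monsub (cyc k) (\<lambda>j. if j = k then qK else 1) f"
    unfolding omP_def monsub_def by (rule subst_pol_cong[OF assms(2)]) (auto simp: cyc_def)
  moreover have "monaut (cyc k) (\<lambda>j. if j = k then qK else 1) (emb f)
      = emb (monsub (cyc k) (\<lambda>j. if j = k then qK else 1) f)"
    by (rule monaut_emb) (simp_all add: bij_cyc[OF assms(1)])
  ultimately show ?thesis by (simp add: omM_def)
qed

lemma omP_Pkd: "1 \<le> k \<Longrightarrow> f \<in> Pkd k d \<Longrightarrow> omP k f \<in> Pkd k d"
  unfolding omP_def by (rule Pkd_subst) (auto intro!: Pkd_Cst_mult Pkd_Var)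

lemma swap_omP:
  assumes "2 \<le> i" "i < k" "f \<in> Pk k" shows "swap_pol i (omP k f) = omP k (swap_pol (i - 1) f)"
  unfolding omP_def swap_pol_monsub subst_pol_subst_pol
  by (rule subst_pol_cong[OF assms(3)])
     (use assms(1,2) in \<open>auto simp: adj_swap_def subst_pol_mult\<close>)

text \<open>This is the reason for stability. When \<open>x_k\<close> is put to zero after the shift, the variable that
  vanishes is \<open>x_(k-1)\<close>. Of \<open>T_(k-1)\<close> only the transposition remains, as the other summand is a multiple
  of \<open>x_(k-1)\<close>; and the transposition makes \<open>x_k\<close> the vanishing variable.\<close>

lemma proj_omP_swap:
  assumes "2 \<le> k" "f \<in> Pk k" shows "proj k (omP k (swap_pol (k - 1) f)) = omP (k - 1) (proj k f)"
  unfolding omP_def swap_pol_monsub subst_pol_subst_pol proj_def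
  by (rule subst_pol_cong[OF assms(2)]) (use assms(1) in \<open>auto simp: adj_swap_def subst_pol_mult\<close>)

lemma proj_omP_opT:
  assumes "2 \<le> k" "f \<in> Pk k" shows "proj k (omP k (opT (k - 1) f)) = omP (k - 1) (proj k f)"
proof -
  have "proj k (omP k (Var (k - 1))) = 0" using assms(1) by (simp add: omP_hom proj_hom)
  then show ?thesis
    using proj_omP_swap[OF assms] by (simp add: opT_quot omP_hom proj_hom)
qed

lemma lookup_proj: "Poly_Mapping.lookup (proj i f) m = (if i \<in> Poly_Mapping.keys m then 0 else Poly_Mapping.lookup f m)"
proof (induction f rule: poly_mapping_additive_induct)
  case (single n c)
  have "mon_img (\<lambda>j. if j = i then 0 else Var j) n = (if i \<in> Poly_Mapping.keys n then 0 else mon_img Var n)"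
  proof (cases "i \<in> Poly_Mapping.keys n")
    case True
    then have "(if i = i then 0 else Var i) ^ Poly_Mapping.lookup n i = (0::pol)" by (simp add: in_keys_iff)
    then show ?thesis unfolding mon_img_def using True by (auto intro!: prod_zero)
  next
    case False
    then have "mon_img (\<lambda>j. if j = i then 0 else Var j) n = mon_img Var n"
      by (intro mon_img_cong) auto
    then show ?thesis using False by simp
  qed
  then have "proj i (Poly_Mapping.single n c) = (if i \<in> Poly_Mapping.keys n then 0 else Poly_Mapping.single n c)"
    unfolding proj_def subst_pol_single by (simp flip: single_as_monomial)
  then show ?case by (auto simp: lookup_single when_def)
qed (simp_all add: proj_hom lookup_add)

lemma lookup_pr1: "Poly_Mapping.lookup (pr1 f) m = (if 1 \<in> Poly_Mapping.keys m then Poly_Mapping.lookup f m else 0)"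
proof -
  have "Poly_Mapping.lookup (pr1 f) m = (\<Sum>n\<in>{m \<in> Poly_Mapping.keys f. 1 \<le> Poly_Mapping.lookup m 1}.
      if n = m then Poly_Mapping.lookup f m else 0)"
    unfolding pr1_def lookup_sum by (rule sum.cong) (auto simp: lookup_single when_def)
  then show ?thesis by (auto simp: in_keys_iff)
qed

lemma pr1_eq: "pr1 f = f - proj 1 f"
  by (rule poly_mapping_eqI) (simp add: lookup_pr1 lookup_proj lookup_minus)

lemma pr1_add: "pr1 (f + g) = pr1 f + pr1 g"
  and pr1_Cst: "pr1 (Cst c * f) = Cst c * pr1 f"
  and pr1_Var_1: "pr1 (Var 1 * f) = Var 1 * f"
  by (simp_all add: pr1_eq proj_hom algebra_simps)

lemma proj_Pkd: "f \<in> Pkd k d \<Longrightarrow> proj i f \<in> Pkd k d"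
  unfolding proj_def by (rule Pkd_subst) (auto intro: Pkd_Var)

lemma pr1_Pkd: "f \<in> Pkd k d \<Longrightarrow> pr1 f \<in> Pkd k d"
  unfolding pr1_eq by (intro Pkd_diff proj_Pkd)

lemma proj_commute: "proj i (proj j f) = proj j (proj i f)"
  by (rule poly_mapping_eqI) (simp add: lookup_proj)

lemma Var_dvd_proj: assumes "proj i f = 0" shows "\<exists>g. f = Var i * g"
proof -
  have "\<exists>g. f - proj i f = Var i * g"
  proof (induction f rule: pol_induct)
    case (add f g)
    then obtain a b where "f - proj i f = Var i * a" "g - proj i g = Var i * b" by blast
    then show ?case by (intro exI[of _ "a + b"]) (simp add: proj_hom algebra_simps)
  next
    case (Var j f)
    then obtain a where "f - proj i f = Var i * a" by blast
    then show ?case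
      by (cases "j = i")
         (auto intro!: exI[of _ f] exI[of _ "Var j * a"] simp: proj_hom mult.left_commute
             simp flip: right_diff_distrib)
  qed (auto intro!: exI[of _ 0] simp: proj_hom)
  then show ?thesis using assms by simp
qed

section \<open>Stable sequences of polynomials\<close>

text \<open>The early levels of an element of the almost symmetric module are determined by the later ones,
  so that it suffices to know sequences from some level \<open>n\<close> on. The index \<open>m\<close> of symmetry is kept apart
  from \<open>n\<close>, because exact compatibility on multiples of \<open>x_1 \<dots> x_r\<close> is used from level \<open>r\<close> on,
  for sequences with arbitrary \<open>m\<close>.\<close>

definition stab :: "nat \<Rightarrow> nat \<Rightarrow> (nat \<Rightarrow> pol) \<Rightarrow> bool" where
  "stab n m f \<longleftrightarrow> n \<le> m \<and> (\<exists>d. \<forall>k\<ge>n. f k \<in> Pkd k d) \<and> (\<forall>k>n. proj k (f k) = f (k - 1)) \<and>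
     (\<forall>i>m. \<forall>k>i. swap_pol i (f k) = f k)"

lemma stab_Pk: "stab n m f \<Longrightarrow> n \<le> k \<Longrightarrow> f k \<in> Pk k"
  by (auto simp: stab_def intro: Pkd_imp_Pk)

lemma stab_mono: "stab n m f \<Longrightarrow> n \<le> n' \<Longrightarrow> m \<le> m' \<Longrightarrow> n' \<le> m' \<Longrightarrow> stab n' m' f"
  by (auto simp: stab_def) (meson order_trans)

lemma stab_add: assumes "stab n m f" "stab n m g" shows "stab n m (\<lambda>k. f k + g k)"
proof -
  obtain d e where "\<forall>k\<ge>n. f k \<in> Pkd k d" "\<forall>k\<ge>n. g k \<in> Pkd k e" using assms by (auto simp: stab_def)
  then have "\<forall>k\<ge>n. f k + g k \<in> Pkd k (max d e)"
    by (metis Pkd_add Pkd_mono max.cobounded1 max.cobounded2 order_refl)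
  then show ?thesis using assms by (auto simp: stab_def proj_hom swap_pol_hom)
qed

lemma stab_linear:
  assumes "stab n m f" "\<And>k d. n \<le> k \<Longrightarrow> f k \<in> Pkd k d \<Longrightarrow> A k (f k) \<in> Pkd k (d + e)"
    "\<And>k. n < k \<Longrightarrow> proj k (A k (f k)) = A (k - 1) (proj k (f k))"
    "\<And>i k. m < i \<Longrightarrow> i < k \<Longrightarrow> swap_pol i (f k) = f k \<Longrightarrow> swap_pol i (A k (f k)) = A k (f k)"
  shows "stab n m (\<lambda>k. A k (f k))"
  using assms unfolding stab_def by auto (metis)

lemma stab_Cst: "stab n m f \<Longrightarrow> stab n m (\<lambda>k. Cst c * f k)"
  by (rule stab_linear[of n m f "\<lambda>k f. Cst c * f" 0]) (auto simp: proj_hom swap_pol_hom Pkd_Cst_mult)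

lemma stab_Var: assumes "stab n m f" "1 \<le> i" "i \<le> n" shows "stab n m (\<lambda>k. Var i * f k)"
proof (rule stab_linear[of n m f "\<lambda>k f. Var i * f" 1])
  have "n \<le> m" using assms by (simp add: stab_def)
  then show "swap_pol j (Var i * f k) = Var i * f k" if "m < j" "swap_pol j (f k) = f k" for j k
    using that assms by (simp add: swap_pol_hom adj_swap_def)
  show "Var i * f k \<in> Pkd k (d + 1)" if "n \<le> k" "f k \<in> Pkd k d" for k d
    using Pkd_mult[OF Pkd_Var[of i k 1] that(2)] that assms by (simp add: add.commute)
qed (use assms in \<open>auto simp: proj_hom\<close>)

lemma stab_fold_opT:
  assumes "stab n m f" "\<And>j. j \<in> set js \<Longrightarrow> 1 \<le> j \<and> j < n" shows "stab n m (\<lambda>k. fold opT js (f k))"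
proof (rule stab_linear[of n m f "\<lambda>k f. fold opT js f" 0])
  have nm: "n \<le> m" using assms by (simp add: stab_def)
  show "fold opT js (f k) \<in> Pkd k (d + 0)" if "n \<le> k" "f k \<in> Pkd k d" for k d
    using fold_opT_Pkd[of js k "f k" d] assms(2) that by force
  show "proj k (fold opT js (f k)) = fold opT js (proj k (f k))" if "n < k" for k
    by (rule proj_fold_opT) (use assms(2) that in force)
  show "swap_pol i (fold opT js (f k)) = fold opT js (f k)" if "m < i" "swap_pol i (f k) = f k" for i k
    using swap_fold_opT[of js i "f k"] assms(2) that nm by force
qed (use assms in auto)

lemma stab_fold_TIP:
  assumes "stab n m f" "\<And>j. j \<in> set js \<Longrightarrow> 1 \<le> j \<and> j < n" shows "stab n m (\<lambda>k. fold TIP js (f k))"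
proof (rule stab_linear[of n m f "\<lambda>k f. fold TIP js f" 0])
  have nm: "n \<le> m" using assms by (simp add: stab_def)
  show "fold TIP js (f k) \<in> Pkd k (d + 0)" if "n \<le> k" "f k \<in> Pkd k d" for k d
    using fold_TIP_Pkd[of js k "f k" d] assms(2) that by force
  show "proj k (fold TIP js (f k)) = fold TIP js (proj k (f k))" if "n < k" for k
    by (rule proj_fold_TIP) (use assms(2) that in force)
  show "swap_pol i (fold TIP js (f k)) = fold TIP js (f k)" if "m < i" "swap_pol i (f k) = f k" for i k
    using swap_fold_TIP[of js i "f k"] assms(2) that nm by force
qed (use assms in auto)

lemma stab_pr1: assumes "stab n m f" "1 \<le> n" shows "stab n m (\<lambda>k. pr1 (f k))"
proof (rule stab_linear[of n m f "\<lambda>k f. pr1 f" 0])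
  have nm: "n \<le> m" using assms by (simp add: stab_def)
  show "proj k (pr1 (f k)) = pr1 (proj k (f k))" for k
    by (simp add: pr1_eq proj_hom proj_commute)
  show "swap_pol i (pr1 (f k)) = pr1 (f k)" if "m < i" "swap_pol i (f k) = f k" for i k
    using that nm assms(2) by (simp add: pr1_eq swap_pol_hom proj_swap)
qed (use assms in \<open>auto simp: pr1_Pkd\<close>)

text \<open>Compatibility is the cancellation of the last factor of the chain by the projection. For the
  symmetry, \<open>T_i\<close> with \<open>i > m\<close> passes the shift and the chain, where its index is lowered and raised again.\<close>

lemma stab_shift:
  assumes f: "stab n m f" and n: "1 \<le> n" shows "stab n m (\<lambda>k. omP k (fold opT [n..<k] (f k)))"
proof (rule stab_linear[of n m f "\<lambda>k f. omP k (fold opT [n..<k] f)" 0])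
  have nm: "n \<le> m" using assms by (simp add: stab_def)
  have Pk: "fold opT [n..<l] (f k) \<in> Pkd k d" if "n \<le> k" "l \<le> k" "f k \<in> Pkd k d" for k l d
    by (rule fold_opT_Pkd) (use n that in auto)
  show "omP k (fold opT [n..<k] (f k)) \<in> Pkd k (d + 0)" if "n \<le> k" "f k \<in> Pkd k d" for k d
    using omP_Pkd[of k] Pk[of k k d] n that by simp
  show "proj k (omP k (fold opT [n..<k] (f k))) = omP (k - 1) (fold opT [n..<k - 1] (proj k (f k)))"
    if k: "n < k" for k
  proof -
    obtain d where "f k \<in> Pkd k d" using f k unfolding stab_def by (meson less_imp_le)
    then have "fold opT [n..<k - 1] (f k) \<in> Pk k" using Pk[of k "k - 1" d] k Pkd_imp_Pk by auto
    moreover have "[n..<k] = [n..<k - 1] @ [k - 1]"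
      using k upt_Suc_append[of n "k - 1"] by simp
    moreover have "proj k (fold opT [n..<k - 1] (f k)) = fold opT [n..<k - 1] (proj k (f k))"
      by (rule proj_fold_opT) auto
    ultimately show ?thesis using proj_omP_opT[of k] k n by simp
  qed
  show "swap_pol i (omP k (fold opT [n..<k] (f k))) = omP k (fold opT [n..<k] (f k))"
    if i: "m < i" "i < k" "swap_pol i (f k) = f k" for i k
  proof -
    obtain j where j: "i = j + 1" "n \<le> j" using i nm by (metis Suc_eq_plus1 less_imp_Suc_add less_Suc_eq_le order_le_less_trans)
    have "opT j (fold opT [n..<k] (f k)) = fold opT [n..<k] (opT (j + 1) (f k))"
      unfolding to_ratfun by (rule fold_TM_shift[symmetric]) (use i j in auto)
    also have "\<dots> = fold opT [n..<k] (f k)" using i(3) j opT_fixed_iff[of i "f k"] by simp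
    finally have "swap_pol j (fold opT [n..<k] (f k)) = fold opT [n..<k] (f k)"
      by (simp add: opT_fixed_iff)
    moreover have "fold opT [n..<k] (f k) \<in> Pk k"
    proof -
      obtain d where "f k \<in> Pkd k d" using f i nm unfolding stab_def by (meson less_imp_le order_trans less_le_trans)
      then show ?thesis using Pk[of k k d] i nm Pkd_imp_Pk by auto
    qed
    ultimately show ?thesis using swap_omP[of i k] j i n by simp
  qed
qed (use f in simp)

text \<open>Here the last transposition fixes the sequence and thus plays the part of the last \<open>T\<close>.\<close>

lemma stab_omP:
  assumes f: "stab m m f" shows "stab (m + 1) (m + 1) (\<lambda>k. omP k (f k))"
proof (rule stab_linear[of "m + 1" "m + 1" f omP 0])
  show "stab (m + 1) (m + 1) f" using f by (rule stab_mono) auto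
  show "omP k (f k) \<in> Pkd k (d + 0)" if "m + 1 \<le> k" "f k \<in> Pkd k d" for k d
    using omP_Pkd[of k] that by simp
  show "proj k (omP k (f k)) = omP (k - 1) (proj k (f k))" if "m + 1 < k" for k
  proof -
    have "swap_pol (k - 1) (f k) = f k" using f that unfolding stab_def by auto
    then show ?thesis using proj_omP_swap[of k "f k"] stab_Pk[OF f, of k] that by simp
  qed
  show "swap_pol i (omP k (f k)) = omP k (f k)" if "m + 1 < i" "i < k" for i k
  proof -
    have "swap_pol (i - 1) (f k) = f k" using f that unfolding stab_def by auto
    then show ?thesis using swap_omP[of i k "f k"] stab_Pk[OF f, of k] that by simp
  qed
qed

text \<open>Inserting the value zero for \<open>x_m\<close> and renaming the later variables makes \<open>x_m\<close> one of the
  symmetric variables. At \<open>x_m = 0\<close> the new sequence has two arguments equal to zero; by symmetry the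
  second one can be moved to the end, where it is removed by compatibility. So the new sequence agrees
  with the old one at \<open>x_m = 0\<close>, and their difference is a multiple of \<open>x_m\<close>.\<close>

definition insert0 :: "nat \<Rightarrow> pol \<Rightarrow> pol" where
  "insert0 m = subst_pol (\<lambda>j. if j < m then Var j else if j = m then 0 else Var (j - 1))"

lemma stab_insert0:
  assumes f: "stab m m f" and m: "1 \<le> m" shows "stab (m - 1) (m - 1) (\<lambda>k. insert0 m (f (k + 1)))"
proof -
  obtain d where d: "\<And>k. m \<le> k \<Longrightarrow> f k \<in> Pkd k d" using f by (auto simp: stab_def)
  have "insert0 m (f (k + 1)) \<in> Pkd k d" if "m - 1 \<le> k" for k
    unfolding insert0_def by (rule Pkd_subst[OF d]) (use that m in \<open>auto intro!: Pkd_Var\<close>)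
  moreover have "proj k (insert0 m (f (k + 1))) = insert0 m (f k)" if k: "m - 1 < k" for k
  proof -
    have "proj k (insert0 m (f (k + 1))) = insert0 m (proj (k + 1) (f (k + 1)))"
      unfolding insert0_def proj_def subst_pol_subst_pol
      by (rule arg_cong[where f = "\<lambda>\<sigma>. subst_pol \<sigma> (f (k + 1))"]) (use k in \<open>auto simp: fun_eq_iff\<close>)
    also have "proj (k + 1) (f (k + 1)) = f k" using f k by (auto simp: stab_def)
    finally show ?thesis .
  qed
  moreover have "swap_pol i (insert0 m (f (k + 1))) = insert0 m (f (k + 1))" if i: "m - 1 < i" "i < k" for i k
  proof -
    have mi: "m \<le> i" using i m by simp
    have "swap_pol i (insert0 m (f (k + 1))) = insert0 m (swap_pol (i + 1) (f (k + 1)))"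
      unfolding insert0_def swap_pol_monsub subst_pol_subst_pol
    proof (rule arg_cong[where f = "\<lambda>\<sigma>. subst_pol \<sigma> (f (k + 1))"], rule ext)
      fix j
      consider "j < m" | "j = m" | "j = i + 1" | "j = i + 2" | "m < j" "j \<noteq> i + 1" "j \<noteq> i + 2"
        by linarith
      then show "subst_pol (\<lambda>j. Var (adj_swap i j)) (if j < m then Var j else if j = m then 0 else Var (j - 1))
        = subst_pol (\<lambda>j. if j < m then Var j else if j = m then 0 else Var (j - 1)) (Var (adj_swap (i + 1) j))"
        using mi by cases (auto simp: adj_swap_def)
    qed
    also have "swap_pol (i + 1) (f (k + 1)) = f (k + 1)" using f i by (auto simp: stab_def)
    finally show ?thesis .
  qed
  ultimately show ?thesis unfolding stab_def by auto
qed

lemma proj_insert0: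
  assumes f: "stab m m f" and m: "1 \<le> m" "m \<le> k" shows "proj m (insert0 m (f (k + 1))) = proj m (f k)"
proof -
  \<comment> \<open>Zero is inserted at position \<open>m\<close> and at position \<open>j\<close>; the latter moves from \<open>m + 1\<close> to \<open>k + 1\<close>.\<close>
  define A where "A j = subst_pol (\<lambda>l. if l = m \<or> l = j then 0 else if l < j then Var l else Var (l - 1))" for j
  have step: "A j (f (k + 1)) = A (m + 1) (f (k + 1))" if "m + 1 \<le> j" "j \<le> k + 1" for j
    using that
  proof (induction j rule: dec_induct)
    case (step j)
    have "A (Suc j) (f (k + 1)) = A j (swap_pol j (f (k + 1)))"
      unfolding A_def swap_pol_monsub subst_pol_subst_pol
      by (rule arg_cong[where f = "\<lambda>\<sigma>. subst_pol \<sigma> (f (k + 1))"])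
         (use step in \<open>auto simp: fun_eq_iff adj_swap_def\<close>)
    also have "swap_pol j (f (k + 1)) = f (k + 1)" using f step by (auto simp: stab_def)
    finally show ?case using step by simp
  qed simp
  have "A (m + 1) (f (k + 1)) = proj m (insert0 m (f (k + 1)))"
    unfolding A_def proj_def insert0_def subst_pol_subst_pol
    by (rule arg_cong[where f = "\<lambda>\<sigma>. subst_pol \<sigma> (f (k + 1))"]) (auto simp: fun_eq_iff)
  moreover have "A (k + 1) (f (k + 1)) = proj m (proj (k + 1) (f (k + 1)))"
    unfolding A_def proj_def subst_pol_subst_pol
    by (rule subst_pol_cong[OF stab_Pk[OF f]]) (use m in auto)
  moreover have "proj (k + 1) (f (k + 1)) = f k" using f m by (auto simp: stab_def)
  ultimately show ?thesis using step[of "k + 1"] m by simp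
qed

lemma stab_decompose:
  assumes f: "stab m m f" and m: "1 \<le> m"
  obtains g h where "stab (m - 1) (m - 1) g" "stab m m h" "\<And>k. m \<le> k \<Longrightarrow> f k = g k + Var m * h k"
proof -
  define g where "g k = insert0 m (f (k + 1))" for k
  have g: "stab (m - 1) (m - 1) g" unfolding g_def by (rule stab_insert0[OF f m])
  have "\<exists>h. f k - g k = Var m * h" if "m \<le> k" for k
    by (rule Var_dvd_proj) (use proj_insert0[OF f m that] in \<open>simp add: proj_hom g_def\<close>)
  then obtain h where h: "\<And>k. m \<le> k \<Longrightarrow> f k - g k = Var m * h k" by metis
  have "stab m m (\<lambda>k. f k + Cst (- 1) * g k)"
    using f stab_mono[OF g] by (intro stab_add stab_Cst) auto
  then have fg: "stab m m (\<lambda>k. f k - g k)" by (simp add: Cst_uminus)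
  have "stab m m h"
    unfolding stab_def
  proof (intro conjI allI impI)
    obtain d where "\<And>k. m \<le> k \<Longrightarrow> f k - g k \<in> Pkd k d" using fg unfolding stab_def by blast
    then show "\<exists>d. \<forall>k\<ge>m. h k \<in> Pkd k d" using h Pkd_divide_Var by metis
    fix k assume k: "m < k"
    have "proj k (f k - g k) = f (k - 1) - g (k - 1)" using fg k unfolding stab_def by blast
    then have "Var m * proj k (h k) = Var m * h (k - 1)"
      using h[of k] h[of "k - 1"] k by (simp add: proj_hom)
    then show "proj k (h k) = h (k - 1)" by simp
  next
    fix i k assume i: "m < i" "i < k"
    have "swap_pol i (f k - g k) = f k - g k" using fg i unfolding stab_def by blast
    moreover have "f k - g k = Var m * h k" using h i by simp
    ultimately have "swap_pol i (Var m * h k) = Var m * h k" by simp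
    then have "Var m * swap_pol i (h k) = Var m * h k" using i by (simp add: swap_pol_hom adj_swap_def)
    then show "swap_pol i (h k) = h k" by simp
  qed simp
  then show ?thesis using that[OF g] h by (metis add.commute diff_add_cancel)
qed

subsection \<open>The Cherednik operators on stable sequences\<close>

text \<open>The parameter \<open>P\<close> stands for the projection \<open>pr1\<close> or the identity; with the latter one
  obtains the operators that satisfy the relations of the DAHA.\<close>

definition opYP :: "(pol \<Rightarrow> pol) \<Rightarrow> nat \<Rightarrow> nat \<Rightarrow> pol \<Rightarrow> pol" where
  "opYP P k i f = Cst (tK ^ (k + 1 - i)) * fold opT [1..<i] (P (omP k (fold TIP [i..<k] f)))"

lemma opY_eq: "1 \<le> i \<Longrightarrow> f \<in> Pk k \<Longrightarrow> opY k i f = opYP pr1 k i f"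
  using fold_opTinv_eq[of "[i..<k]" k f] by (simp add: opY_def opYP_def varpi_omP)

lemma emb_opYP: assumes "1 \<le> i" "1 \<le> k" "f \<in> Pk k" shows "emb (opYP (\<lambda>f. f) k i f) = YM k i (emb f)"
proof -
  have "fold TIP [i..<k] f \<in> Pk k"
    using assms fold_TIP_Pkd[of "[i..<k]" k f] unfolding Pk_Un by auto
  then show ?thesis using assms by (simp add: opYP_def YM_def emb_mult emb_fold_opT emb_fold_TIP emb_omP)
qed

lemma fold_TIP_Var:
  assumes "n \<le> k"
  shows "fold TIP [n..<k] (Var n * f) = Cst (inverse tK ^ (k - n)) * Var k * fold opT [n..<k] f"
  using assms
proof (induction k rule: dec_induct)
  case (step k)
  have TIM_xv: "TIM k (xv k * v) = cK (inverse tK) * (xv (k + 1) * TM k v)" for v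
  proof -
    have "TM k (xv (k + 1) * TM k v) = xv k * (cK tK * v)"
      unfolding TM_xv_Suc TM_quadratic by (simp add: Cst_diff emb_diff algebra_simps)
    then have "xv (k + 1) * TM k v = TIM k (xv k * (cK tK * v))" by (rule TIM_eqI[symmetric])
    also have "\<dots> = cK tK * TIM k (xv k * v)" by (simp add: TIM_cK mult.left_commute[of "xv k"])
    finally show ?thesis by simp
  qed
  have TIP_Var: "TIP k (Var k * g) = Cst (inverse tK) * (Var (k + 1) * opT k g)" for g
    unfolding to_ratfun by (rule TIM_xv)
  have "fold TIP [n..<Suc k] (Var n * f) = TIP k (Cst (inverse tK ^ (k - n)) * (Var k * fold opT [n..<k] f))"
    using step by (simp add: mult.assoc)
  also have "\<dots> = Cst (inverse tK ^ (k - n)) * Cst (inverse tK) * Var (k + 1) * opT k (fold opT [n..<k] f)"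
    by (simp add: TIP_Cst TIP_Var mult.assoc)
  also have "Cst (inverse tK ^ (k - n)) * Cst (inverse tK) = Cst (inverse tK ^ (Suc k - n))"
    using step by (simp add: Suc_diff_le Cst_mult mult.commute)
  finally show ?case using step by simp
qed simp

lemma tK_power_cancel: "n \<le> k \<Longrightarrow> i \<le> n \<Longrightarrow> tK ^ (k + 1 - i) * inverse tK ^ (k - n) = tK ^ (n + 1 - i)"
proof -
  assume "n \<le> k" "i \<le> n"
  then have "tK ^ (k + 1 - i) = tK ^ (n + 1 - i) * tK ^ (k - n)" by (simp flip: power_add)
  then show ?thesis by (simp add: mult.assoc flip: power_mult_distrib)
qed

text \<open>After applying the inverses of \<open>T_i, \<dots>, T_(m-1)\<close>, split the sequence as \<open>g + x_m h\<close> with \<open>g\<close>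
  symmetric in \<open>x_m\<close> too. The remaining inverses fix \<open>g\<close>, so its contribution keeps the factor \<open>t^k\<close>. They
  turn \<open>x_m h\<close> into \<open>t^(m-k) x_k T_(k-1) \<dots> T_m h\<close>, which cancels \<open>t^k\<close>; the shift makes the factor \<open>x_k\<close>
  into \<open>q x_1\<close>, and \<open>pr1\<close> does nothing. Hence the part \<open>A\<close> without \<open>t^k\<close> is the same with and without
  the projection.\<close>

theorem opYP_stable:
  assumes f: "stab m m f" and i: "1 \<le> i" "i \<le> m"
  obtains A B where "stab m m A" "stab m m (B (\<lambda>f. f))" "stab m m (B pr1)"
    "\<And>P k. m \<le> k \<Longrightarrow> P \<in> {\<lambda>f. f, pr1} \<Longrightarrow> opYP P k i (f k) = A k + Cst (tK ^ k) * B P k"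
proof -
  have m: "1 \<le> m" using i by simp
  define G where "G k = fold TIP [i..<m] (f k)" for k
  have G: "stab m m G" unfolding G_def by (rule stab_fold_TIP[OF f]) (use i in auto)
  obtain g h where g: "stab (m - 1) (m - 1) g" and h: "stab m m h"
    and gh: "\<And>k. m \<le> k \<Longrightarrow> G k = g k + Var m * h k"
    using stab_decompose[OF G m] by blast
  define Z where "Z k = omP k (fold opT [m..<k] (h k))" for k
  have Z: "stab m m Z" unfolding Z_def by (rule stab_shift[OF h m])
  define A where "A k = Cst (tK ^ (m + 1 - i) * qK) * fold opT [1..<i] (Var 1 * Z k)" for k
  have A: "stab m m A"
    unfolding A_def using i by (intro stab_Cst stab_fold_opT stab_Var Z) auto
  define B where "B P k = Cst (tK * inverse tK ^ i) * fold opT [1..<i] (P (omP k (g k)))" for P k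
  have omg: "stab m m (\<lambda>k. omP k (g k))" using stab_omP[OF g] m by simp
  then have B: "stab m m (B (\<lambda>f. f))" "stab m m (B pr1)"
    unfolding B_def using i m by (intro stab_Cst stab_fold_opT stab_pr1; auto)+
  have "opYP P k i (f k) = A k + Cst (tK ^ k) * B P k"
    if k: "m \<le> k" and "P \<in> {\<lambda>f. f, pr1}" for P k
  proof -
    have P: "P (u + v) = P u + P v" "P (Cst c * u) = Cst c * P u" "P (Var 1 * u) = Var 1 * u" for u v c
      using that(2) by (auto simp: pr1_add pr1_Cst pr1_Var_1[simplified])
    have "[i..<k] = [i..<m] @ [m..<k]"
      using i k by (metis le_Suc_ex upt_add_eq_append)
    then have "fold TIP [i..<k] (f k) = fold TIP [m..<k] (G k)" by (simp add: G_def)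
    also have "\<dots> = fold TIP [m..<k] (g k) + fold TIP [m..<k] (Var m * h k)"
      using gh[OF k] by (simp add: fold_TIP_add)
    also have "fold TIP [m..<k] (g k) = g k"
      by (rule fold_TIP_fixed) (use g m in \<open>auto simp: stab_def\<close>)
    also have "fold TIP [m..<k] (Var m * h k) = Cst (inverse tK ^ (k - m)) * Var k * fold opT [m..<k] (h k)"
      by (rule fold_TIP_Var[OF k])
    finally have "P (omP k (fold TIP [i..<k] (f k)))
        = P (omP k (g k)) + Cst (inverse tK ^ (k - m) * qK) * (Var 1 * Z k)"
      by (simp add: omP_hom P Z_def Cst_mult mult.assoc mult.left_commute[of "Var _" "Cst _"] P[simplified])
    then have Y: "opYP P k i (f k) = Cst (tK ^ (k + 1 - i)) * fold opT [1..<i] (P (omP k (g k)))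
        + Cst (tK ^ (k + 1 - i) * (inverse tK ^ (k - m) * qK)) * fold opT [1..<i] (Var 1 * Z k)"
      by (simp add: opYP_def fold_opT_add fold_opT_Cst distrib_left Cst_mult mult.assoc)
    have c2: "tK ^ (k + 1 - i) * (inverse tK ^ (k - m) * qK) = tK ^ (m + 1 - i) * qK"
      using tK_power_cancel[of m k i] k i by (simp add: mult.assoc[symmetric])
    have c1: "tK ^ (k + 1 - i) = tK ^ k * (tK * inverse tK ^ i)"
    proof -
      have "tK ^ (k + 1 - i) * tK ^ i = tK ^ k * tK" using i k by (simp flip: power_add)
      then have "tK ^ (k + 1 - i) * (tK ^ i * inverse tK ^ i) = tK ^ k * tK * inverse tK ^ i"
        by (simp only: mult.assoc[symmetric])
      then show ?thesis by (simp add: mult.assoc flip: power_mult_distrib)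
    qed
    show ?thesis
      unfolding Y c2 unfolding c1 A_def B_def by (simp add: Cst_mult mult.assoc)
  qed
  then show ?thesis using that A B by blast
qed

text \<open>On a multiple of \<open>x_1 \<dots> x_r\<close> the inverses of \<open>T_i, \<dots>, T_(r-1)\<close> commute with this product, and it
  remains divisible by \<open>x_r\<close> as in the summand \<open>x_m h\<close> above. So no term with \<open>t^k\<close> occurs, and the value
  is again \<open>x_1 \<dots> x_r\<close> times a sequence that is stable from level \<open>r\<close> on.\<close>

definition eP :: "nat \<Rightarrow> pol" where "eP r = (\<Prod>i=1..r. Var i)"

lemma emb_eP: "emb (eP r) = eM r" by (simp add: eP_def eM_def)

lemma opYP_eP:
  assumes i: "1 \<le> i" "i \<le> r" "r \<le> k" and f: "f \<in> Pk k"
  shows "opYP (\<lambda>f. f) k i (eP r * f) = eP r * (Cst (tK ^ (r + 1 - i) * qK) *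
    fold opT [1..<i] (omP k (fold opT [r..<k] (fold TIP [i..<r] f))))"
proof -
  obtain r' where r': "r = Suc r'" using i by (cases r) auto
  have er: "eP r = eP r' * Var r" by (simp add: eP_def r')
  define g where "g = fold TIP [i..<r] f"
  have inv: "fold TIP js (eP s * u) = eP s * fold TIP js u" "fold opT js (eP s * u) = eP s * fold opT js u"
    if "\<And>j. j \<in> set js \<Longrightarrow> 1 \<le> j \<and> j \<noteq> s" for js s u
    unfolding to_ratfun emb_eP
    by (rule fold_TIM_mult fold_TM_mult, use that in \<open>auto intro!: sM_eM\<close>)+
  have "[i..<k] = [i..<r] @ [r..<k]" using i by (metis le_Suc_ex upt_add_eq_append)
  then have "fold TIP [i..<k] (eP r * f) = fold TIP [r..<k] (fold TIP [i..<r] (eP r * f))" by simp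
  also have "fold TIP [i..<r] (eP r * f) = eP r * g" unfolding g_def by (rule inv) (use i in auto)
  also have "fold TIP [r..<k] (eP r * g) = eP r' * fold TIP [r..<k] (Var r * g)"
    unfolding er mult.assoc by (rule inv) (use i r' in auto)
  also have "fold TIP [r..<k] (Var r * g) = Cst (inverse tK ^ (k - r)) * Var k * fold opT [r..<k] g"
    by (rule fold_TIP_Var) (use i in simp)
  finally have "omP k (fold TIP [i..<k] (eP r * f))
      = omP k (eP r') * (Cst (inverse tK ^ (k - r)) * (Cst qK * Var 1) * omP k (fold opT [r..<k] g))"
    by (simp add: omP_hom mult.assoc)
  also have "omP k (eP r') = (\<Prod>i=1..r'. Var (Suc i))"
    using i r' by (simp add: eP_def omP_def subst_pol_prod)
  also have "\<dots> * (Cst (inverse tK ^ (k - r)) * (Cst qK * Var 1) * omP k (fold opT [r..<k] g))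
      = Cst (inverse tK ^ (k - r) * qK) * (eP r * omP k (fold opT [r..<k] g))"
  proof -
    have "eP r = Var 1 * (\<Prod>i=1..r'. Var (Suc i))"
      unfolding eP_def r' by (subst prod.atLeast_Suc_atMost) (simp_all add: prod.atLeast_Suc_atMost_Suc_shift del: prod.cl_ivl_Suc)
    then show ?thesis by (simp add: Cst_mult mult_ac)
  qed
  finally have "opYP (\<lambda>f. f) k i (eP r * f) = Cst (tK ^ (k + 1 - i) * (inverse tK ^ (k - r) * qK)) *
      fold opT [1..<i] (eP r * omP k (fold opT [r..<k] g))"
    by (simp add: opYP_def fold_opT_Cst Cst_mult mult.assoc)
  also have "fold opT [1..<i] (eP r * omP k (fold opT [r..<k] g)) = eP r * fold opT [1..<i] (omP k (fold opT [r..<k] g))"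
    by (rule inv) (use i in auto)
  also have "tK ^ (k + 1 - i) * (inverse tK ^ (k - r) * qK) = tK ^ (r + 1 - i) * qK"
    using tK_power_cancel[of r k i] i by (simp add: mult.assoc[symmetric])
  finally show ?thesis by (simp add: g_def mult.left_commute)
qed

section \<open>Limits\<close>

subsection \<open>The \<open>t\<close>-adic valuation\<close>

lemma ordK_Fract:
  assumes "A \<noteq> 0" "B \<noteq> 0"
  shows "ordK (Fraction_Field.Fract A B) = int (Polynomial.order 0 A) - int (Polynomial.order 0 B)"
  unfolding ordK_def
proof (rule the_equality)
  fix n assume "\<exists>A' B'. A' \<noteq> 0 \<and> B' \<noteq> 0 \<and> Fraction_Field.Fract A B = Fraction_Field.Fract A' B' \<and>
     n = int (Polynomial.order 0 A') - int (Polynomial.order 0 B')"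
  then obtain A' B' where *: "A' \<noteq> 0" "B' \<noteq> 0" "Fraction_Field.Fract A B = Fraction_Field.Fract A' B'"
     "n = int (Polynomial.order 0 A') - int (Polynomial.order 0 B')" by blast
  then have "A * B' = A' * B" using assms by (simp add: eq_fract)
  then have "Polynomial.order 0 (A * B') = Polynomial.order 0 (A' * B)" by simp
  then have "Polynomial.order 0 A + Polynomial.order 0 B' = Polynomial.order 0 A' + Polynomial.order 0 B"
    using assms * by (subst (asm) (1 2) order_mult) auto
  then show "n = int (Polynomial.order 0 A) - int (Polynomial.order 0 B)" using * by simp
qed (use assms in blast)

lemma coef_cases: assumes "x \<noteq> (0::coef)" obtains A B where "A \<noteq> 0" "B \<noteq> 0" "x = Fraction_Field.Fract A B"
  using assms that by (cases x rule: Fract_cases_nonzero) auto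

lemma ordK_mult: assumes "x \<noteq> 0" "y \<noteq> 0" shows "ordK (x * y) = ordK x + ordK y"
proof -
  obtain A B where x: "A \<noteq> 0" "B \<noteq> 0" "x = Fraction_Field.Fract A B" using coef_cases assms by metis
  obtain C D where y: "C \<noteq> 0" "D \<noteq> 0" "y = Fraction_Field.Fract C D" using coef_cases assms by metis
  have "A * C \<noteq> 0" "B * D \<noteq> 0" using x y by simp_all
  then show ?thesis using x y by (simp add: ordK_Fract order_mult)
qed

lemma order_add_ge: assumes "p + q \<noteq> (0::rat poly poly)" "n \<le> Polynomial.order 0 p \<or> p = 0" "n \<le> Polynomial.order 0 q \<or> q = 0"
  shows "n \<le> Polynomial.order 0 (p + q)"
proof -
  have "[:- 0, 1:] ^ n dvd p" "[:- 0, 1:] ^ n dvd q" using assms(2,3) by (auto simp only: order_divides)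
  then have "[:- 0, 1:] ^ n dvd p + q" by (rule dvd_add)
  then show ?thesis using assms(1) by (simp only: order_divides) simp
qed

text \<open>The element \<open>0\<close> has no meaningful order, but lies in all powers of the ideal of \<open>t\<close>.\<close>

definition in_tpow :: "int \<Rightarrow> coef \<Rightarrow> bool" where
  "in_tpow m x \<longleftrightarrow> x = 0 \<or> m \<le> ordK x"

lemma in_tpow_mult: assumes "in_tpow m x" "c \<noteq> 0" shows "in_tpow (m + ordK c) (c * x)"
  using assms ordK_mult[of c x] by (cases "x = 0") (auto simp: in_tpow_def)

lemma in_tpow_add: assumes "in_tpow m x" "in_tpow m y" shows "in_tpow m (x + y)"
proof (cases "x = 0 \<or> y = 0 \<or> x + y = 0")
  case False
  obtain A B where x: "A \<noteq> 0" "B \<noteq> 0" "x = Fraction_Field.Fract A B" using coef_cases False by metis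
  obtain C D where y: "C \<noteq> 0" "D \<noteq> 0" "y = Fraction_Field.Fract C D" using coef_cases False by metis
  let ?o = "Polynomial.order 0"
  have xy: "x + y = Fraction_Field.Fract (A * D + C * B) (B * D)" using x y by simp
  have BD: "B * D \<noteq> 0" using x y by simp
  have N: "A * D + C * B \<noteq> 0" using False xy BD by (auto simp: fract_collapse)
  have m: "m + int (?o B) \<le> int (?o A)" "m + int (?o D) \<le> int (?o C)"
    using assms x y False by (auto simp: in_tpow_def ordK_Fract)
  define n where "n = nat (m + int (?o B) + int (?o D))"
  have "?o (A * D) = ?o A + ?o D" "?o (C * B) = ?o C + ?o B" "?o (B * D) = ?o B + ?o D"
    by (rule order_mult; use x y in simp)+
  note o = this
  have "n \<le> ?o (A * D + C * B)"
    by (rule order_add_ge[OF N]) (use m in \<open>simp_all add: o n_def nat_le_iff\<close>)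
  then show ?thesis
    unfolding in_tpow_def xy ordK_Fract[OF N BD] using o by (simp add: n_def nat_le_iff)
qed (use assms in \<open>auto simp: in_tpow_def\<close>)

lemma in_tpow_uminus: "in_tpow m x \<Longrightarrow> in_tpow m (- x)"
proof -
  have "ordK (- 1) = 0"
  proof -
    have "(- 1::coef) = Fraction_Field.Fract (- 1) 1" by (simp add: One_fract_def)
    then show ?thesis by (simp add: ordK_Fract order_0I)
  qed
  then show "in_tpow m x \<Longrightarrow> in_tpow m (- x)" using in_tpow_mult[of m x "- 1"] by simp
qed

lemma convK_iff: "convK a l \<longleftrightarrow> (\<forall>m. \<forall>\<^sub>F n in sequentially. in_tpow m (a n - l))"
  by (simp add: convK_def in_tpow_def)

lemma convK_cong: "convK a l \<Longrightarrow> \<forall>\<^sub>F n in sequentially. a n = b n \<Longrightarrow> convK b l"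
  unfolding convK_iff by (auto elim: eventually_elim2)

lemma convK_const: "convK (\<lambda>n. l) l" by (simp add: convK_iff in_tpow_def)

lemma convK_add: assumes "convK a l" "convK b l'" shows "convK (\<lambda>n. a n + b n) (l + l')"
  unfolding convK_iff
proof
  fix m
  have "\<forall>\<^sub>F n in sequentially. in_tpow m (a n - l)" "\<forall>\<^sub>F n in sequentially. in_tpow m (b n - l')"
    using assms by (auto simp: convK_iff)
  then show "\<forall>\<^sub>F n in sequentially. in_tpow m (a n + b n - (l + l'))"
  proof eventually_elim
    case (elim n)
    have "a n + b n - (l + l') = (a n - l) + (b n - l')" by simp
    then show ?case using in_tpow_add[OF elim] by metis
  qed
qed

lemma convK_mult_const: assumes "convK a l" shows "convK (\<lambda>n. a n * c) (l * c)"
proof (cases "c = 0")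
  case False
  show ?thesis unfolding convK_iff
  proof
    fix m
    have "\<forall>\<^sub>F n in sequentially. in_tpow (m - ordK c) (a n - l)" using assms by (auto simp: convK_iff)
    then show "\<forall>\<^sub>F n in sequentially. in_tpow m (a n * c - l * c)"
    proof eventually_elim
      case (elim n)
      have "c * (a n - l) = a n * c - l * c" by (simp add: algebra_simps)
      then show ?case using in_tpow_mult[OF elim False] by simp
    qed
  qed
qed (simp add: convK_const)

lemma convK_sum: "(\<And>i. i \<in> A \<Longrightarrow> convK (a i) (l i)) \<Longrightarrow> convK (\<lambda>n. \<Sum>i\<in>A. a i n) (\<Sum>i\<in>A. l i)"
  by (induction A rule: infinite_finite_induct) (auto intro: convK_add convK_const)

lemma convK_unique: assumes "convK a l" "convK a l'" shows "l = l'"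
proof (rule ccontr)
  assume "l \<noteq> l'"
  define m where "m = ordK (l - l') + 1"
  have "\<forall>\<^sub>F n in sequentially. in_tpow m (a n - l)" "\<forall>\<^sub>F n in sequentially. in_tpow m (a n - l')"
    using assms by (auto simp: convK_iff)
  then have "\<forall>\<^sub>F n in sequentially. in_tpow m (l - l')"
  proof eventually_elim
    case (elim n)
    have "l - l' = - (a n - l) + (a n - l')" by simp
    then show ?case using in_tpow_add[OF in_tpow_uminus[OF elim(1)] elim(2)] by simp
  qed
  then show False using \<open>l \<noteq> l'\<close> by (simp add: in_tpow_def m_def)
qed

lemma ordK_tK: "ordK (tK ^ n) = int n"
proof -
  have "tK ^ n = Fraction_Field.Fract ([:0, 1:] ^ n) 1"
    by (induction n) (simp_all add: tK_def One_fract_def)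
  moreover have "Polynomial.order 0 ([:- 0, 1:] ^ n :: rat poly poly) = n" by (rule order_power_n_n)
  ultimately show ?thesis by (simp add: ordK_Fract order_0I)
qed

lemma convK_tK: assumes "1 \<le> n" shows "convK (\<lambda>k. tK ^ (k * n)) 0"
  unfolding convK_iff
proof
  fix m :: int
  have "in_tpow m (tK ^ (k * n) - 0)" if "nat m \<le> k" for k
  proof -
    have "nat m \<le> k * n" using that assms by (metis le_trans mult.right_neutral mult_le_mono2)
    then show ?thesis by (simp add: in_tpow_def ordK_tK nat_le_iff)
  qed
  then show "\<forall>\<^sub>F k in sequentially. in_tpow m (tK ^ (k * n) - 0)"
    unfolding eventually_sequentially by blast
qed

subsection \<open>The almost symmetric module\<close>

text \<open>The composition of the projections down to level \<open>k\<close>.\<close>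

definition trunc :: "nat \<Rightarrow> pol \<Rightarrow> pol" where
  "trunc k = subst_pol (\<lambda>j. if j \<le> k then Var j else 0)"

lemma trunc_id: "f \<in> Pk k \<Longrightarrow> trunc k f = f"
  unfolding trunc_def by (rule subst_pol_id) auto

lemma trunc_proj: "k < l \<Longrightarrow> trunc k (proj l f) = trunc k f"
  unfolding trunc_def proj_def subst_pol_subst_pol
  by (rule arg_cong[where f = "\<lambda>\<sigma>. subst_pol \<sigma> f"]) auto

lemma proj_trunc: "1 \<le> k \<Longrightarrow> proj k (trunc k f) = trunc (k - 1) f"
  unfolding trunc_def proj_def subst_pol_subst_pol
  by (rule arg_cong[where f = "\<lambda>\<sigma>. subst_pol \<sigma> f"]) (auto simp: fun_eq_iff)

lemma trunc_Pkd: "f \<in> Pkd n d \<Longrightarrow> trunc k f \<in> Pkd k d"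
  unfolding trunc_def by (rule Pkd_subst) (auto intro: Pkd_Var)

lemma trunc_compat:
  assumes "\<And>l. k < l \<Longrightarrow> proj l (F l) = F (l - 1)" "F k \<in> Pk k" "k \<le> l"
  shows "trunc k (F l) = F k"
  using assms(3)
proof (induction l rule: dec_induct)
  case base
  then show ?case using assms(2) by (rule trunc_id)
next
  case (step l)
  then show ?case using trunc_proj[of k "Suc l" "F (Suc l)"] assms(1)[of "Suc l"] by simp
qed

lemma swap_pol_Pk: assumes "1 \<le> i" "i < k" "f \<in> Pk k" shows "swap_pol i f \<in> Pk k"
proof -
  obtain d where "f \<in> Pkd k d" using assms Pk_imp_Pkd by blast
  then have "swap_pol i f \<in> Pkd k d"
    unfolding swap_pol_monsub by (rule Pkd_subst) (use assms in \<open>auto intro!: Pkd_Var simp: adj_swap_def\<close>)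
  then show ?thesis by (rule Pkd_imp_Pk)
qed

lemma Pinf_compat: "F \<in> Pinf \<Longrightarrow> k \<le> l \<Longrightarrow> trunc k (F l) = F k"
  by (rule trunc_compat) (auto simp: Pinf_def)

lemma Psym_stab: "F \<in> Psym m \<longleftrightarrow> stab 0 m F"
proof
  assume F: "F \<in> Psym m"
  then have Pinf: "F \<in> Pinf" by (simp add: Psym_def)
  show "stab 0 m F"
    unfolding stab_def
  proof (intro conjI allI impI)
    show "\<exists>d. \<forall>k\<ge>0. F k \<in> Pkd k d"
      using Pinf unfolding Pinf_def Pk_def Pkd_def by blast
    show "proj k (F k) = F (k - 1)" if "0 < k" for k
      using Pinf that unfolding Pinf_def by simp
    show "swap_pol i (F k) = F k" if i: "m < i" "i < k" for i k
    proof -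
      have "swap_inf i F k = F k" using F i by (simp add: Psym_def)
      moreover have "max k (i + 1) = k" using i by simp
      ultimately have "trunc k (swap_pol i (F k)) = F k" by (simp only: swap_inf_def trunc_def)
      moreover have "swap_pol i (F k) \<in> Pk k" using i Pinf by (intro swap_pol_Pk) (auto simp: Pinf_def)
      ultimately show ?thesis by (simp add: trunc_id)
    qed
  qed simp
next
  assume F: "stab 0 m F"
  then obtain d where d: "\<And>k. F k \<in> Pkd k d" unfolding stab_def by auto
  have Pinf: "F \<in> Pinf"
    using F d Pkd_imp_Pk[OF d] unfolding Pinf_def stab_def Pkd_def by auto
  have "swap_inf i F = F" if i: "m < i" for i
  proof
    fix k
    have "swap_pol i (F (max k (i + 1))) = F (max k (i + 1))" using F i unfolding stab_def by auto
    then show "swap_inf i F k = F k"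
      using Pinf_compat[OF Pinf, of k "max k (i + 1)"] by (simp add: swap_inf_def trunc_def)
  qed
  then show "F \<in> Psym m" using Pinf by (simp add: Psym_def)
qed

lemma Pas_iff: "F \<in> Pas \<longleftrightarrow> (\<exists>m. stab 0 m F)"
  by (simp add: Pas_def Psym_stab)

lemma Pas_Pinf: "F \<in> Pas \<Longrightarrow> F \<in> Pinf"
  by (auto simp: Pas_def Psym_def)

lemma Pas_Pk: "F \<in> Pas \<Longrightarrow> F k \<in> Pk k"
  using Pas_Pinf by (auto simp: Pinf_def)

lemma Pas_stab: assumes "F \<in> Pas" obtains m where "\<And>n l. m \<le> l \<Longrightarrow> n \<le> l \<Longrightarrow> stab n l F"
  using assms stab_mono unfolding Pas_iff by blast

lemma stab_extend: assumes f: "stab n m f" obtains F where "F \<in> Pas" "\<And>k. n \<le> k \<Longrightarrow> F k = f k"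
proof -
  define F where "F k = (if n \<le> k then f k else trunc k (f n))" for k
  obtain d where d: "\<And>k. n \<le> k \<Longrightarrow> f k \<in> Pkd k d" using f unfolding stab_def by blast
  have nm: "n \<le> m" using f by (simp add: stab_def)
  have "F k \<in> Pkd k d" for k using d trunc_Pkd[OF d[of n]] by (simp add: F_def)
  moreover have "proj k (F k) = F (k - 1)" if k: "0 < k" for k
  proof -
    consider "n < k" | "k = n" | "k < n" by linarith
    then show ?thesis
    proof cases
      case 1
      then have "n \<le> k - 1" by simp
      then show ?thesis using f 1 by (simp add: F_def stab_def)
    next
      case 2
      have "proj n (f n) = proj n (trunc n (f n))" using trunc_id[OF stab_Pk[OF f]] by simp
      moreover have "\<not> n \<le> n - 1" using 2 k by simp
      ultimately show ?thesis using 2 k by (simp add: F_def proj_trunc)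
    next
      case 3
      then have "\<not> n \<le> k - 1" "\<not> n \<le> k" by simp_all
      then show ?thesis using k by (simp add: F_def proj_trunc)
    qed
  qed
  moreover have "swap_pol i (F k) = F k" if "m < i" "i < k" for i k
    using f that nm by (simp add: F_def stab_def)
  ultimately have "stab 0 m F" unfolding stab_def by blast
  then show ?thesis using that[of F] by (auto simp: Pas_iff F_def)
qed

lemma Pas_add: assumes "F \<in> Pas" "G \<in> Pas" shows "(\<lambda>k. F k + G k) \<in> Pas"
proof -
  obtain m m' where "stab 0 m F" "stab 0 m' G" using assms by (auto simp: Pas_iff)
  then have "stab 0 (max m m') F" "stab 0 (max m m') G" using stab_mono by auto
  then show ?thesis using stab_add unfolding Pas_iff by blast
qed
lemma Pas_Cst: "F \<in> Pas \<Longrightarrow> (\<lambda>k. Cst c * F k) \<in> Pas"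
  using stab_Cst unfolding Pas_iff by blast
lemma Pas_zero: "(\<lambda>k. 0) \<in> Pas"
  unfolding Pas_iff stab_def by (auto simp: proj_hom swap_pol_hom)

subsection \<open>Uniqueness of limits\<close>

lemma Pinf_lookup:
  assumes F: "F \<in> Pinf" and m: "Poly_Mapping.keys m \<subseteq> {1..K}" and "K \<le> k"
  shows "Poly_Mapping.lookup (F k) m = Poly_Mapping.lookup (F K) m"
  using assms(3)
proof (induction k rule: dec_induct)
  case (step k)
  have "proj (Suc k) (F (Suc k)) = F k" using F unfolding Pinf_def by auto
  moreover have "Suc k \<notin> Poly_Mapping.keys m" using m step by auto
  ultimately show ?case using step.IH lookup_proj[of "Suc k" "F (Suc k)" m] by simp
qed simp

lemma Cst_mult_lookup: "Poly_Mapping.lookup (Cst c * f) m = c * Poly_Mapping.lookup f m"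
proof (induction f rule: poly_mapping_additive_induct)
  case (single n d)
  then show ?case by (simp add: Cst_def mult_single lookup_single when_def)
qed (simp_all add: distrib_left lookup_add)

text \<open>The coefficients of a compatible sequence at a fixed monomial are eventually constant, so a limit
  in the sense of \<open>has_lim\<close> is a \<open>t\<close>-adic limit of coefficients.\<close>

lemma has_lim_coefficient:
  assumes "has_lim f L"
  shows "Poly_Mapping.keys m \<subseteq> {1..K} \<Longrightarrow> convK (\<lambda>k. Poly_Mapping.lookup (f k) m) (Poly_Mapping.lookup (L K) m)"
    and "\<not> Poly_Mapping.keys m \<subseteq> {1..K} \<Longrightarrow> Poly_Mapping.lookup (L K) m = 0"
proof -
  obtain N :: nat and h g a b where h: "h \<in> Pinf" and ab: "\<And>i. i \<in> {1..N} \<Longrightarrow> g i \<in> Pas \<and> convK (a i) (b i)"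
    and f: "\<forall>\<^sub>F k in sequentially. f k = h k + (\<Sum>i=1..N. Cst (a i k) * g i k)"
    and L: "L = (\<lambda>k. h k + (\<Sum>i=1..N. Cst (b i) * g i k))"
    using assms unfolding has_lim_def by blast
  have g: "g i \<in> Pinf" if "i \<in> {1..N}" for i using ab[OF that] Pas_Pinf by blast
  show "convK (\<lambda>k. Poly_Mapping.lookup (f k) m) (Poly_Mapping.lookup (L K) m)"
    if m: "Poly_Mapping.keys m \<subseteq> {1..K}"
  proof -
    have "\<forall>\<^sub>F k in sequentially. Poly_Mapping.lookup (h K) m + (\<Sum>i=1..N. a i k * Poly_Mapping.lookup (g i K) m)
        = Poly_Mapping.lookup (f k) m"
      using f eventually_ge_at_top[of K]
    proof eventually_elim
      case (elim k)
      then show ?case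
        using Pinf_lookup[OF h m elim(2)] Pinf_lookup[OF g m elim(2)]
        by (simp add: lookup_add lookup_sum Cst_mult_lookup)
    qed
    moreover have "convK (\<lambda>k. Poly_Mapping.lookup (h K) m + (\<Sum>i=1..N. a i k * Poly_Mapping.lookup (g i K) m))
        (Poly_Mapping.lookup (h K) m + (\<Sum>i=1..N. b i * Poly_Mapping.lookup (g i K) m))"
      using ab by (intro convK_add convK_const convK_sum convK_mult_const) auto
    ultimately show ?thesis
      unfolding L by (simp add: lookup_add lookup_sum Cst_mult_lookup convK_cong)
  qed
  show "Poly_Mapping.lookup (L K) m = 0" if "\<not> Poly_Mapping.keys m \<subseteq> {1..K}"
  proof -
    have "Poly_Mapping.lookup (F K) m = 0" if "F \<in> Pinf" for F
    proof -
      have "F K \<in> Pk K" using that by (simp add: Pinf_def)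
      then have "m \<notin> Poly_Mapping.keys (F K)" using \<open>\<not> Poly_Mapping.keys m \<subseteq> {1..K}\<close> unfolding Pk_def by blast
      then show ?thesis by (simp add: in_keys_iff)
    qed
    then show ?thesis using h g unfolding L by (simp add: lookup_add lookup_sum Cst_mult_lookup)
  qed
qed

lemma has_lim_unique: assumes "has_lim f L" "has_lim f L'" shows "L = L'"
proof
  fix K
  show "L K = L' K"
  proof (rule poly_mapping_eqI)
    fix m
    show "Poly_Mapping.lookup (L K) m = Poly_Mapping.lookup (L' K) m"
      using has_lim_coefficient[OF assms(1), of m K] has_lim_coefficient[OF assms(2), of m K] convK_unique
      by (cases "Poly_Mapping.keys m \<subseteq> {1..K}") auto
  qed
qed

lemma op_lim_eq: "has_lim (\<lambda>k. A k (F k)) L \<Longrightarrow> op_lim A F = L"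
  unfolding op_lim_def using has_lim_unique by blast

subsection \<open>Convergence with error terms of positive order in \<open>t^k\<close>\<close>

text \<open>Limits with arbitrary coefficient sequences do not obviously pass through operators. Those that
  occur here have coefficients \<open>t^(k n)\<close>, and this form is inherited under composition.\<close>

definition error_sum :: "(nat \<times> (nat \<Rightarrow> pol)) list \<Rightarrow> nat \<Rightarrow> pol" where
  "error_sum es k = (\<Sum>(n, g)\<leftarrow>es. Cst (tK ^ (k * n)) * g k)"

definition conv :: "(nat \<Rightarrow> pol) \<Rightarrow> (nat \<Rightarrow> pol) \<Rightarrow> bool" where
  "conv f F \<longleftrightarrow> F \<in> Pas \<and> (\<exists>es. (\<forall>(n, g)\<in>set es. 1 \<le> n \<and> g \<in> Pas) \<and>
     (\<forall>\<^sub>F k in sequentially. f k = F k + error_sum es k))"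

lemma conv_Pas: "conv f F \<Longrightarrow> F \<in> Pas" by (simp add: conv_def)

lemma conv_cong: "conv f F \<Longrightarrow> \<forall>\<^sub>F k in sequentially. f k = g k \<Longrightarrow> conv g F"
proof -
  assume f: "conv f F" and fg: "\<forall>\<^sub>F k in sequentially. f k = g k"
  obtain es where es: "\<forall>(n, g)\<in>set es. 1 \<le> n \<and> g \<in> Pas"
    and e: "\<forall>\<^sub>F k in sequentially. f k = F k + error_sum es k"
    using f unfolding conv_def by blast
  have "\<forall>\<^sub>F k in sequentially. g k = F k + error_sum es k"
    using fg e by eventually_elim simp
  then show "conv g F" using es f unfolding conv_def by blast
qed

lemma conv_refl: "F \<in> Pas \<Longrightarrow> conv F F"
  unfolding conv_def by (auto intro!: exI[of _ "[]"] simp: error_sum_def)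

lemma conv_add: assumes "conv f F" "conv g G" shows "conv (\<lambda>k. f k + g k) (\<lambda>k. F k + G k)"
proof -
  obtain es es' where "\<forall>(n, g)\<in>set es. 1 \<le> n \<and> g \<in> Pas" "\<forall>(n, g)\<in>set es'. 1 \<le> n \<and> g \<in> Pas"
    and e: "\<forall>\<^sub>F k in sequentially. f k = F k + error_sum es k"
      "\<forall>\<^sub>F k in sequentially. g k = G k + error_sum es' k"
    using assms unfolding conv_def by blast
  then have "\<forall>(n, g)\<in>set (es @ es'). 1 \<le> n \<and> g \<in> Pas" by auto
  moreover have "\<forall>\<^sub>F k in sequentially. f k + g k = F k + G k + error_sum (es @ es') k"
    using e by eventually_elim (simp add: error_sum_def)
  ultimately show ?thesis using assms Pas_add unfolding conv_def by blast
qed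

lemma conv_shift: assumes "conv f F" "1 \<le> n" shows "conv (\<lambda>k. Cst (tK ^ (k * n)) * f k) (\<lambda>k. 0)"
proof -
  obtain es where es: "\<forall>(n, g)\<in>set es. 1 \<le> n \<and> g \<in> Pas"
    and e: "\<forall>\<^sub>F k in sequentially. f k = F k + error_sum es k"
    using assms unfolding conv_def by blast
  define es' where "es' = (n, F) # map (\<lambda>(m, g). (n + m, g)) es"
  have "error_sum (map (\<lambda>(m, g). (n + m, g)) es) k = Cst (tK ^ (k * n)) * error_sum es k" for k
    by (induction es) (auto simp: error_sum_def distrib_left power_add Cst_mult mult.assoc add_mult_distrib2)
  then have "\<forall>\<^sub>F k in sequentially. Cst (tK ^ (k * n)) * f k = 0 + error_sum es' k"
    using e by (auto elim!: eventually_mono simp: es'_def error_sum_def distrib_left)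
  moreover have "\<forall>(n, g)\<in>set es'. 1 \<le> n \<and> g \<in> Pas"
    using es assms conv_Pas by (auto simp: es'_def)
  ultimately show ?thesis using Pas_zero unfolding conv_def by blast
qed

lemma conv_Cst: assumes "conv f F" shows "conv (\<lambda>k. Cst c * f k) (\<lambda>k. Cst c * F k)"
proof -
  obtain es where es: "\<forall>(n, g)\<in>set es. 1 \<le> n \<and> g \<in> Pas"
    and e: "\<forall>\<^sub>F k in sequentially. f k = F k + error_sum es k"
    using assms unfolding conv_def by blast
  define es' where "es' = map (\<lambda>(m, g). (m, \<lambda>k. Cst c * g k)) es"
  have "error_sum es' k = Cst c * error_sum es k" for k
    unfolding es'_def by (induction es) (auto simp: error_sum_def distrib_left mult.left_commute)
  then have "\<forall>\<^sub>F k in sequentially. Cst c * f k = Cst c * F k + error_sum es' k"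
    using e by (auto elim!: eventually_mono simp: distrib_left)
  moreover have "\<forall>(n, g)\<in>set es'. 1 \<le> n \<and> g \<in> Pas"
    using es Pas_Cst by (auto simp: es'_def)
  ultimately show ?thesis using assms Pas_Cst unfolding conv_def by blast
qed

lemma conv_op:
  assumes add: "\<And>k f g. A k (f + g) = A k f + A k g" and Cst: "\<And>k c f. A k (Cst c * f) = Cst c * A k f"
    and A: "\<And>F. F \<in> Pas \<Longrightarrow> conv (\<lambda>k. A k (F k)) (L F)" and f: "conv f F"
  shows "conv (\<lambda>k. A k (f k)) (L F)"
proof -
  obtain es where es: "\<forall>(n, g)\<in>set es. 1 \<le> n \<and> g \<in> Pas"
    and e: "\<forall>\<^sub>F k in sequentially. f k = F k + error_sum es k"
    using f unfolding conv_def by blast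
  have "conv (\<lambda>k. A k (F k + error_sum es k)) (L F)" using es
  proof (induction es)
    case Nil
    then show ?case using A conv_Pas[OF f] by (simp add: error_sum_def)
  next
    case (Cons e es)
    obtain n g where e: "e = (n, g)" by fastforce
    have "conv (\<lambda>k. Cst (tK ^ (k * n)) * A k (g k)) (\<lambda>k. 0)"
      using Cons e A by (intro conv_shift) auto
    moreover have "conv (\<lambda>k. A k (F k + error_sum es k)) (L F)" using Cons by auto
    ultimately have "conv (\<lambda>k. A k (F k + error_sum es k) + Cst (tK ^ (k * n)) * A k (g k)) (\<lambda>k. L F k + 0)"
      by (rule conv_add[rotated])
    moreover have "A k (F k + error_sum es k) + Cst (tK ^ (k * n)) * A k (g k)
        = A k (F k + error_sum (e # es) k)" for k
    proof -
      have "F k + error_sum (e # es) k = (F k + error_sum es k) + Cst (tK ^ (k * n)) * g k"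
        by (simp add: e error_sum_def)
      then show ?thesis by (simp only: add Cst)
    qed
    ultimately show ?case by simp
  qed
  then show ?thesis by (rule conv_cong) (use e in \<open>auto elim: eventually_mono\<close>)
qed

lemma conv_has_lim: assumes "conv f F" shows "has_lim f F"
proof -
  obtain es where es: "\<forall>(n, g)\<in>set es. 1 \<le> n \<and> g \<in> Pas"
    and e: "\<forall>\<^sub>F k in sequentially. f k = F k + error_sum es k"
    using assms unfolding conv_def by blast
  \<comment> \<open>The summand zero makes the number of summands positive.\<close>
  define es' where "es' = (1, \<lambda>k. 0) # es"
  define N where "N = length es'"
  define g where "g i = snd (es' ! (i - 1))" for i
  define a where "a i k = tK ^ (k * fst (es' ! (i - 1)))" for i k
  have sum: "(\<Sum>i=1..N. Cst (a i k) * g i k) = error_sum es k" for k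
  proof -
    have "(\<Sum>i=1..N. Cst (a i k) * g i k) = (\<Sum>i<N. Cst (tK ^ (k * fst (es' ! i))) * snd (es' ! i) k)"
      by (rule sum.reindex_bij_witness[of _ Suc "\<lambda>i. i - 1"]) (auto simp: a_def g_def)
    also have "\<dots> = error_sum es' k"
      unfolding error_sum_def N_def by (subst sum_list_sum_nth) (auto simp: case_prod_unfold atLeast0LessThan)
    finally show ?thesis by (simp add: es'_def error_sum_def)
  qed
  have mem: "1 \<le> fst (es' ! (i - 1)) \<and> g i \<in> Pas" if "i \<in> {1..N}" for i
  proof -
    have "es' ! (i - 1) \<in> set es'" using that by (intro nth_mem) (auto simp: N_def)
    then show ?thesis using es Pas_zero by (auto simp: g_def es'_def)
  qed
  have F: "F \<in> Pinf" using assms conv_Pas Pas_Pinf by blast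
  have "g i \<in> Pas \<and> convK (a i) 0" if "i \<in> {1..N}" for i
    using mem[OF that] convK_tK[of "fst (es' ! (i - 1))"] by (auto simp: a_def[abs_def])
  moreover have "1 \<le> N" by (simp add: N_def es'_def)
  ultimately show ?thesis
    unfolding has_lim_def using F e
    by (intro exI[of _ N] conjI bexI[of _ F] exI[of _ g] exI[of _ a] exI[of _ "\<lambda>_. 0"]) (auto simp: sum[simplified])
qed

lemma conv_unique: "conv f F \<Longrightarrow> conv f G \<Longrightarrow> F = G"
  using has_lim_unique conv_has_lim by blast

section \<open>The standard representation\<close>

definition opP :: "nat \<Rightarrow> dgen \<Rightarrow> pol \<Rightarrow> pol" where
  "opP k g f = (case g of GT i \<Rightarrow> opT i f | GX i \<Rightarrow> Var i * f | GY i \<Rightarrow> opYP (\<lambda>f. f) k i f | _ \<Rightarrow> 0)"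

definition opL :: "dgen \<Rightarrow> (nat \<Rightarrow> pol) \<Rightarrow> nat \<Rightarrow> pol" where
  "opL g = (case g of GT i \<Rightarrow> limT i | GX i \<Rightarrow> limX i | GY i \<Rightarrow> limY i | _ \<Rightarrow> (\<lambda>F k. 0))"

lemma opP_add: "opP k g (f + f') = opP k g f + opP k g f'"
  by (cases g) (simp_all add: opP_def opYP_def opT_add fold_opT_add fold_TIP_add omP_hom algebra_simps)
lemma opP_Cst: "opP k g (Cst c * f) = Cst c * opP k g f"
  by (cases g) (simp_all add: opP_def opYP_def opT_Cst fold_opT_Cst fold_TIP_Cst omP_hom mult.left_commute)

text \<open>The operators with index \<open>i\<close> require a level above \<open>i\<close>; the limit does not depend on the earlier
  levels.\<close>

lemma conv_stab: assumes "stab n m f" obtains F where "F \<in> Pas" "conv f F" "\<And>k. n \<le> k \<Longrightarrow> f k = F k"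
proof -
  obtain F where F: "F \<in> Pas" "\<And>k. n \<le> k \<Longrightarrow> F k = f k" using stab_extend[OF assms] by blast
  have "conv f F"
    by (rule conv_cong[OF conv_refl[OF F(1)]]) (use F(2) in \<open>auto simp: eventually_sequentially\<close>)
  then show ?thesis using that F by metis
qed

lemma conv_opT: assumes "F \<in> Pas" "1 \<le> i" shows "conv (\<lambda>k. opT i (F k)) (limT i F)"
proof -
  obtain m where m: "\<And>n l. m \<le> l \<Longrightarrow> n \<le> l \<Longrightarrow> stab n l F" using Pas_stab[OF assms(1)] by blast
  define l where "l = max m (i + 1)"
  have "stab l l F" using m by (simp add: l_def)
  then have "stab l l (\<lambda>k. fold opT [i] (F k))"
    by (rule stab_fold_opT) (use assms in \<open>auto simp: l_def\<close>)
  then have s: "stab l l (\<lambda>k. opT i (F k))" by simp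
  obtain G where "conv (\<lambda>k. opT i (F k)) G" using conv_stab[OF s] by blast
  then show ?thesis using op_lim_eq[OF conv_has_lim] by (simp add: limT_def)
qed

lemma conv_opX: assumes "F \<in> Pas" "1 \<le> i" shows "conv (\<lambda>k. Var i * F k) (limX i F)"
proof -
  obtain m where m: "\<And>n l. m \<le> l \<Longrightarrow> n \<le> l \<Longrightarrow> stab n l F" using Pas_stab[OF assms(1)] by blast
  define l where "l = max m i"
  have "stab l l F" using m by (simp add: l_def)
  then have s: "stab l l (\<lambda>k. Var i * F k)"
    by (rule stab_Var) (use assms in \<open>auto simp: l_def\<close>)
  obtain G where "conv (\<lambda>k. Var i * F k) G" using conv_stab[OF s] by blast
  then show ?thesis using op_lim_eq[of "\<lambda>k. opX i" F G] conv_has_lim by (simp add: limX_def opX_def)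
qed

text \<open>The limits with and without the projection agree, because both versions have the same part of
  order zero in \<open>t^k\<close>. Therefore the limit operators inherit the relations of the version without
  projection.\<close>

lemma conv_opY: assumes "F \<in> Pas" "1 \<le> i"
  shows "conv (\<lambda>k. opY k i (F k)) (limY i F)" "conv (\<lambda>k. opYP (\<lambda>f. f) k i (F k)) (limY i F)"
proof -
  obtain m where m: "\<And>n l. m \<le> l \<Longrightarrow> n \<le> l \<Longrightarrow> stab n l F" using Pas_stab[OF assms(1)] by blast
  define l where "l = max m i"
  have l: "stab l l F" "i \<le> l" using m by (simp_all add: l_def)
  obtain A B where AB: "stab l l A" "stab l l (B (\<lambda>f. f))" "stab l l (B pr1)"
    "\<And>P k. l \<le> k \<Longrightarrow> P \<in> {\<lambda>f. f, pr1} \<Longrightarrow> opYP P k i (F k) = A k + Cst (tK ^ k) * B P k"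
    using opYP_stable[OF l(1) assms(2) l(2)] by blast
  obtain G where G: "conv A G" using conv_stab[OF AB(1)] by blast
  have conv: "conv (\<lambda>k. opYP P k i (F k)) G" if P: "P \<in> {\<lambda>f. f, pr1}" for P
  proof -
    have "stab l l (B P)" using AB P by blast
    then obtain E where "conv (B P) E" using conv_stab by blast
    then have "conv (\<lambda>k. Cst (tK ^ (k * 1)) * B P k) (\<lambda>k. 0)" by (rule conv_shift) simp
    from conv_add[OF G this] have "conv (\<lambda>k. A k + Cst (tK ^ k) * B P k) G" by simp
    then show ?thesis
      by (rule conv_cong) (use AB(4) P in \<open>auto simp: eventually_sequentially intro!: exI[of _ l]\<close>)
  qed
  have "(\<lambda>k. opYP pr1 k i (F k)) = (\<lambda>k. opY k i (F k))"
    using opY_eq[OF assms(2) Pas_Pk[OF assms(1)]] by auto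
  then have Y: "conv (\<lambda>k. opY k i (F k)) G" using conv[of pr1] by simp
  then have "limY i F = G" unfolding limY_def by (intro op_lim_eq conv_has_lim)
  then show "conv (\<lambda>k. opY k i (F k)) (limY i F)" "conv (\<lambda>k. opYP (\<lambda>f. f) k i (F k)) (limY i F)"
    using Y conv[of "\<lambda>f. f"] by simp_all
qed

lemma conv_opP: "F \<in> Pas \<Longrightarrow> g \<in> sdaha_gens \<Longrightarrow> conv (\<lambda>k. opP k g (F k)) (opL g F)"
  by (cases g) (simp_all add: opP_def opL_def conv_opT conv_opX conv_opY)

lemma free_action_opP: "free_action (\<lambda>c f. Cst c * f) UNIV UNIV (opP k)"
  by unfold_locales (simp_all add: Cst_hom algebra_simps opP_add opP_Cst flip: opP_Cst)

definition actP :: "nat \<Rightarrow> dgen falg \<Rightarrow> pol \<Rightarrow> pol" where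
  "actP k = free_action.act (\<lambda>c f. Cst c * f) (opP k)"

interpretation PA: free_action "\<lambda>c f. Cst c * f" UNIV UNIV "opP k"
  rewrites "free_action.act (\<lambda>c f. Cst c * f) (opP k) = actP k" for k
  by (rule free_action_opP) (simp add: actP_def)

lemma free_action_opL: "free_action (\<lambda>c F k. Cst c * F k) Pas sdaha_gens opL"
proof
  show "opL g F \<in> Pas" if "g \<in> sdaha_gens" "F \<in> Pas" for g F
    using conv_opP[OF that(2,1)] by (rule conv_Pas)
  show "opL g (F + G) = opL g F + opL g G" if g: "g \<in> sdaha_gens" and FG: "F \<in> Pas" "G \<in> Pas" for g F G
  proof (rule conv_unique)
    have "(F + G) \<in> Pas" using Pas_add[OF FG] by (simp add: plus_fun_def)
    then show "conv (\<lambda>k. opP k g ((F + G) k)) (opL g (F + G))" using g by (rule conv_opP)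
    show "conv (\<lambda>k. opP k g ((F + G) k)) (opL g F + opL g G)"
      using conv_add[OF conv_opP[OF FG(1) g] conv_opP[OF FG(2) g]] by (simp add: opP_add plus_fun_def)
  qed
  show "opL g (\<lambda>k. Cst c * F k) = (\<lambda>k. Cst c * opL g F k)" if g: "g \<in> sdaha_gens" and F: "F \<in> Pas" for g F c
  proof (rule conv_unique)
    show "conv (\<lambda>k. opP k g (Cst c * F k)) (opL g (\<lambda>k. Cst c * F k))"
      using conv_opP[OF Pas_Cst[OF F] g] .
    show "conv (\<lambda>k. opP k g (Cst c * F k)) (\<lambda>k. Cst c * opL g F k)"
      using conv_Cst[OF conv_opP[OF F g]] by (simp add: opP_Cst)
  qed
qed (use Pas_add Pas_Cst Pas_zero in \<open>simp_all add: Cst_hom algebra_simps plus_fun_def zero_fun_def\<close>)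

definition actL :: "dgen falg \<Rightarrow> (nat \<Rightarrow> pol) \<Rightarrow> nat \<Rightarrow> pol" where
  "actL = free_action.act (\<lambda>c F k. Cst c * F k) opL"

interpretation LA: free_action "\<lambda>c F k. Cst c * F k" Pas sdaha_gens opL
  rewrites "free_action.act (\<lambda>c F k. Cst c * F k) opL = actL"
  by (rule free_action_opL) (simp add: actL_def)

lemma conv_act: assumes "a \<in> words_in sdaha_gens" "F \<in> Pas" shows "conv (\<lambda>k. actP k a (F k)) (actL a F)"
  using assms(1)
proof (induction rule: words_in_induct)
  case zero
  then show ?case using conv_refl[OF Pas_zero] by (simp add: zero_fun_def)
next
  case (single c gs)
  then have "conv (\<lambda>k. foldr (opP k) gs (F k)) (foldr opL gs F)"
  proof (induction gs)
    case Nil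
    then show ?case using conv_refl[OF assms(2)] by simp
  next
    case (Cons g gs)
    then have gs: "conv (\<lambda>k. foldr (opP k) gs (F k)) (foldr opL gs F)" and g: "g \<in> sdaha_gens" by auto
    have "conv (\<lambda>k. opP k g (foldr (opP k) gs (F k))) (opL g (foldr opL gs F))"
      by (rule conv_op[OF opP_add opP_Cst conv_opP[OF _ g] gs])
    then show ?case by simp
  qed
  from conv_Cst[OF this, of c] show ?case by (simp only: PA.act_word LA.act_word)
next
  case (add a b)
  then show ?case using conv_add by (simp add: PA.act_add LA.act_add plus_fun_def)
qed

lemma pos_gens_simps [simp]:
  "GT i \<in> pos_gens k \<longleftrightarrow> 1 \<le> i \<and> i < k" "GX i \<in> pos_gens k \<longleftrightarrow> 1 \<le> i \<and> i \<le> k"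
  "GY i \<in> pos_gens k \<longleftrightarrow> 1 \<le> i \<and> i \<le> k" "GXi i \<notin> pos_gens k" "GYi i \<notin> pos_gens k"
  by (auto simp: pos_gens_def)

lemma opP_Pk:
  assumes "g \<in> pos_gens k" "f \<in> Pk k"
  shows "opP k g f \<in> Pk k" "emb (opP k g f) = opM k g (emb f)"
proof -
  obtain d where d: "f \<in> Pkd k d" using Pk_imp_Pkd assms by blast
  have "opYP (\<lambda>f. f) k i f \<in> Pk k" if "1 \<le> i" "i \<le> k" for i
  proof -
    have "fold TIP [i..<k] f \<in> Pkd k d" by (rule fold_TIP_Pkd[OF _ d]) (use that in auto)
    then have "omP k (fold TIP [i..<k] f) \<in> Pkd k d" using that by (intro omP_Pkd) auto
    then have "opYP (\<lambda>f. f) k i f \<in> Pkd k d"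
      unfolding opYP_def by (intro Pkd_Cst_mult fold_opT_Pkd) (use that in auto)
    then show ?thesis by (rule Pkd_imp_Pk)
  qed
  then show "opP k g f \<in> Pk k"
    using assms Pkd_imp_Pk[OF opT_Pkd[OF _ _ d]] Pk_mult[OF Pk_Var assms(2)]
    by (cases g) (simp_all add: opP_def)
  show "emb (opP k g f) = opM k g (emb f)"
    using assms by (cases g) (simp_all add: opP_def opM_def emb_opT emb_mult emb_opYP)
qed

lemma emb_actP: assumes "a \<in> words_in (pos_gens k)" "f \<in> Pk k" shows "emb (actP k a f) = actM k a (emb f)"
  using assms(1)
proof (induction rule: words_in_induct)
  case (single c gs)
  then have "foldr (opP k) gs f \<in> Pk k \<and> emb (foldr (opP k) gs f) = foldr (opM k) gs (emb f)"
    using assms(2) by (induction gs) (auto simp: opP_Pk)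
  then show ?case by (simp add: PA.act_word MA.act_word emb_mult)
qed (simp_all add: PA.act_add MA.act_add emb_add)

lemma pos_gens_mono: "k \<le> l \<Longrightarrow> pos_gens k \<subseteq> pos_gens l"
  by (auto simp: pos_gens_def)

lemma words_in_pos_gens:
  assumes "a \<in> words_in sdaha_gens" obtains K where "\<And>k. K \<le> k \<Longrightarrow> a \<in> words_in (pos_gens k)"
proof -
  have "\<exists>K. a \<in> words_in (pos_gens K)"
    using assms
  proof (induction rule: words_in_induct)
    case (single c gs)
    have "\<exists>K. set gs \<subseteq> pos_gens K" using single
    proof (induction gs)
      case (Cons g gs)
      then obtain K where K: "set gs \<subseteq> pos_gens K" by auto
      have "\<exists>L. g \<in> pos_gens L"
        using Cons.prems by (cases g) auto
      then obtain L where "g \<in> pos_gens L" by blast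
      then have "set (g # gs) \<subseteq> pos_gens (max K L)"
        using K pos_gens_mono[of K "max K L"] pos_gens_mono[of L "max K L"] by auto
      then show ?case by blast
    qed simp
    then obtain K where "set gs \<subseteq> pos_gens K" by blast
    then have "scal c * prod_list (map gen gs) \<in> words_in (pos_gens K)"
      by (intro words_in_mult words_in_prod_list) auto
    then show ?case by blast
  next
    case (add a b)
    then obtain K L where "a \<in> words_in (pos_gens K)" "b \<in> words_in (pos_gens L)" by blast
    then have "a + b \<in> words_in (pos_gens (max K L))"
      using pos_gens_mono[of K "max K L"] pos_gens_mono[of L "max K L"]
      by (intro words_in_add) (auto elim: words_in_mono)
    then show ?case by blast
  qed auto
  then show ?thesis using that pos_gens_mono words_in_mono by metis
qed

text \<open>The value of \<open>a\<close> at level \<open>k\<close> is zero as soon as \<open>a\<close> is a consequence of the relations of rank \<open>k\<close>.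
  This serves both for the relators of the limit algebra and for the theorem.\<close>

lemma actL_zero:
  assumes a: "a \<in> words_in sdaha_gens" and zero: "\<forall>\<^sub>F k in sequentially. a \<in> gl_ideal k" and F: "F \<in> Pas"
  shows "actL a F = (\<lambda>k. 0)"
proof (rule conv_unique)
  show "conv (\<lambda>k. actP k a (F k)) (actL a F)" by (rule conv_act[OF a F])
  obtain K where K: "\<And>k. K \<le> k \<Longrightarrow> a \<in> words_in (pos_gens k)" using words_in_pos_gens[OF a] by blast
  have "\<forall>\<^sub>F k in sequentially. 0 = actP k a (F k)"
    using zero eventually_ge_at_top[of "max K 1"]
  proof eventually_elim
    case (elim k)
    then have "emb (actP k a (F k)) = 0"
      using emb_actP[OF K Pas_Pk[OF F], of k] gl_ideal_act_zero[of k a] by simp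
    then show ?case by simp
  qed
  then show "conv (\<lambda>k. actP k a (F k)) (\<lambda>k. 0)" by (rule conv_cong[OF conv_refl[OF Pas_zero]])
qed

text \<open>A relator involves two indices at most.\<close>

lemma daha_relators_finite:
  assumes "r \<in> daha_relators {1..} {1..}" shows "\<exists>K. r \<in> daha_relators {1..<K} {1..K}"
proof -
  have "\<exists>i. \<exists>j. r \<in> daha_relators ({i, j, i + 1, 1} \<inter> {1..}) ({i, j, i + 1, 1} \<inter> {1..})"
    using assms
  proof (cases rule: daha_relators_cases)
    case (TT i j)
    show ?thesis unfolding TT(1) by (intro exI[of _ i] exI[of _ j] daha_relatorsI) (use TT in auto)
  next
    case (braid i)
    show ?thesis unfolding braid(1) by (intro exI[of _ i] exI[of _ i] daha_relatorsI) (use braid in auto)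
  next
    case (quad i)
    show ?thesis unfolding quad(1) by (intro exI[of _ i] exI[of _ i] daha_relatorsI) (use quad in auto)
  next
    case (X i)
    show ?thesis unfolding X(1) by (intro exI[of _ i] exI[of _ i] daha_relatorsI) (use X in auto)
  next
    case (TX i j)
    show ?thesis unfolding TX(1) by (intro exI[of _ i] exI[of _ j] daha_relatorsI) (use TX in auto)
  next
    case (XX i j)
    show ?thesis unfolding XX(1) by (intro exI[of _ i] exI[of _ j] daha_relatorsI) (use XX in auto)
  next
    case (Y i)
    show ?thesis unfolding Y(1) by (intro exI[of _ i] exI[of _ i] daha_relatorsI) (use Y in auto)
  next
    case (TY i j)
    show ?thesis unfolding TY(1) by (intro exI[of _ i] exI[of _ j] daha_relatorsI) (use TY in auto)
  next
    case (YY i j)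
    show ?thesis unfolding YY(1) by (intro exI[of _ i] exI[of _ j] daha_relatorsI) (use YY in auto)
  next
    case YTX
    show ?thesis unfolding YTX(1) by (intro exI[of _ 1] exI[of _ 1] daha_relatorsI) (use YTX in auto)
  qed
  then obtain i j where r: "r \<in> daha_relators ({i, j, i + 1, 1} \<inter> {1..}) ({i, j, i + 1, 1} \<inter> {1..})" by blast
  have "daha_relators ({i, j, i + 1, 1} \<inter> {1..}) ({i, j, i + 1, 1} \<inter> {1..})
      \<subseteq> daha_relators {1..<i + j + 3} {1..i + j + 3}"
    by (rule daha_relators_mono) auto
  then show ?thesis using r by blast
qed

lemma sdaha_relators_vanish:
  assumes "r \<in> sdaha_relators" shows "\<forall>\<^sub>F k in sequentially. r \<in> gl_ideal k"
proof -
  obtain K where K: "r \<in> daha_relators {1..<K} {1..K}"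
    using daha_relators_finite assms unfolding sdaha_relators_def by blast
  have "r \<in> gl_ideal k" if "max K 1 \<le> k" for k
  proof -
    have "r \<in> daha_relators {1..<k} {1..k}"
      using K daha_relators_mono[of "{1..<K}" "{1..<k}" "{1..K}" "{1..k}"] that by auto
    then have "r \<in> gl_relators k" by (simp add: gl_relators_def)
    then show ?thesis using that by (intro rel_ideal_relator[OF gl_relators_words]) auto
  qed
  then show ?thesis unfolding eventually_sequentially by blast
qed

abbreviation sd_ideal :: "dgen falg set" where
  "sd_ideal \<equiv> rel_ideal sdaha_gens sdaha_relators"

lemma sd_ideal_acts_zero: assumes "a \<in> sd_ideal" "F \<in> Pas" shows "actL a F = (\<lambda>k. 0)"
proof -
  have "actL a F = 0"
  proof (rule LA.rel_ideal_acts_zero[OF sdaha_relators_words _ assms])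
    fix r G assume r: "r \<in> sdaha_relators" and G: "G \<in> Pas"
    then have "r \<in> words_in sdaha_gens" using sdaha_relators_words by blast
    then show "actL r G = 0"
      using actL_zero[OF _ sdaha_relators_vanish[OF r] G] by (simp add: zero_fun_def)
  qed
  then show ?thesis by (simp add: zero_fun_def)
qed

subsection \<open>From the limit back to finite rank\<close>

lemma opT_eP: "1 \<le> i \<Longrightarrow> i \<noteq> r \<Longrightarrow> opT i (eP r * f) = eP r * opT i f"
  unfolding to_ratfun emb_eP by (rule TM_mult) (simp add: sM_eM)

lemma opP_eP:
  assumes g: "g \<in> pos_gens r" and f: "stab r l f"
  obtains f' where "stab r l f'" "\<And>k. r \<le> k \<Longrightarrow> opP k g (eP r * f k) = eP r * f' k"
proof (cases g)
  case (GT i)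
  have "stab r l (\<lambda>k. fold opT [i] (f k))" by (rule stab_fold_opT[OF f]) (use g GT in auto)
  moreover have "opP k g (eP r * f k) = eP r * fold opT [i] (f k)" for k
    using g GT opT_eP[of i r "f k"] by (simp add: opP_def)
  ultimately show ?thesis using that by blast
next
  case (GX i)
  have "stab r l (\<lambda>k. Var i * f k)" by (rule stab_Var[OF f]) (use g GX in auto)
  moreover have "opP k g (eP r * f k) = eP r * (Var i * f k)" for k
    using GX by (simp add: opP_def mult.left_commute)
  ultimately show ?thesis using that by blast
next
  case (GY i)
  then have i: "1 \<le> i" "i \<le> r" using g by auto
  let ?f = "\<lambda>k. Cst (tK ^ (r + 1 - i) * qK) *
      fold opT [1..<i] (omP k (fold opT [r..<k] (fold TIP [i..<r] (f k))))"
  have "stab r l ?f"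
    by (intro stab_Cst stab_fold_opT stab_shift stab_fold_TIP f) (use i in auto)
  moreover have "opP k g (eP r * f k) = eP r * ?f k" if "r \<le> k" for k
    using opYP_eP[OF i that stab_Pk[OF f that]] GY by (simp add: opP_def)
  ultimately show ?thesis using that by blast
qed (use g in auto)

lemma actP_eP:
  assumes "a \<in> words_in (pos_gens r)" "stab r l f"
  shows "\<exists>f'. stab r l f' \<and> (\<forall>k\<ge>r. actP k a (eP r * f k) = eP r * f' k)"
  using assms(1)
proof (induction rule: words_in_induct)
  case zero
  have "stab r l (\<lambda>k. Cst 0 * f k)" by (rule stab_Cst[OF assms(2)])
  then show ?case by (intro exI[of _ "\<lambda>k. 0"]) simp
next
  case (single c gs)
  have "\<exists>f'. stab r l f' \<and> (\<forall>k\<ge>r. foldr (opP k) gs (eP r * f k) = eP r * f' k)"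
    using single
  proof (induction gs)
    case (Cons g gs)
    then obtain f' where f': "stab r l f'" "\<forall>k\<ge>r. foldr (opP k) gs (eP r * f k) = eP r * f' k" by auto
    obtain f'' where "stab r l f''" "\<And>k. r \<le> k \<Longrightarrow> opP k g (eP r * f' k) = eP r * f'' k"
      using opP_eP[OF _ f'(1), of g] Cons.prems by auto
    then show ?case using f'(2) by (intro exI[of _ f'']) auto
  qed (use assms(2) in auto)
  then obtain f' where f': "stab r l f'" "\<forall>k\<ge>r. foldr (opP k) gs (eP r * f k) = eP r * f' k" by blast
  then show ?case
    using stab_Cst[OF f'(1), of c]
    by (intro exI[of _ "\<lambda>k. Cst c * f' k"]) (simp only: PA.act_word, simp add: mult.left_commute)
next
  case (add a b)
  then obtain f' f'' where "stab r l f'" "\<forall>k\<ge>r. actP k a (eP r * f k) = eP r * f' k"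
    "stab r l f''" "\<forall>k\<ge>r. actP k b (eP r * f k) = eP r * f'' k" by blast
  then show ?case
    using stab_add[of r l f' f''] by (intro exI[of _ "\<lambda>k. f' k + f'' k"]) (simp add: PA.act_add distrib_left)
qed

lemma stab_eP: assumes "stab r l f" shows "stab r l (\<lambda>k. eP r * f k)"
proof -
  have "stab r l (\<lambda>k. eP s * f k)" if "s \<le> r" for s
    using that
  proof (induction s)
    case (Suc s)
    have "stab r l (\<lambda>k. Var (Suc s) * (eP s * f k))" using Suc by (intro stab_Var) auto
    then show ?case by (simp add: eP_def mult.left_commute mult.commute)
  qed (use assms in \<open>simp add: eP_def\<close>)
  then show ?thesis by blast
qed

text \<open>If the limit operator vanishes, then so does its value on \<open>x_1 \<dots> x_r F\<close>, which at every level \<open>k \<ge> r\<close>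
  is the value of the operator of rank \<open>k\<close>. Therefore \<open>a X_1 \<dots> X_r\<close> annihilates all polynomials in rank
  \<open>k\<close>; it vanishes by faithfulness, and \<open>X_1 \<dots> X_r\<close> is invertible.\<close>

lemma actL_zero_imp_ideal:
  assumes r: "2 \<le> r" and a: "a \<in> words_in (pos_gens r)"
    and vanish: "\<And>F. F \<in> Pas \<Longrightarrow> actL a F = (\<lambda>k. 0)" and rk: "r \<le> k"
  shows "a \<in> gl_ideal k"
proof -
  interpret gl_daha k by standard (use r rk in simp)
  have pos: "pos_gens n \<subseteq> sdaha_gens" for n by (auto simp: pos_gens_def)
  have pd: "pos_gens k \<subseteq> daha_gens k" by (auto simp: pos_gens_def)
  have asd: "a \<in> words_in sdaha_gens" using a pos by (rule words_in_mono)
  have ak: "a \<in> words_in (pos_gens k)" using a pos_gens_mono[OF rk] by (rule words_in_mono)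
  have act0: "actP k a (eP r * f) = 0" if f: "f \<in> Pk k" for f
  proof -
    obtain d where "f \<in> Pkd k d" using Pk_imp_Pkd[OF f] by blast
    then have "f \<in> Pkd j d" "proj (Suc j) f = f" "i > k \<Longrightarrow> swap_pol i f = f" if "k \<le> j" for j i
    proof -
      show "f \<in> Pkd j d" using \<open>f \<in> Pkd k d\<close> that by (rule Pkd_mono) simp
      show "proj (Suc j) f = f" unfolding proj_def by (rule subst_pol_id[OF f]) (use that in auto)
      show "swap_pol i f = f" if "i > k" unfolding swap_pol_def by (rule subst_pol_id[OF f]) (use that in auto)
    qed
    then have "stab k k (\<lambda>_. f)"
      unfolding stab_def by (metis One_nat_def Suc_pred less_Suc_eq_le less_imp_Suc_add order_refl zero_less_Suc)
    then obtain F where F: "F \<in> Pas" "F k = f" using stab_extend by (metis order_refl)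
    obtain m where "\<And>n l. m \<le> l \<Longrightarrow> n \<le> l \<Longrightarrow> stab n l F" using Pas_stab[OF F(1)] by blast
    then have st: "stab r (max m r) F" by simp
    obtain f' where f': "stab r (max m r) f'" "\<And>j. r \<le> j \<Longrightarrow> actP j a (eP r * F j) = eP r * f' j"
      using actP_eP[OF a st] by blast
    obtain H where H: "H \<in> Pas" "\<And>j. r \<le> j \<Longrightarrow> H j = eP r * F j"
      using stab_extend[OF stab_eP[OF st]] by blast
    obtain E where E: "E \<in> Pas" "\<And>j. r \<le> j \<Longrightarrow> E j = eP r * f' j"
      using stab_extend[OF stab_eP[OF f'(1)]] by blast
    have "conv (\<lambda>j. actP j a (H j)) (\<lambda>j. 0)" using conv_act[OF asd H(1)] vanish[OF H(1)] by simp
    moreover have "conv (\<lambda>j. actP j a (H j)) E"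
      by (rule conv_cong[OF conv_refl[OF E(1)]]) (use H E f' in \<open>auto simp: eventually_sequentially intro!: exI[of _ r]\<close>)
    ultimately have "E = (\<lambda>j. 0)" by (rule conv_unique[symmetric])
    then have "eP r * f' k = 0" using E(2)[OF rk] by metis
    then show ?thesis using f'(2)[OF rk] F(2) by simp
  qed
  have X: "Xprod r \<in> words_in (pos_gens k)" by (rule Xprod_words) (use rk in auto)
  have "a * Xprod r \<in> gl_ideal k"
  proof (rule actM_faithful)
    show "a * Xprod r \<in> words_in (pos_gens k)" using ak X by (rule words_in_mult)
    fix f assume f: "f \<in> Pk k"
    have "eP r \<in> Pk k" unfolding eP_def
      using rk by (induction r) (auto simp: intro!: Pk_mult Pk_Var)
    then have "emb (actP k a (eP r * f)) = actM k a (emb (eP r * f))"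
      by (intro emb_actP ak Pk_mult f)
    then show "actM k (a * Xprod r) (emb f) = 0"
      using act0[OF f] rk by (simp add: actM_mult actM_Xprod emb_mult emb_eP)
  qed
  then have "a * Xprod r \<in> relS k"
    using relS_iff[OF words_in_mono[OF words_in_mult[OF ak X] pd]] by simp
  then have "a * Xw [1..<Suc r] \<asymp> 0" by (simp only: cg_def Xprod_Xw diff_zero)
  moreover have "a * Xw b \<asymp> 0 \<Longrightarrow> set b \<subseteq> {1..k} \<Longrightarrow> a \<asymp> 0" for b
  proof (induction b rule: rev_induct)
    case (snoc i b)
    have i: "1 \<le> i" "i \<le> k" using snoc.prems by auto
    have "a * Xw b \<asymp> a * Xw b * (XX i * XI i)"
      using cg_left[OF cg_sym[OF X_XI(1)[OF i]], of "a * Xw b"] by simp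
    also have "\<dots> = a * Xw (b @ [i]) * XI i" by (simp add: mult.assoc)
    also have "\<dots> \<asymp> 0 * XI i" by (rule cg_right[OF snoc.prems(1)])
    finally show ?case using snoc by simp
  qed simp
  moreover have "set [1..<Suc r] \<subseteq> {1..k}" using rk by auto
  ultimately have "a \<asymp> 0" by blast
  then have "a \<in> relS k" by (simp add: cg_def)
  then show ?thesis using relS_iff[OF words_in_mono[OF ak pd]] by simp
qed

subsection \<open>Existence and uniqueness of the standard representation\<close>

lemma End_as_simps:
  "carrier End_as = {A \<in> Pas \<rightarrow>\<^sub>E Pas. linear_as A}" "mult End_as = (\<lambda>A B. compose Pas A B)"
  "one End_as = (\<lambda>F\<in>Pas. F)" "zero End_as = (\<lambda>F\<in>Pas. (\<lambda>k. 0))"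
  "add End_as = (\<lambda>A B. \<lambda>F\<in>Pas. (\<lambda>k. A F k + B F k))"
  by (simp_all add: End_as_def)

lemma sdaha_presented: "sdaha = presented_alg sdaha_gens sdaha_relators"
  by (simp add: sdaha_def)

lemmas sd_words = sdaha_relators_words

lemma restrict_actL_End: assumes "a \<in> words_in sdaha_gens" shows "restrict (actL a) Pas \<in> carrier End_as"
  using LA.act_closed[OF assms] LA.act_add_right[OF assms] LA.act_sc[OF assms] Pas_add Pas_Cst
  by (auto simp: End_as_simps linear_as_def plus_fun_def)

lemma actL_scal: "actL (scal c) = (\<lambda>F k. Cst c * F k)"
  by (intro ext) (simp add: LA.act_scal)

lemma std_rep_unique:
  assumes \<rho>: "is_std_rep \<rho>" and a: "a \<in> words_in sdaha_gens"
  shows "\<rho> (sdaha_class a) = restrict (actL a) Pas"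
proof -
  have hom: "\<rho> \<in> ring_hom sdaha End_as" using \<rho> by (simp add: is_std_rep_def)
  have scal: "\<rho> (sdaha_class (scal c)) = restrict (actL (scal c)) Pas" for c
    using \<rho> by (simp add: is_std_rep_def actL_scal)
  have mult: "\<rho> (sdaha_class (a * b)) = restrict (actL (a * b)) Pas"
    if "a \<in> words_in sdaha_gens" "b \<in> words_in sdaha_gens"
      "\<rho> (sdaha_class a) = restrict (actL a) Pas" "\<rho> (sdaha_class b) = restrict (actL b) Pas" for a b
  proof -
    have "\<rho> (sdaha_class (a * b)) = compose Pas (\<rho> (sdaha_class a)) (\<rho> (sdaha_class b))"
      unfolding pres_class_mult[OF sd_words that(1,2)]
      using ring_hom_mult[OF hom] pres_class_carrier[OF sd_words] that(1,2)
      by (simp add: sdaha_presented End_as_simps)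
    also have "\<dots> = restrict (actL (a * b)) Pas"
      unfolding that(3,4) by (rule ext)
        (simp add: compose_def LA.act_closed[OF that(2)] LA.act_mult[OF that(1,2)])
    finally show ?thesis .
  qed
  have gen: "\<rho> (sdaha_class (gen g)) = restrict (actL (gen g)) Pas" if "g \<in> sdaha_gens" for g
  proof -
    have "restrict (actL (gen g)) Pas = restrict (opL g) Pas" using LA.act_gen by (auto simp: fun_eq_iff)
    then show ?thesis using \<rho> that by (cases g) (simp_all add: is_std_rep_def opL_def)
  qed
  show ?thesis using a
  proof (induction rule: words_in_induct)
    case zero
    then show ?case using scal[of 0] by (simp only: scal_zero)
  next
    case (single c gs)
    then have "\<rho> (sdaha_class (prod_list (map gen gs))) = restrict (actL (prod_list (map gen gs))) Pas
        \<and> prod_list (map gen gs) \<in> words_in sdaha_gens"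
    proof (induction gs)
      case Nil
      show ?case using scal[of 1] by (simp only: scal_one list.map prod_list.Nil words_in_one)
    next
      case (Cons g gs)
      have g: "g \<in> sdaha_gens" and "set gs \<subseteq> sdaha_gens" using Cons.prems by simp_all
      note IH = Cons.IH[OF this(2)]
      note gs = conjunct2[OF IH] conjunct1[OF IH]
      have "gen g \<in> words_in sdaha_gens" using g by simp
      with mult[OF this gs(1) gen[OF g] gs(2)] gs(1) show ?case
        by (simp only: list.map prod_list.Cons words_in_mult)
    qed
    then show ?case by (intro mult scal words_in_scal) auto
  next
    case (add a b)
    have "\<rho> (sdaha_class (a + b)) = (\<lambda>F\<in>Pas. (\<lambda>k. \<rho> (sdaha_class a) F k + \<rho> (sdaha_class b) F k))"
      unfolding pres_class_add[OF sd_words add(3,4)]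
      using ring_hom_add[OF hom] pres_class_carrier[OF sd_words] add(3,4)
      by (simp add: sdaha_presented End_as_simps)
    then show ?case using add by (auto simp: LA.act_add plus_fun_def fun_eq_iff)
  qed
qed

definition std_op :: "dgen falg set \<Rightarrow> (nat \<Rightarrow> pol) \<Rightarrow> nat \<Rightarrow> pol" where
  "std_op = (\<lambda>C\<in>carrier sdaha. restrict (actL (SOME a. a \<in> words_in sdaha_gens \<and> C = sdaha_class a)) Pas)"

lemma std_op_class: assumes a: "a \<in> words_in sdaha_gens" shows "std_op (sdaha_class a) = restrict (actL a) Pas"
proof -
  define b where "b = (SOME b. b \<in> words_in sdaha_gens \<and> sdaha_class a = sdaha_class b)"
  have b: "b \<in> words_in sdaha_gens \<and> sdaha_class a = sdaha_class b"
    unfolding b_def by (rule someI[of _ a]) (use a in simp)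
  then have "a - b \<in> sd_ideal" using pres_class_eq_iff[OF sd_words a] by blast
  then have "actL a F = actL b F" if "F \<in> Pas" for F
    using sd_ideal_acts_zero[OF _ that, of "a - b"] LA.act_diff[of a b F]
    by (simp flip: zero_fun_def)
  then have "restrict (actL b) Pas = restrict (actL a) Pas" by (auto simp: fun_eq_iff)
  then show ?thesis
    using pres_class_carrier[OF sd_words a] by (simp add: std_op_def sdaha_presented b_def)
qed

lemma is_std_rep_std_op: "is_std_rep std_op"
  unfolding is_std_rep_def
proof (intro conjI allI impI)
  show "std_op \<in> extensional (carrier sdaha)" by (simp add: std_op_def)
  have surj: "\<exists>a\<in>words_in sdaha_gens. C = sdaha_class a" if "C \<in> carrier sdaha" for C
    using pres_class_surj[OF sd_words] that unfolding sdaha_presented by metis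
  show "std_op \<in> ring_hom sdaha End_as"
  proof (rule ring_hom_memI)
    fix C assume "C \<in> carrier sdaha"
    then show "std_op C \<in> carrier End_as" using surj restrict_actL_End std_op_class by metis
  next
    fix C D assume "C \<in> carrier sdaha" "D \<in> carrier sdaha"
    then obtain a b where ab: "a \<in> words_in sdaha_gens" "C = sdaha_class a"
      "b \<in> words_in sdaha_gens" "D = sdaha_class b" using surj by metis
    have "std_op (C \<otimes>\<^bsub>sdaha\<^esub> D) = restrict (actL (a * b)) Pas"
      using std_op_class[OF words_in_mult[OF ab(1,3)]] pres_class_mult[OF sd_words ab(1,3)]
      by (simp add: ab sdaha_presented)
    then show "std_op (C \<otimes>\<^bsub>sdaha\<^esub> D) = std_op C \<otimes>\<^bsub>End_as\<^esub> std_op D"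
      using LA.act_mult[OF ab(1,3)] LA.act_closed[OF ab(3)]
      by (auto simp: ab std_op_class End_as_simps compose_def fun_eq_iff)
    have "std_op (C \<oplus>\<^bsub>sdaha\<^esub> D) = restrict (actL (a + b)) Pas"
      using std_op_class[OF words_in_add[OF ab(1,3)]] pres_class_add[OF sd_words ab(1,3)]
      by (simp add: ab sdaha_presented)
    then show "std_op (C \<oplus>\<^bsub>sdaha\<^esub> D) = std_op C \<oplus>\<^bsub>End_as\<^esub> std_op D"
      by (auto simp: ab std_op_class End_as_simps LA.act_add fun_eq_iff)
  next
    show "std_op \<one>\<^bsub>sdaha\<^esub> = \<one>\<^bsub>End_as\<^esub>"
      using std_op_class[of 1] pres_class_one[OF sd_words]
      by (auto simp: sdaha_presented End_as_simps fun_eq_iff)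
  qed
  show "std_op (sdaha_class (scal c)) = (\<lambda>F\<in>Pas. (\<lambda>k. Cst c * F k))" for c
    by (simp add: std_op_class actL_scal)
  show "std_op (sdaha_class (TT i)) = restrict (limT i) Pas"
    "std_op (sdaha_class (XX i)) = restrict (limX i) Pas"
    "std_op (sdaha_class (YY i)) = restrict (limY i) Pas" if "1 \<le> i" for i
    using that LA.act_gen by (auto simp: std_op_class opL_def fun_eq_iff)
qed

lemma std_rep_class:
  assumes "a \<in> words_in sdaha_gens" "F \<in> Pas" shows "std_rep (sdaha_class a) F = actL a F"
proof -
  have "std_rep = std_op"
    unfolding std_rep_def
  proof (rule the_equality)
    show "is_std_rep std_op" by (rule is_std_rep_std_op)
    fix \<rho> assume \<rho>: "is_std_rep \<rho>"
    show "\<rho> = std_op"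
    proof (rule extensionalityI[of _ "carrier sdaha"])
      fix C assume "C \<in> carrier sdaha"
      then obtain a where "a \<in> words_in sdaha_gens" "C = sdaha_class a"
        using pres_class_surj[OF sd_words] unfolding sdaha_presented by metis
      then show "\<rho> C = std_op C" using std_rep_unique[OF \<rho>] std_op_class by simp
    qed (use \<rho> in \<open>simp_all add: is_std_rep_def std_op_def\<close>)
  qed
  then show ?thesis using assms by (simp add: std_op_class)
qed

section \<open>The canonical morphisms\<close>

lemma daha_presented: "daha k = presented_alg (daha_gens k) (gl_relators k)"
  by (simp add: daha_def)

lemma generate_ring_classes:
  assumes R: "R \<subseteq> words_in G" and G': "G' \<subseteq> G"
  shows "generate_ring (presented_alg G R) (pres_class G R ` (range scal \<union> gen ` G'))
    = pres_class G R ` words_in G'" (is "?A = ?B")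
proof
  have sub: "a \<in> words_in G" if "a \<in> words_in G'" for a using that G' by (rule words_in_mono)
  show "?A \<subseteq> ?B"
  proof
    fix x assume "x \<in> ?A"
    then show "x \<in> ?B"
    proof induction
      case one
      then show ?case using pres_class_one[OF R] by (metis words_in_one image_eqI)
    next
      case (incl h)
      then show ?case by (force intro: words_in_scal)
    next
      case (a_inv h)
      then obtain a where "a \<in> words_in G'" "h = pres_class G R a" by blast
      then show ?case using pres_class_uminus[OF R sub] words_in_uminus by (metis image_eqI)
    next
      case (eng_add h1 h2)
      then obtain a b where "a \<in> words_in G'" "h1 = pres_class G R a" "b \<in> words_in G'" "h2 = pres_class G R b"
        by blast
      then show ?case using pres_class_add[OF R sub sub] words_in_add by (metis image_eqI)
    next
      case (eng_mult h1 h2)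
      then obtain a b where "a \<in> words_in G'" "h1 = pres_class G R a" "b \<in> words_in G'" "h2 = pres_class G R b"
        by blast
      then show ?case using pres_class_mult[OF R sub sub] words_in_mult by (metis image_eqI)
    qed
  qed
  have scal: "pres_class G R (scal c) \<in> ?A" for c by (rule generate_ring.incl) blast
  have "pres_class G R a \<in> ?A" if "a \<in> words_in G'" for a
    using that
  proof (induction rule: words_in_induct)
    case zero
    then show ?case using scal[of 0] by simp
  next
    case (single c gs)
    have "pres_class G R (prod_list (map gen gs)) \<in> ?A \<and> prod_list (map gen gs) \<in> words_in G'"
      using single
    proof (induction gs)
      case Nil
      then show ?case using scal[of 1] by simp
    next
      case (Cons g gs)
      have "pres_class G R (gen g) \<in> ?A" using Cons.prems by (intro generate_ring.incl) auto
      then show ?case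
        using Cons pres_class_mult[OF R sub sub, of "gen g" "prod_list (map gen gs)"]
        by (auto intro: generate_ring.eng_mult words_in_mult)
    qed
    then show ?case
      using pres_class_mult[OF R sub sub, of "scal c" "prod_list (map gen gs)"] scal[of c]
      by (auto intro: generate_ring.eng_mult)
  next
    case (add a b)
    then show ?case using pres_class_add[OF R sub sub] by (auto intro: generate_ring.eng_add)
  qed
  then show "?B \<subseteq> ?A" by blast
qed

lemma gen_pos_gens: "range scal \<union> TT ` {1..<k} \<union> XX ` {1..k} \<union> YY ` {1..k} = range scal \<union> gen ` pos_gens k"
  unfolding pos_gens_def by (auto simp: image_image)

lemma pos_gens_sdaha: "pos_gens k \<subseteq> sdaha_gens" and pos_gens_daha: "pos_gens k \<subseteq> daha_gens k"
  by (auto simp: pos_gens_def)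

lemma sdaha_sub_classes: "sdaha_sub k = sdaha_class ` words_in (pos_gens k)"
  unfolding sdaha_sub_def gen_pos_gens sdaha_presented
  by (rule generate_ring_classes[OF sd_words pos_gens_sdaha])

lemma daha_plus_classes: "1 \<le> k \<Longrightarrow> daha_plus k = daha_class k ` words_in (pos_gens k)"
  unfolding daha_plus_def gen_pos_gens daha_presented
  by (rule generate_ring_classes[OF gl_relators_words pos_gens_daha])

text \<open>A relation between elements of rank \<open>k\<close> in the limit algebra may be derived with generators of
  higher index, so it is not obvious that it holds in rank \<open>k\<close>. The standard representation shows it: the
  difference acts by zero, hence vanishes already in rank \<open>k\<close>.\<close>

lemma sdaha_class_eq_imp:
  assumes k: "2 \<le> k" and a: "a \<in> words_in (pos_gens k)" and b: "b \<in> words_in (pos_gens k)"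
    and eq: "sdaha_class a = sdaha_class b"
  shows "daha_class k a = daha_class k b"
proof -
  have "a - b \<in> sd_ideal"
    using eq pres_class_eq_iff[OF sd_words] a b words_in_mono[OF _ pos_gens_sdaha] by blast
  then have "a - b \<in> gl_ideal k"
    using sd_ideal_acts_zero by (intro actL_zero_imp_ideal[OF k words_in_diff[OF a b]]) auto
  then show ?thesis
    using pres_class_eq_iff[OF gl_relators_words] k a b words_in_mono[OF _ pos_gens_daha] by simp
qed

definition phi_map :: "nat \<Rightarrow> dgen falg set \<Rightarrow> dgen falg set" where
  "phi_map k = (\<lambda>C\<in>sdaha_sub k. daha_class k (SOME a. a \<in> words_in (pos_gens k) \<and> C = sdaha_class a))"

lemma phi_map_class:
  assumes k: "2 \<le> k" and a: "a \<in> words_in (pos_gens k)"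
  shows "phi_map k (sdaha_class a) = daha_class k a"
proof -
  define b where "b = (SOME b. b \<in> words_in (pos_gens k) \<and> sdaha_class a = sdaha_class b)"
  have "b \<in> words_in (pos_gens k) \<and> sdaha_class a = sdaha_class b"
    unfolding b_def by (rule someI[of _ a]) (use a in simp)
  then have "daha_class k b = daha_class k a" using sdaha_class_eq_imp[OF k] a by metis
  then show ?thesis using a by (simp add: phi_map_def sdaha_sub_classes b_def)
qed

lemma canonical_morphism_phi_map: assumes k: "2 \<le> k" shows "canonical_morphism k (phi_map k)"
  unfolding canonical_morphism_def
proof (intro conjI allI ballI)
  note gl_words = gl_relators_words[of k]
  have k1: "1 \<le> k" using k by simp
  note w = words_in_mono[OF _ pos_gens_sdaha[of k]] words_in_mono[OF _ pos_gens_daha[of k]]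
  show "phi_map k \<in> extensional (sdaha_sub k)" by (simp add: phi_map_def)
  show "phi_map k \<in> ring_hom (sdaha\<lparr>carrier := sdaha_sub k\<rparr>) ((daha k)\<lparr>carrier := daha_plus k\<rparr>)"
  proof (rule ring_hom_memI)
    fix C assume "C \<in> carrier (sdaha\<lparr>carrier := sdaha_sub k\<rparr>)"
    then show "phi_map k C \<in> carrier ((daha k)\<lparr>carrier := daha_plus k\<rparr>)"
      using phi_map_class[OF k] by (auto simp: sdaha_sub_classes daha_plus_classes[OF k1])
  next
    fix C D assume "C \<in> carrier (sdaha\<lparr>carrier := sdaha_sub k\<rparr>)" "D \<in> carrier (sdaha\<lparr>carrier := sdaha_sub k\<rparr>)"
    then obtain a b where ab: "a \<in> words_in (pos_gens k)" "C = sdaha_class a"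
      "b \<in> words_in (pos_gens k)" "D = sdaha_class b" by (auto simp: sdaha_sub_classes)
    have "phi_map k (C \<otimes>\<^bsub>sdaha\<^esub> D) = daha_class k (a * b)"
      using phi_map_class[OF k words_in_mult[OF ab(1,3)]] pres_class_mult[OF sd_words w(1)[OF ab(1)] w(1)[OF ab(3)]]
      by (simp add: ab sdaha_presented)
    also have "\<dots> = phi_map k C \<otimes>\<^bsub>daha k\<^esub> phi_map k D"
      using pres_class_mult[OF gl_words w(2)[OF ab(1)] w(2)[OF ab(3)]] k1
      by (simp add: ab phi_map_class[OF k] daha_presented)
    finally show "phi_map k (C \<otimes>\<^bsub>sdaha\<lparr>carrier := sdaha_sub k\<rparr>\<^esub> D)
        = phi_map k C \<otimes>\<^bsub>(daha k)\<lparr>carrier := daha_plus k\<rparr>\<^esub> phi_map k D" by simp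
    have "phi_map k (C \<oplus>\<^bsub>sdaha\<^esub> D) = daha_class k (a + b)"
      using phi_map_class[OF k words_in_add[OF ab(1,3)]] pres_class_add[OF sd_words w(1)[OF ab(1)] w(1)[OF ab(3)]]
      by (simp add: ab sdaha_presented)
    also have "\<dots> = phi_map k C \<oplus>\<^bsub>daha k\<^esub> phi_map k D"
      using pres_class_add[OF gl_words w(2)[OF ab(1)] w(2)[OF ab(3)]] k1
      by (simp add: ab phi_map_class[OF k] daha_presented)
    finally show "phi_map k (C \<oplus>\<^bsub>sdaha\<lparr>carrier := sdaha_sub k\<rparr>\<^esub> D)
        = phi_map k C \<oplus>\<^bsub>(daha k)\<lparr>carrier := daha_plus k\<rparr>\<^esub> phi_map k D" by simp
  next
    show "phi_map k \<one>\<^bsub>sdaha\<lparr>carrier := sdaha_sub k\<rparr>\<^esub> = \<one>\<^bsub>(daha k)\<lparr>carrier := daha_plus k\<rparr>\<^esub>"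
      using phi_map_class[OF k, of 1] pres_class_one[OF sd_words] pres_class_one[OF gl_words] k1
      by (simp add: sdaha_presented daha_presented)
  qed
qed (use k in \<open>simp_all add: phi_map_class\<close>)

lemma canonical_morphism_unique:
  assumes k: "2 \<le> k" and \<phi>: "canonical_morphism k \<phi>" and a: "a \<in> words_in (pos_gens k)"
  shows "\<phi> (sdaha_class a) = daha_class k a"
proof -
  have k1: "1 \<le> k" using k by simp
  note gl_words = gl_relators_words[OF k1]
  note w = words_in_mono[OF _ pos_gens_sdaha[of k]] words_in_mono[OF _ pos_gens_daha[of k]]
  have hom: "\<phi> \<in> ring_hom (sdaha\<lparr>carrier := sdaha_sub k\<rparr>) ((daha k)\<lparr>carrier := daha_plus k\<rparr>)"
    using \<phi> by (simp add: canonical_morphism_def)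
  have scal: "\<phi> (sdaha_class (scal c)) = daha_class k (scal c)" for c
    using \<phi> by (simp add: canonical_morphism_def)
  have mem: "sdaha_class a \<in> sdaha_sub k" if "a \<in> words_in (pos_gens k)" for a
    using that by (simp add: sdaha_sub_classes)
  have mult: "\<phi> (sdaha_class (a * b)) = daha_class k (a * b)"
    if "a \<in> words_in (pos_gens k)" "b \<in> words_in (pos_gens k)"
      "\<phi> (sdaha_class a) = daha_class k a" "\<phi> (sdaha_class b) = daha_class k b" for a b
    using ring_hom_mult[OF hom, of "sdaha_class a" "sdaha_class b"] mem that
      pres_class_mult[OF sd_words w(1)[OF that(1)] w(1)[OF that(2)]]
      pres_class_mult[OF gl_words w(2)[OF that(1)] w(2)[OF that(2)]]
    by (simp add: sdaha_presented daha_presented)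
  have gen: "\<phi> (sdaha_class (gen g)) = daha_class k (gen g)" if "g \<in> pos_gens k" for g
    using \<phi> that by (cases g) (simp_all add: canonical_morphism_def)
  show ?thesis using a
  proof (induction rule: words_in_induct)
    case zero
    then show ?case using scal[of 0] by simp
  next
    case (single c gs)
    then have "\<phi> (sdaha_class (prod_list (map gen gs))) = daha_class k (prod_list (map gen gs))
        \<and> prod_list (map gen gs) \<in> words_in (pos_gens k)"
    proof (induction gs)
      case Nil
      then show ?case using scal[of 1] by simp
    next
      case (Cons g gs)
      then show ?case using mult[of "gen g" "prod_list (map gen gs)"] gen by (auto intro: words_in_mult)
    qed
    then show ?case using mult[OF _ _ scal] by simp
  next
    case (add a b)
    then show ?case
      using ring_hom_add[OF hom, of "sdaha_class a" "sdaha_class b"] mem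
        pres_class_add[OF sd_words w(1)[OF add(3)] w(1)[OF add(4)]]
        pres_class_add[OF gl_words w(2)[OF add(3)] w(2)[OF add(4)]]
      by (simp add: sdaha_presented daha_presented)
  qed
qed

lemma phi_class:
  assumes k: "2 \<le> k" and a: "a \<in> words_in (pos_gens k)" shows "phi k (sdaha_class a) = daha_class k a"
proof -
  have "phi k = phi_map k"
    unfolding phi_def
  proof (rule the_equality)
    show "canonical_morphism k (phi_map k)" by (rule canonical_morphism_phi_map[OF k])
    fix \<phi> assume \<phi>: "canonical_morphism k \<phi>"
    show "\<phi> = phi_map k"
    proof (rule extensionalityI[of _ "sdaha_sub k"])
      fix C assume "C \<in> sdaha_sub k"
      then show "\<phi> C = phi_map k C"
        using canonical_morphism_unique[OF k \<phi>] phi_map_class[OF k] by (auto simp: sdaha_sub_classes)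
    qed (use \<phi> in \<open>simp_all add: canonical_morphism_def phi_map_def\<close>)
  qed
  then show ?thesis using phi_map_class[OF k a] by simp
qed

theorem theorem4:
  fixes r :: nat and h :: "dgen falg set"
  assumes "r \<ge> 2" and "h \<in> sdaha_sub r"
  shows "(\<forall>F\<in>Pas. std_rep h F = (\<lambda>k. 0)) \<longleftrightarrow>
         (\<exists>k0\<ge>r. \<forall>k\<ge>k0. phi k h = \<zero>\<^bsub>daha k\<^esub>)"
proof -
  obtain a where a: "a \<in> words_in (pos_gens r)" and h: "h = sdaha_class a"
    using assms(2) by (auto simp: sdaha_sub_classes)
  have asd: "a \<in> words_in sdaha_gens" using a pos_gens_sdaha by (rule words_in_mono)
  have phi0: "phi k h = \<zero>\<^bsub>daha k\<^esub> \<longleftrightarrow> a \<in> gl_ideal k" if "r \<le> k" for k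
  proof -
    have k: "2 \<le> k" "1 \<le> k" using assms(1) that by auto
    have ak: "a \<in> words_in (pos_gens k)" using a pos_gens_mono[OF that] by (rule words_in_mono)
    show ?thesis
      unfolding h phi_class[OF k(1) ak] daha_presented
      by (rule pres_class_zero_iff[OF gl_relators_words[OF k(2)] words_in_mono[OF ak pos_gens_daha]])
  qed
  show ?thesis
  proof
    assume "\<forall>F\<in>Pas. std_rep h F = (\<lambda>k. 0)"
    then have "actL a F = (\<lambda>k. 0)" if "F \<in> Pas" for F
      using that std_rep_class[OF asd that] by (simp add: h)
    then have "\<forall>k\<ge>r. phi k h = \<zero>\<^bsub>daha k\<^esub>"
      using actL_zero_imp_ideal[OF assms(1) a] phi0 by blast
    then show "\<exists>k0\<ge>r. \<forall>k\<ge>k0. phi k h = \<zero>\<^bsub>daha k\<^esub>" by blast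
  next
    assume "\<exists>k0\<ge>r. \<forall>k\<ge>k0. phi k h = \<zero>\<^bsub>daha k\<^esub>"
    then obtain k0 where k0: "r \<le> k0" "\<And>k. k0 \<le> k \<Longrightarrow> phi k h = \<zero>\<^bsub>daha k\<^esub>" by blast
    have "a \<in> gl_ideal k" if "k0 \<le> k" for k
      using k0(2)[OF that] phi0[of k] k0(1) that by simp
    then have "\<forall>\<^sub>F k in sequentially. a \<in> gl_ideal k"
      unfolding eventually_sequentially by blast
    then show "\<forall>F\<in>Pas. std_rep h F = (\<lambda>k. 0)"
      using std_rep_class[OF asd] actL_zero[OF asd] by (simp add: h)
  qed
qed

end
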